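(* Assume the Riemann hypothesis. Then for every positive integer $n$ there exists $t_n>0$ such that, for $t>t_n$, the function $Z^{(n+1)}(t)$ has exactly one zero between any two consecutive zeros of $Z^{(n)}(t)$.
   Context: Let $h(s)=\pi^{-s/2}\Gamma(s/2)$ and let $\theta(t)=\arg h(1/2+it)$ for real $t$, taken as a continuous (indeed real-analytic) function of $t$. The Hardy function is $Z(t)=e^{i\theta(t)}\zeta(1/2+it)$, which is real-valued for real $t$; $Z^{(n)}$ denotes its $n$-th derivative in $t$. *)

theory Defs
  imports "HOL-Complex_Analysis.Complex_Analysis"
begin

text \<open>
  The Riemann zeta function, as the analytic continuation of the Dirichlet series to
  the plane without the pole 1. The condition \<open>f 1 = 0\<close> only fixes the junk value at
  the pole, so that the description determines a total function.
\<close>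

definition zeta :: "complex \<Rightarrow> complex" where
  "zeta = (THE f. f holomorphic_on (- {1}) \<and>
                  (\<forall>s. Re s > 1 \<longrightarrow> (\<lambda>n. 1 / of_nat (Suc n) powr s) sums f s) \<and>
                  f 1 = 0)"

definition riemann_hypothesis :: bool where
  "riemann_hypothesis \<longleftrightarrow>
     (\<forall>s. zeta s = 0 \<and> 0 < Re s \<and> Re s < 1 \<longrightarrow> Re s = 1 / 2)"

definition hardy_h :: "complex \<Rightarrow> complex" where
  "hardy_h s = of_real pi powr (- s / 2) * Gamma (s / 2)"

text \<open>
  A continuous argument of \<open>hardy_h\<close> on the critical line is unique up to a constant in
  \<open>2 * pi * \<int>\<close>, on which the Hardy function does not depend; since \<open>hardy_h (1/2) > 0\<close>,
  the usual normalisation \<open>\<theta> 0 = 0\<close> selects one.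
\<close>

definition hardy_theta :: "real \<Rightarrow> real" where
  "hardy_theta = (THE \<theta>. continuous_on UNIV \<theta> \<and>
                         (\<forall>t. is_Arg (hardy_h (Complex (1/2) t)) (\<theta> t)) \<and>
                         \<theta> 0 = 0)"

text \<open>
  The values of the Hardy function are real, but this is a consequence of the functional
  equation; it is kept complex-valued here, as its formula stands, and hence
  differentiated with \<open>vector_derivative\<close>.
\<close>

definition hardy_Z :: "real \<Rightarrow> complex" where
  "hardy_Z t = exp (\<i> * of_real (hardy_theta t)) * zeta (Complex (1/2) t)"

definition hardy_Z_deriv :: "nat \<Rightarrow> real \<Rightarrow> complex" where
  "hardy_Z_deriv n = ((\<lambda>f t. vector_derivative f (at t)) ^^ n) hardy_Z"

definition consecutive_zeros :: "(real \<Rightarrow> 'a::zero) \<Rightarrow> real \<Rightarrow> real \<Rightarrow> bool" where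
  "consecutive_zeros f a b \<longleftrightarrow>
     a < b \<and> f a = 0 \<and> f b = 0 \<and> (\<forall>x. a < x \<and> x < b \<longrightarrow> f x \<noteq> 0)"

end

theory Submission
  imports Defs "HOL-Probability.Probability" "HOL-Real_Asymp.Real_Asymp"
begin

text \<open>
  The Hardy function extends to a function \<open>F\<close> that is holomorphic on the strip
  \<open>\<bar>Im t\<bar> < 1/4\<close> and real on the real axis. The property carried along the derivatives is:
  for every \<open>L\<close>, if \<open>Re t\<close> is large and \<open>t\<close> lies in the upper half of a thin strip, then \<open>F t \<noteq> 0\<close> and
  \<open>Im (F'/F) \<le> - L \<cdot> Im t\<close>. It forces \<open>F'/F\<close> to decrease strictly between real zeros, so together
  with Rolle's theorem \<open>F'\<close> has exactly one zero there.

  The property passes from \<open>F\<close> to \<open>F'\<close>. With \<open>q = F'/F\<close> one has \<open>F''/F' = q + q'/q\<close>, and since \<open>q\<close> maps the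
  upper half strip into the lower half plane, the Schwarz-Pick lemma gives \<open>\<bar>q'/q\<bar> \<le> 2 / Im t\<close>. On a half
  disc this is absorbed by an explicit harmonic barrier that is \<open>O(Im t)\<close> at the centre, so the constant \<open>L\<close>
  drops by a bounded amount only.

  The property for \<open>Z\<close> itself comes from \<open>\<xi>\<close>: under the Riemann hypothesis \<open>\<xi>(1/2 + i t)\<close> is an entire
  function of order 1 with only real zeros, so \<open>Im (f'/f) \<le> 0\<close> in the upper half plane. By the
  growth of the digamma function this quantity tends to minus infinity on a horizontal line above the
  critical strip, and the maximum principle propagates the decay down to the real axis. The functional equation and the growth of \<open>\<xi>\<close> are
  obtained from the theta function.
\<close>

section \<open>A maximum principle and logarithmic derivatives at real points\<close>

text \<open>The obstacle is the real axis, the bottom edge of every domain used. The zeros of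
  \<open>F\<close> there are poles of \<open>F'/F\<close>, and nothing is known about their spacing
  or about the size of \<open>F'/F\<close> between them. Only a sign survives: at every real point,
  zero or not, the upper limit of \<open>Im (F'/F)\<close> from above is at most 0. This is why the
  maximum principle takes its boundary values as one-sided upper limits. A sign on the axis does not
  give decay proportional to \<open>Im t\<close>; that comes from explicit barriers that are
  compared with \<open>F'/F\<close> on domains of fixed size sliding to the right. Quantifying over
  every \<open>L\<close>, each with its own threshold for \<open>Re t\<close>, is what allows
  iteration: a finite number of fixed losses in the constant and of shrinkings of the strip is
  harmless, and the price is a threshold that depends on \<open>n\<close>.\<close>

lemma Im_maximum_principle:
  assumes D: "open D" "connected D" "bounded D" and g: "g holomorphic_on D"
    and bd: "\<And>\<zeta> \<epsilon>. \<zeta> \<in> frontier D \<Longrightarrow> \<epsilon> > 0 \<Longrightarrow> eventually (\<lambda>z. Im (g z) < \<epsilon>) (at \<zeta> within D)"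
    and z: "z \<in> D"
  shows "Im (g z) \<le> 0"
proof (rule ccontr)
  assume "\<not> Im (g z) \<le> 0"
  define \<epsilon> where "\<epsilon> = Im (g z)"
  have \<epsilon>: "\<epsilon> > 0" using \<open>\<not> Im (g z) \<le> 0\<close> by (simp add: \<epsilon>_def)
  define K where "K = {w \<in> D. \<epsilon> \<le> Im (g w)}"
  have contg: "continuous_on D g" by (simp add: g holomorphic_on_imp_continuous_on)
  \<comment> \<open>A limit point of \<open>K\<close> on the frontier would contradict the frontier
    hypothesis, so \<open>K\<close> is compact inside \<open>D\<close>.\<close>
  have "closed K"
    unfolding closed_sequential_limits
  proof (intro allI impI, elim conjE)
    fix X l assume X: "\<forall>n. X n \<in> K" "X \<longlonglongrightarrow> l"
    have "l \<in> closure D"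
      using X unfolding K_def closure_sequential by blast
    moreover have "l \<notin> frontier D"
    proof
      assume l: "l \<in> frontier D"
      hence "l \<notin> D" using D(1) by (simp add: frontier_def interior_open)
      hence "filterlim X (at l within D) sequentially"
        using X unfolding filterlim_at K_def by (auto intro!: always_eventually)
      from filterlim_iff[THEN iffD1, OF this, rule_format, OF bd[OF l \<epsilon>]]
      have "eventually (\<lambda>n. Im (g (X n)) < \<epsilon>) sequentially" .
      then obtain n where "Im (g (X n)) < \<epsilon>" by (auto simp: eventually_sequentially)
      thus False using X(1) by (auto simp: K_def dest: spec[of _ n])
    qed
    ultimately have lD: "l \<in> D" using D(1) by (simp add: frontier_def interior_open)
    have "(\<lambda>n. g (X n)) \<longlonglongrightarrow> g l"
      by (rule continuous_on_tendsto_compose[OF contg X(2) lD]) (use X(1) K_def in auto)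
    hence "(\<lambda>n. Im (g (X n))) \<longlonglongrightarrow> Im (g l)" by (rule tendsto_Im)
    hence "\<epsilon> \<le> Im (g l)"
      by (rule LIMSEQ_le_const) (use X(1) K_def in auto)
    thus "l \<in> K" using lD by (simp add: K_def)
  qed
  moreover have "bounded K" using D(3) by (rule bounded_subset) (auto simp: K_def)
  ultimately have "compact K" by (simp add: compact_eq_bounded_closed)
  moreover have "K \<noteq> {}" using z by (auto simp: K_def \<epsilon>_def)
  moreover have "continuous_on K (\<lambda>w. Im (g w))"
    by (intro continuous_intros continuous_on_subset[OF contg]) (auto simp: K_def)
  ultimately obtain z1 where z1: "z1 \<in> K" "\<And>w. w \<in> K \<Longrightarrow> Im (g w) \<le> Im (g z1)"
    using continuous_attains_sup by metis
  have z1D: "z1 \<in> D" and z1e: "\<epsilon> \<le> Im (g z1)" using z1(1) by (auto simp: K_def)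
  have mx: "Im (g w) \<le> Im (g z1)" if "w \<in> D" for w
    using z1(2)[of w] z1e that by (cases "\<epsilon> \<le> Im (g w)") (auto simp: K_def)
  \<comment> \<open>\<open>exp (- \<i> * g)\<close> has modulus \<open>exp (Im g)\<close>, so a
    maximum of \<open>Im g\<close> is an interior maximum of a modulus.\<close>
  have "(\<lambda>w. exp (- \<i> * g w)) constant_on D"
    by (rule maximum_modulus_principle[OF _ D(1,2) D(1) order_refl z1D])
       (use g mx in \<open>auto intro!: holomorphic_intros simp: norm_exp_eq_Re\<close>)
  then obtain c where c: "\<And>w. w \<in> D \<Longrightarrow> exp (- \<i> * g w) = c"
    unfolding constant_on_def by blast
  have const: "Im (g w) = Im (g z1)" if "w \<in> D" for w
  proof -
    have "norm (exp (- \<i> * g w)) = norm (exp (- \<i> * g z1))" using c that z1D by simp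
    thus ?thesis by (simp add: norm_exp_eq_Re)
  qed
  \<comment> \<open>\<open>Im g\<close> is now constant, at a level of at least
    \<open>\<epsilon>\<close>; any frontier point of the bounded set \<open>D\<close> refutes
    this.\<close>
  have "frontier D \<noteq> {}"
  proof
    assume "frontier D = {}"
    hence "D = {} \<or> D = UNIV" by (simp add: frontier_eq_empty)
    thus False using z D(3) not_bounded_UNIV by auto
  qed
  then obtain \<zeta> where \<zeta>: "\<zeta> \<in> frontier D" by blast
  hence "\<zeta> \<in> closure D" "\<zeta> \<notin> D" using D(1) by (auto simp: frontier_def interior_open)
  hence "\<zeta> islimpt D" by (auto simp: closure_def)
  hence nt: "at \<zeta> within D \<noteq> bot" by (simp add: trivial_limit_within)
  have "eventually (\<lambda>z. z \<in> D) (at \<zeta> within D)" by (auto simp: eventually_at_filter)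
  with bd[OF \<zeta> \<epsilon>] have "eventually (\<lambda>z. False) (at \<zeta> within D)"
    by eventually_elim (use const z1e in force)
  thus False using nt by simp
qed

text \<open>This is the Schwarz-Pick inequality at the centre of a disc. The Cayley map that sends
  \<open>f c\<close> to 0 and the lower half plane to the unit disc has derivative of modulus
  \<open>1 / (2 * \<bar>Im (f c)\<bar>)\<close> at \<open>f c\<close>; the Schwarz lemma applies to
  its composition with \<open>f\<close>, rescaled to the unit disc.\<close>

lemma deriv_bound_lower_half_plane:
  assumes f: "f holomorphic_on ball c r" and r: "r > 0"
    and neg: "\<And>z. z \<in> ball c r \<Longrightarrow> Im (f z) < 0"
  shows "norm (deriv f c) \<le> 2 * \<bar>Im (f c)\<bar> / r"
proof -
  define w0 where "w0 = f c"
  have w0: "Im w0 < 0" using neg[of c] r by (simp add: w0_def)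
  define g where "g = (\<lambda>z. (f (c + of_real r * z) - w0) / (f (c + of_real r * z) - cnj w0))"
  have inb: "c + of_real r * z \<in> ball c r" if "norm z < 1" for z
    using that r by (simp add: dist_norm norm_mult)
  have nz: "f (c + of_real r * z) - cnj w0 \<noteq> 0" if "norm z < 1" for z
  proof
    assume "f (c + of_real r * z) - cnj w0 = 0"
    hence "Im (f (c + of_real r * z)) = - Im w0" by (simp add: complex_eq_iff)
    thus False using neg[OF inb[OF that]] w0 by simp
  qed
  have fc: "(\<lambda>z. f (c + of_real r * z)) holomorphic_on ball 0 1"
    by (rule holomorphic_on_compose_gen[OF _ f, unfolded o_def])
       (use inb in \<open>auto intro!: holomorphic_intros\<close>)
  have 1: "g holomorphic_on ball 0 1"
    unfolding g_def using nz by (intro holomorphic_intros fc) auto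
  have 2: "g 0 = 0" by (simp add: g_def w0_def)
  have 3: "norm (g z) < 1" if "norm z < 1" for z
  proof -
    define w where "w = f (c + of_real r * z)"
    have w: "Im w < 0" using neg[OF inb[OF that]] by (simp add: w_def)
    \<comment> \<open>The two squares differ by \<open>4 * Im w * Im w0 > 0\<close>:
      \<open>w\<close> is nearer to \<open>w0\<close> than to its reflection.\<close>
    have "(Im w - Im w0)\<^sup>2 < (Im w + Im w0)\<^sup>2"
      using mult_neg_neg[OF w w0] by (simp add: power2_eq_square algebra_simps)
    hence "norm (w - w0) < norm (w - cnj w0)"
      by (simp add: cmod_def)
    thus ?thesis using nz[OF that] by (simp add: g_def norm_divide w_def)
  qed
  have "norm (deriv g 0) \<le> 1" by (rule Schwarz_Lemma(2)[OF 1 2 3, of 0]) auto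
  moreover have "(g has_field_derivative (deriv f c * of_real r / (w0 - cnj w0))) (at 0)"
  proof -
    have "(f has_field_derivative deriv f c) (at (c + of_real r * 0))"
      using holomorphic_derivI[OF f open_ball, of c] r by simp
    moreover have "((\<lambda>z. c + of_real r * z) has_field_derivative of_real r) (at 0)"
      by (auto intro!: derivative_eq_intros)
    ultimately have d: "((\<lambda>z. f (c + of_real r * z)) has_field_derivative deriv f c * of_real r) (at 0)"
      by (rule DERIV_chain2)
    have wn: "w0 - cnj w0 \<noteq> 0" using w0 by (auto simp: complex_eq_iff)
    have "(g has_field_derivative
        ((deriv f c * of_real r) * (f (c + of_real r * 0) - cnj w0) -
          (f (c + of_real r * 0) - w0) * (deriv f c * of_real r)) /
        ((f (c + of_real r * 0) - cnj w0) * (f (c + of_real r * 0) - cnj w0))) (at 0)"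
      unfolding g_def
      using DERIV_divide[OF DERIV_diff[OF d DERIV_const] DERIV_diff[OF d DERIV_const] nz[of 0]] by simp
    also have "((deriv f c * of_real r) * (f (c + of_real r * 0) - cnj w0) -
          (f (c + of_real r * 0) - w0) * (deriv f c * of_real r)) /
        ((f (c + of_real r * 0) - cnj w0) * (f (c + of_real r * 0) - cnj w0)) =
        deriv f c * of_real r / (w0 - cnj w0)"
      using wn by (simp add: w0_def[symmetric])
    finally show ?thesis .
  qed
  hence "deriv g 0 = deriv f c * of_real r / (w0 - cnj w0)" by (rule DERIV_imp_deriv)
  moreover have "norm (w0 - cnj w0) = 2 * \<bar>Im w0\<bar>"
    by (simp add: complex_diff_cnj norm_mult)
  ultimately have "norm (deriv f c) * r / (2 * \<bar>Im w0\<bar>) \<le> 1"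
    using r by (simp add: norm_divide norm_mult)
  thus ?thesis using r w0 by (simp add: divide_simps w0_def mult.commute split: if_splits)
qed

text \<open>\<open>Im F\<close> vanishes at the real points near \<open>x\<close>, hence so does its
  derivative in the real direction, which is the imaginary part of
  \<open>deriv F (of_real x)\<close>.\<close>

lemma deriv_real_on_reals:
  assumes "open S" "F holomorphic_on S" and re: "\<And>x::real. of_real x \<in> S \<Longrightarrow> F (of_real x) \<in> \<real>"
    and x: "of_real x \<in> S"
  shows "deriv F (of_real x) \<in> \<real>"
proof -
  have "((\<lambda>x. F (of_real x)) has_vector_derivative deriv F (of_real x)) (at x)"
    by (rule has_vector_derivative_real_field) (use assms holomorphic_derivI in blast)
  hence "((\<lambda>x. Im (F (of_real x))) has_vector_derivative Im (deriv F (of_real x))) (at x)"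
    by (rule bounded_linear.has_vector_derivative[OF bounded_linear_Im])
  hence 1: "((\<lambda>x. Im (F (of_real x))) has_real_derivative Im (deriv F (of_real x))) (at x)"
    by (simp add: has_real_derivative_iff_has_vector_derivative)
  have "open ((of_real :: real \<Rightarrow> complex) -` S)"
    by (rule open_vimage[OF assms(1)]) (intro continuous_intros)
  hence ev: "eventually (\<lambda>y. (of_real y :: complex) \<in> S) (nhds x)"
    using eventually_nhds_in_open[of "(of_real :: real \<Rightarrow> complex) -` S" x] x by simp
  have "((\<lambda>x. 0) has_real_derivative Im (deriv F (of_real x))) (at x)"
    by (rule DERIV_cong_ev[THEN iffD1, OF refl _ refl 1], rule eventually_mono[OF ev])
       (use re in \<open>auto simp: complex_is_Real_iff\<close>)
  hence "Im (deriv F (of_real x)) = 0" using DERIV_unique DERIV_const by blast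
  thus ?thesis by (simp add: complex_is_Real_iff)
qed

lemma logderiv_power_mult:
  fixes w a :: complex
  assumes g: "(g has_field_derivative g') (at w)" and "w \<noteq> a" "g w \<noteq> 0"
  shows "deriv (\<lambda>w. (w - a) ^ n * g w) w / ((w - a) ^ n * g w) = of_nat n / (w - a) + g' / g w"
proof -
  define u where "u = w - a"
  have u: "u \<noteq> 0" using assms by (simp add: u_def)
  have "((\<lambda>w. (w - a) ^ n * g w) has_field_derivative
      (of_nat n * (w - a)^(n-1) * g w + (w - a)^n * g')) (at w)"
    by (auto intro!: derivative_eq_intros g)
  hence "deriv (\<lambda>w. (w - a) ^ n * g w) w = of_nat n * u^(n-1) * g w + u^n * g'"
    unfolding u_def by (rule DERIV_imp_deriv)
  thus ?thesis using u assms(3) unfolding u_def[symmetric]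
    by (cases n) (simp_all add: add_divide_distrib)
qed

text \<open>Near \<open>p\<close> one has \<open>F w = (w - p) ^ n * g w\<close> with
  \<open>g\<close> zero-free. The polar part \<open>n / (w - p)\<close> has nonpositive imaginary
  part above the axis, and \<open>g' / g\<close> is continuous and real at \<open>p\<close>. The
  point \<open>w\<close> with \<open>F w \<noteq> 0\<close> makes the order \<open>n\<close>
  finite.\<close>

lemma Im_logderiv_at_real_point:
  assumes S: "open S" "connected S" and F: "F holomorphic_on S"
    and re: "\<And>x::real. of_real x \<in> S \<Longrightarrow> F (of_real x) \<in> \<real>"
    and p: "of_real p \<in> S" and nz: "w \<in> S" "F w \<noteq> 0" and \<epsilon>: "\<epsilon> > 0"
  shows "eventually (\<lambda>z. Im (deriv F z / F z) < \<epsilon>) (at (of_real p) within {z. Im z > 0})"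
proof -
  have "\<exists>n g r. 0 < r \<and> ball (of_real p) r \<subseteq> S \<and> g holomorphic_on ball (of_real p) r \<and>
          (\<forall>w\<in>ball (of_real p) r. F w = (w - of_real p)^n * g w \<and> g w \<noteq> 0)"
  proof (cases "F (of_real p) = 0")
    case True
    have "\<not> F constant_on S"
      using True nz p unfolding constant_on_def by metis
    from holomorphic_factor_zero_nonconstant[OF F S p True this] show ?thesis by metis
  next
    case False
    have "continuous_on S F" by (simp add: F holomorphic_on_imp_continuous_on)
    then obtain e where e: "e > 0" "\<And>y. dist (of_real p) y < e \<Longrightarrow> y \<in> S \<Longrightarrow> F y \<noteq> 0"
      using continuous_on_avoid[of S F "of_real p" 0] p False by metis
    obtain d where d: "d > 0" "ball (of_real p) d \<subseteq> S"
      using S(1) p openE by blast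
    show ?thesis
      by (rule exI[of _ 0], rule exI[of _ F], rule exI[of _ "min e d"])
         (use e d holomorphic_on_subset[OF F, of "ball (of_real p) (min e d)"] in \<open>auto simp: subset_iff\<close>)
  qed
  then obtain n g r where r: "0 < r" "ball (of_real p) r \<subseteq> S" and g: "g holomorphic_on ball (of_real p) r"
    and Fg: "\<And>w. w \<in> ball (of_real p) r \<Longrightarrow> F w = (w - of_real p)^n * g w"
    and gnz: "\<And>w. w \<in> ball (of_real p) r \<Longrightarrow> g w \<noteq> 0"
    by blast
  let ?B = "ball (of_real p :: complex) r"
  define h where "h = (\<lambda>w. deriv g w / g w)"
  have h: "continuous_on ?B h"
    unfolding h_def using gnz g
    by (intro holomorphic_on_imp_continuous_on holomorphic_intros holomorphic_deriv) auto
  have ld: "deriv F w / F w = of_nat n / (w - of_real p) + h w" if "w \<in> ?B" "w \<noteq> of_real p" for w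
  proof -
    have dg: "(g has_field_derivative deriv g w) (at w)"
      by (rule holomorphic_derivI[OF g open_ball that(1)])
    have "(F has_field_derivative deriv F w) (at w)"
      using holomorphic_derivI[OF F S(1)] r(2) that(1) by blast
    hence "((\<lambda>w. (w - of_real p)^n * g w) has_field_derivative deriv F w) (at w)"
      by (rule has_field_derivative_transform_within_open[OF _ open_ball that(1)]) (simp add: Fg)
    hence "deriv F w / F w = deriv (\<lambda>w. (w - of_real p)^n * g w) w / ((w - of_real p)^n * g w)"
      by (simp only: DERIV_imp_deriv Fg[OF that(1)])
    also have "\<dots> = of_nat n / (w - of_real p) + h w"
      unfolding h_def by (rule logderiv_power_mult[OF dg that(2) gnz[OF that(1)]])
    finally show ?thesis .
  qed
  \<comment> \<open>At nearby real points other than \<open>p\<close>, \<open>h\<close> is a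
    difference of real quantities; reality at \<open>p\<close> follows by continuity along
    \<open>X\<close>.\<close>
  have "h (of_real p) \<in> \<real>"
  proof -
    define X :: "nat \<Rightarrow> complex" where "X = (\<lambda>k. of_real (p + r / (2 + real k)))"
    have dX: "dist (of_real p) (X k) = r / (2 + real k)" for k
      unfolding X_def dist_of_real using r(1) by (simp add: dist_real_def)
    have XB: "X k \<in> ?B" "X k \<noteq> of_real p" for k
    proof -
      have "0 < r / (2 + real k)" "r / (2 + real k) < r"
        using r(1) by (auto simp: divide_less_eq add_pos_nonneg distrib_left)
      thus "X k \<in> ?B" "X k \<noteq> of_real p" using dX[of k] by auto
    qed
    have Xl: "X \<longlonglongrightarrow> of_real p"
    proof -
      have "(\<lambda>k. p + r / (2 + real k)) \<longlonglongrightarrow> p + 0"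
        by (intro tendsto_intros real_tendsto_divide_at_top[OF tendsto_const]
              filterlim_tendsto_add_at_top[OF tendsto_const] filterlim_real_sequentially)
      thus ?thesis unfolding X_def by (intro tendsto_of_real) simp
    qed
    have "h (X k) \<in> \<real>" for k
    proof -
      have "h (X k) = deriv F (X k) / F (X k) - of_nat n / (X k - of_real p)"
        using ld[OF XB] by simp
      also have "\<dots> \<in> \<real>"
      proof -
        have XS: "X k \<in> S" using XB(1)[of k] r(2) by blast
        have "deriv F (X k) \<in> \<real>" "F (X k) \<in> \<real>"
          using deriv_real_on_reals[OF S(1) F re] re XS unfolding X_def by blast+
        moreover have "X k \<in> \<real>" unfolding X_def by (rule Reals_of_real)
        ultimately show ?thesis by (intro Reals_diff Reals_divide Reals_of_nat Reals_of_real)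
      qed
      finally show ?thesis .
    qed
    moreover have "(\<lambda>k. h (X k)) \<longlonglongrightarrow> h (of_real p)"
      by (rule continuous_on_tendsto_compose[OF h Xl]) (use XB r in auto)
    ultimately show ?thesis
      using closed_sequentially[OF closed_complex_Reals] by metis
  qed
  hence Imh: "Im (h (of_real p)) = 0" by (simp add: complex_is_Real_iff)
  have "isCont h (of_real p)"
    using h r(1) by (simp add: continuous_on_eq_continuous_at)
  hence "(\<lambda>w. Im (h w)) \<midarrow>of_real p\<rightarrow> 0"
    using Imh tendsto_Im[of h "h (of_real p)" "at (of_real p)"] by (simp add: isCont_def)
  hence "((\<lambda>w. Im (h w)) \<longlongrightarrow> 0) (at (of_real p) within {z. Im z > 0})"
    by (rule tendsto_mono[rotated]) (simp add: at_le)
  hence ev1: "eventually (\<lambda>w. Im (h w) < \<epsilon>) (at (of_real p) within {z. Im z > 0})"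
    using \<epsilon> by (rule order_tendstoD)
  have ev2: "eventually (\<lambda>w. w \<in> ?B) (at (of_real p) within {z. Im z > 0})"
    by (rule eventually_mono[OF eventually_at_ball[OF r(1)]]) auto
  have ev3: "eventually (\<lambda>w. Im w > 0) (at (of_real p) within {z. Im z > 0})"
    by (auto simp: eventually_at_filter)
  show ?thesis
    using ev1 ev2 ev3
  proof eventually_elim
    case (elim w)
    have "Im (of_nat n / (w - of_real p)) \<le> 0"
      using elim by (simp add: Im_divide divide_nonpos_nonneg)
    moreover have "w \<noteq> of_real p" using elim by auto
    ultimately show ?case using ld[of w] elim by simp
  qed
qed

section \<open>Decay of the logarithmic derivative in a strip\<close>

definition strip :: "real \<Rightarrow> complex set" where
  "strip Y = {z. \<bar>Im z\<bar> < Y}"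

text \<open>When \<open>F'/F\<close> is real on the real axis, a bound proportional to
  \<open>Im z\<close> is a statement about its derivative: dividing by \<open>Im z\<close> and
  letting it tend to 0 gives \<open>(F'/F)' \<le> - L\<close> between real zeros. The threshold
  \<open>X\<close> may depend on \<open>L\<close>.\<close>

definition logderiv_decays :: "(complex \<Rightarrow> complex) \<Rightarrow> real \<Rightarrow> bool" where
  "logderiv_decays F Y \<longleftrightarrow>
     (\<forall>L. \<exists>X. \<forall>z. X < Re z \<and> 0 < Im z \<and> Im z < Y \<longrightarrow>
        F z \<noteq> 0 \<and> Im (deriv F z / F z) \<le> - L * Im z)"

lemma strip_eq: "strip Y = {z. Im z < Y} \<inter> {z. Im z > - Y}"
  by (auto simp: strip_def)

lemma open_strip: "open (strip Y)"
  unfolding strip_eq by (intro open_Int open_halfspace_Im_lt open_halfspace_Im_gt)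

lemma connected_strip: "connected (strip Y)"
  unfolding strip_eq
  by (intro convex_connected convex_Int convex_halfspace_Im_lt convex_halfspace_Im_gt)

lemma of_real_in_strip: "Y > 0 \<Longrightarrow> of_real x \<in> strip Y"
  by (simp add: strip_def)

text \<open>On the half circle, the Poisson kernels of the half plane at the end points of the diameter
  add up to \<open>1 / Im w\<close>.\<close>

lemma half_disc_barrier:
  fixes w :: complex
  assumes "dist (of_real x) w = \<rho>" "Im w > 0"
  shows "Im (- 2 / (w - of_real (x + \<rho>)) - 2 / (w - of_real (x - \<rho>))) = 2 / Im w"
proof -
  define a b where "a = Re w - x" and "b = Im w"
  have b: "b > 0" using assms by (simp add: b_def)
  have "\<rho> \<ge> 0" using assms(1) zero_le_dist by metis
  have "a\<^sup>2 + b\<^sup>2 = \<rho>\<^sup>2"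
    using assms(1) \<open>\<rho> \<ge> 0\<close> by (auto simp: a_def b_def dist_norm cmod_def power2_commute)
  have p: "(a - \<rho>)\<^sup>2 + b\<^sup>2 > 0" "(a + \<rho>)\<^sup>2 + b\<^sup>2 > 0"
    using b by (simp_all add: add_nonneg_pos)
  have e1: "(a - \<rho>)\<^sup>2 + b\<^sup>2 = 2 * \<rho> * (\<rho> - a)" and e2: "(a + \<rho>)\<^sup>2 + b\<^sup>2 = 2 * \<rho> * (\<rho> + a)"
    using \<open>a\<^sup>2 + b\<^sup>2 = \<rho>\<^sup>2\<close> by (simp_all add: power2_eq_square algebra_simps)
  have nz: "\<rho> \<noteq> 0" "\<rho> - a \<noteq> 0" "\<rho> + a \<noteq> 0" using p e1 e2 by auto
  \<comment> \<open>The altitude theorem in the right triangle over the diameter.\<close>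
  have bb: "b * b = (\<rho> - a) * (\<rho> + a)"
    using \<open>a\<^sup>2 + b\<^sup>2 = \<rho>\<^sup>2\<close> by (simp add: power2_eq_square algebra_simps)
  have "Im (- 2 / (w - of_real (x + \<rho>)) - 2 / (w - of_real (x - \<rho>))) =
      2 * b / ((a - \<rho>)\<^sup>2 + b\<^sup>2) + 2 * b / ((a + \<rho>)\<^sup>2 + b\<^sup>2)"
    by (simp add: Im_divide a_def b_def algebra_simps)
  also have "\<dots> = b / (\<rho> * (\<rho> - a)) + b / (\<rho> * (\<rho> + a))"
    unfolding e1 e2 by simp
  also have "\<dots> = 2 * b / ((\<rho> - a) * (\<rho> + a))"
    using nz by (simp add: divide_simps) (simp add: algebra_simps)
  also have "\<dots> = 2 / b" using b unfolding bb[symmetric] by simp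
  finally show ?thesis by (simp add: b_def)
qed

text \<open>The disc of radius \<open>Im w\<close> about \<open>w\<close> is the largest one that
  stays in the upper half plane. For \<open>q = F'/F\<close> the Schwarz-Pick bound on
  \<open>deriv q w\<close> carries the factor \<open>\<bar>Im (q w)\<bar>\<close>, which is at most
  \<open>norm (q w)\<close>; so the size of \<open>q\<close> drops out of the bound on
  \<open>q' / q\<close>.\<close>

lemma logderiv_deriv_bound:
  assumes F: "F holomorphic_on ball w (Im w)" and w: "Im w > 0"
    and H: "\<And>z. z \<in> ball w (Im w) \<Longrightarrow> F z \<noteq> 0 \<and> Im (deriv F z / F z) < 0"
  shows "deriv F w \<noteq> 0"
    "Im (deriv (deriv F) w / deriv F w) \<le> Im (deriv F w / F w) + 2 / Im w"
proof -
  define q where "q = (\<lambda>z. deriv F z / F z)"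
  have wb: "w \<in> ball w (Im w)" using w by simp
  have F': "deriv F holomorphic_on ball w (Im w)" by (intro holomorphic_deriv F) auto
  have q: "q holomorphic_on ball w (Im w)"
    unfolding q_def using H by (intro holomorphic_intros F F') auto
  have qn: "Im (q w) < 0" using H[OF wb] by (simp add: q_def)
  have le: "norm (deriv q w) \<le> 2 * \<bar>Im (q w)\<bar> / Im w"
    by (rule deriv_bound_lower_half_plane[OF q w]) (use H q_def in auto)
  have nz: "F w \<noteq> 0" using H[OF wb] by simp
  show nz': "deriv F w \<noteq> 0" using qn by (auto simp: q_def)
  have "(q has_field_derivative (deriv (deriv F) w * F w - deriv F w * deriv F w) / (F w * F w)) (at w)"
    unfolding q_def using DERIV_divide[OF holomorphic_derivI[OF F' open_ball wb] holomorphic_derivI[OF F open_ball wb] nz] .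
  hence "deriv q w = (deriv (deriv F) w * F w - deriv F w * deriv F w) / (F w * F w)"
    by (rule DERIV_imp_deriv)
  hence eq: "deriv (deriv F) w / deriv F w = q w + deriv q w / q w"
    using nz nz' by (simp add: q_def field_simps)
  have "Im (deriv q w / q w) \<le> norm (deriv q w / q w)"
    using abs_Im_le_cmod abs_le_D1 by blast
  also have "\<dots> \<le> (2 * \<bar>Im (q w)\<bar> / Im w) / norm (q w)"
    unfolding norm_divide by (intro divide_right_mono le) auto
  also have "\<dots> = (2 / Im w) * (\<bar>Im (q w)\<bar> / norm (q w))" by simp
  also have "\<dots> \<le> (2 / Im w) * 1"
    using w by (intro mult_left_mono) (auto simp: divide_le_eq_1 abs_Im_le_cmod)
  finally show "Im (deriv (deriv F) w / deriv F w) \<le> Im (deriv F w / F w) + 2 / Im w"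
    unfolding eq by (simp add: q_def)
qed

lemma logderiv_decays_deriv:
  assumes Y: "Y > 0" and F: "F holomorphic_on strip Y"
    and re: "\<And>x::real. F (of_real x) \<in> \<real>"
    and dec: "logderiv_decays F Y"
  shows "logderiv_decays (deriv F) (Y / 4)"
  unfolding logderiv_decays_def
proof
  fix L :: real
  \<comment> \<open>The term \<open>64 / Y\<^sup>2\<close> pays for the barrier \<open>U\<close> at
    \<open>z\<close>, which is at most \<open>4 * Im z / \<rho>\<^sup>2\<close> with
    \<open>\<rho> = Y / 4\<close>.\<close>
  define L1 where "L1 = \<bar>L\<bar> + 64 / Y\<^sup>2"
  have L1: "L1 > 0" using Y by (simp add: L1_def add_nonneg_pos)
  obtain X where X: "\<And>z. X < Re z \<Longrightarrow> 0 < Im z \<Longrightarrow> Im z < Y \<Longrightarrow>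
      F z \<noteq> 0 \<and> Im (deriv F z / F z) \<le> - L1 * Im z"
    using dec unfolding logderiv_decays_def by metis
  have hol: "F holomorphic_on ball w (Im w)" if "Im w > 0" "Im w < Y / 2" for w
    using F
  proof (rule holomorphic_on_subset, intro subsetI)
    fix z assume "z \<in> ball w (Im w)"
    hence "\<bar>Im w - Im z\<bar> < Im w" using abs_Im_le_cmod[of "w - z"] by (simp add: dist_norm)
    thus "z \<in> strip Y" using that by (auto simp: strip_def)
  qed
  \<comment> \<open>A disc of radius \<open>Im w < Y / 2\<close> that touches the real axis stays
    below height \<open>Y\<close> and reaches less than \<open>Y\<close> to the left, so the assumed
    decay holds on all of it.\<close>
  have H: "F z \<noteq> 0 \<and> Im (deriv F z / F z) < 0"
    if "z \<in> ball w (Im w)" "Im w > 0" "Im w < Y / 2" "X + Y < Re w" for z w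
  proof -
    have "\<bar>Im w - Im z\<bar> < Im w" "\<bar>Re w - Re z\<bar> < Im w"
      using that(1) abs_Im_le_cmod[of "w - z"] abs_Re_le_cmod[of "w - z"] by (simp_all add: dist_norm)
    hence z: "X < Re z" "0 < Im z" "Im z < Y" using that by auto
    have "- L1 * Im z < 0" using L1 z by simp
    thus ?thesis using X[OF z] by auto
  qed
  have nz: "deriv F w \<noteq> 0" if "Im w > 0" "Im w < Y / 2" "X + Y < Re w" for w
    using logderiv_deriv_bound(1)[OF hol[OF that(1,2)] that(1)] H that by blast
  have bnd: "Im (deriv (deriv F) w / deriv F w) \<le> - L1 * Im w + 2 / Im w"
    if "Im w > 0" "Im w < Y / 2" "X + Y < Re w" for w
    using logderiv_deriv_bound(2)[OF hol[OF that(1,2)] that(1)] H that X[of w] Y by fastforce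
  show "\<exists>X. \<forall>z. X < Re z \<and> 0 < Im z \<and> Im z < Y / 4 \<longrightarrow>
      deriv F z \<noteq> 0 \<and> Im (deriv (deriv F) z / deriv F z) \<le> - L * Im z"
  \<comment> \<open>The margin \<open>2 * Y\<close> keeps the half disc of radius
    \<open>Y / 4\<close> about \<open>Re z\<close> inside the region where \<open>bnd\<close>
    holds.\<close>
  proof (rule exI[of _ "X + 2 * Y"], intro allI impI, elim conjE)
    fix z assume z: "X + 2 * Y < Re z" "0 < Im z" "Im z < Y / 4"
    define x0 \<rho> where "x0 = Re z" and "\<rho> = Y / 4"
    have \<rho>: "\<rho> > 0" using Y by (simp add: \<rho>_def)
    define D where "D = ball (of_real x0) \<rho> \<inter> {w. Im w > 0}"
    define U where "U = (\<lambda>w::complex. - 2 / (w - of_real (x0 + \<rho>)) - 2 / (w - of_real (x0 - \<rho>)))"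
    \<comment> \<open>On the arc the term \<open>2 / Im w\<close> of \<open>bnd\<close> equals
      \<open>Im (U w)\<close>; on the diameter the upper limit of \<open>Im (F''/F')\<close> is at
      most 0 and \<open>U\<close> only helps.\<close>
    define G where "G = (\<lambda>w. deriv (deriv F) w / deriv F w + of_real L1 * w - U w)"
    have inD: "Im w < Y / 2" "X + Y < Re w" if "dist (of_real x0) w \<le> \<rho>" for w
    proof -
      have "\<bar>Im w\<bar> \<le> \<rho>" "\<bar>x0 - Re w\<bar> \<le> \<rho>"
        using that abs_Im_le_cmod[of "of_real x0 - w"] abs_Re_le_cmod[of "of_real x0 - w"]
        by (simp_all add: dist_norm)
      hence "Im w \<le> Y / 4" "Re z - Y / 4 \<le> Re w" unfolding \<rho>_def x0_def by linarith+
      thus "Im w < Y / 2" "X + Y < Re w" using z(1) Y by linarith+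
    qed
    have F': "deriv F holomorphic_on strip Y" by (intro holomorphic_deriv F open_strip)
    have F'': "deriv (deriv F) holomorphic_on strip Y" by (intro holomorphic_deriv F' open_strip)
    define D' where "D' = {w. 0 < Im w} \<inter> {w. Im w < Y / 2} \<inter> {w. X + Y < Re w}"
    have D': "open D'" unfolding D'_def
      by (intro open_Int open_halfspace_Im_lt open_halfspace_Im_gt open_halfspace_Re_gt)
    have D'strip: "D' \<subseteq> strip Y" using Y by (auto simp: D'_def strip_def)
    have Ghol: "G holomorphic_on D'"
      unfolding G_def U_def
      by (intro holomorphic_intros holomorphic_on_subset[OF F' D'strip] holomorphic_on_subset[OF F'' D'strip])
         (use nz in \<open>auto simp: D'_def complex_eq_iff\<close>)
    have DD': "D \<subseteq> D'" using inD by (auto simp: D_def D'_def)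
    \<comment> \<open>The end points of the diameter are poles of \<open>U\<close>; there, as on the
      whole diameter, only this sign is used.\<close>
    have U0: "Im (U w) \<ge> 0" if "Im w > 0" for w
      using that by (simp add: U_def Im_divide divide_nonneg_nonneg)
    have "Im (G z) \<le> 0"
    proof (rule Im_maximum_principle[of D G z])
      show "open D" unfolding D_def by (intro open_Int open_ball open_halfspace_Im_gt)
      show "connected D" unfolding D_def
        by (intro convex_connected convex_Int convex_ball convex_halfspace_Im_gt)
      show "bounded D" unfolding D_def by (intro bounded_Int) auto
      show "G holomorphic_on D" by (rule holomorphic_on_subset[OF Ghol DD'])
      show "z \<in> D" using z \<rho> by (auto simp: D_def x0_def \<rho>_def dist_norm cmod_def)
      fix \<zeta> and \<epsilon> :: real assume \<zeta>: "\<zeta> \<in> frontier D" and \<epsilon>: "\<epsilon> > 0"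
      have cl: "closure D \<subseteq> cball (of_real x0) \<rho> \<inter> {w. Im w \<ge> 0}"
        by (rule closure_minimal) (auto simp: D_def intro!: closed_Int closed_halfspace_Im_ge)
      have \<zeta>': "dist (of_real x0) \<zeta> \<le> \<rho>" "Im \<zeta> \<ge> 0"
        using \<zeta> cl by (auto simp: frontier_def)
      have \<zeta>D: "\<zeta> \<notin> D" using \<zeta> \<open>open D\<close> by (simp add: frontier_def interior_open)
      show "eventually (\<lambda>w. Im (G w) < \<epsilon>) (at \<zeta> within D)"
      proof (cases "Im \<zeta> = 0")
        case True
        define p where "p = Re \<zeta>"
        have p: "\<zeta> = of_real p" using True by (simp add: p_def complex_eq_iff)
        have zs: "z \<in> strip Y" "deriv F z \<noteq> 0"
          using z nz[of z] Y by (auto simp: strip_def)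
        have re': "deriv F (of_real x) \<in> \<real>" for x
          by (rule deriv_real_on_reals[OF open_strip F]) (use re Y in \<open>auto simp: strip_def\<close>)
        have 1: "eventually (\<lambda>w. Im (deriv (deriv F) w / deriv F w) < \<epsilon> / 2) (at \<zeta> within {w. Im w > 0})"
          unfolding p by (rule Im_logderiv_at_real_point[OF open_strip connected_strip F' _ _ zs])
            (use re' Y \<epsilon> in \<open>auto simp: strip_def\<close>)
        have 2: "eventually (\<lambda>w. L1 * Im w < \<epsilon> / 2) (at \<zeta> within {w. Im w > 0})"
        proof -
          have "((\<lambda>w. L1 * Im w) \<longlongrightarrow> L1 * Im \<zeta>) (at \<zeta> within {w. Im w > 0})"
            by (intro tendsto_intros)
          thus ?thesis using True \<epsilon> by (intro order_tendstoD[of _ "L1 * Im \<zeta>"]) auto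
        qed
        have 3: "eventually (\<lambda>w. Im w > 0) (at \<zeta> within {w. Im w > 0})"
          by (auto simp: eventually_at_filter)
        have "eventually (\<lambda>w. Im (G w) < \<epsilon>) (at \<zeta> within {w. Im w > 0})"
          using 1 2 3 by eventually_elim (use U0 in \<open>fastforce simp: G_def\<close>)
        moreover have "at \<zeta> within D \<le> at \<zeta> within {w. Im w > 0}"
          by (rule at_le) (auto simp: D_def)
        ultimately show ?thesis by (simp add: le_filter_def)
      next
        case False
        hence i: "Im \<zeta> > 0" using \<zeta>' by simp
        hence d: "dist (of_real x0) \<zeta> = \<rho>" using \<zeta>D \<zeta>' by (auto simp: D_def)
        have "\<zeta> \<in> D'" using inD[OF \<zeta>'(1)] i by (simp add: D'_def)
        hence "isCont G \<zeta>"
          using Ghol D' holomorphic_on_imp_continuous_on continuous_on_eq_continuous_at by blast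
        hence "(\<lambda>w. Im (G w)) \<midarrow>\<zeta>\<rightarrow> Im (G \<zeta>)" unfolding isCont_def by (rule tendsto_Im)
        moreover have "Im (G \<zeta>) \<le> 0"
          using bnd[OF i inD[OF \<zeta>'(1)]] half_disc_barrier[OF d i] by (simp add: G_def U_def)
        ultimately have "eventually (\<lambda>w. Im (G w) < \<epsilon>) (at \<zeta>)"
          using \<epsilon> by (intro order_tendstoD[of _ "Im (G \<zeta>)"]) auto
        thus ?thesis by (rule filter_leD[OF at_le, rotated]) simp
      qed
    qed
    moreover have "Im (U z) \<le> 64 / Y\<^sup>2 * Im z"
    proof -
      \<comment> \<open>\<open>z\<close> lies vertically above the centre, at equal distance from
        the two poles of \<open>U\<close>.\<close>
      have "Im (U z) = 4 * Im z / (\<rho>\<^sup>2 + (Im z)\<^sup>2)"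
        by (simp add: U_def Im_divide x0_def)
      also have "\<dots> \<le> 4 * Im z / \<rho>\<^sup>2"
        using z \<rho> by (intro divide_left_mono) (auto simp: add_pos_nonneg)
      also have "\<dots> = 64 / Y\<^sup>2 * Im z" by (simp add: \<rho>_def power2_eq_square)
      finally show ?thesis .
    qed
    ultimately have "Im (deriv (deriv F) z / deriv F z) \<le> - \<bar>L\<bar> * Im z"
      by (simp add: G_def L1_def algebra_simps)
    also have "\<dots> \<le> - L * Im z" using z by (intro mult_right_mono) auto
    finally show "deriv F z \<noteq> 0 \<and> Im (deriv (deriv F) z / deriv F z) \<le> - L * Im z"
      using nz[of z] z Y by auto
  qed
qed

text \<open>The decay is used with \<open>L = 1\<close>. Since \<open>q = F'/F\<close> is real on
  the axis, its difference quotient at \<open>x\<close> with increment \<open>\<i> * y\<close> has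
  real part \<open>Im (q (x + \<i> * y)) / y \<le> -1\<close>. Hence \<open>q\<close> decreases
  strictly between consecutive zeros of \<open>F\<close> and vanishes at most once there.\<close>

lemma unique_critical_point:
  assumes Y: "Y > 0" and F: "F holomorphic_on strip Y"
    and re: "\<And>x::real. F (of_real x) \<in> \<real>"
    and dec: "logderiv_decays F Y"
  shows "\<exists>T>0. \<forall>a b. T < a \<and> a < b \<and> F (of_real a) = 0 \<and> F (of_real b) = 0 \<and>
           (\<forall>x. a < x \<and> x < b \<longrightarrow> F (of_real x) \<noteq> 0) \<longrightarrow>
           (\<exists>!u. a < u \<and> u < b \<and> deriv F (of_real u) = 0)"
proof -
  obtain X where X: "\<And>z. X < Re z \<Longrightarrow> 0 < Im z \<Longrightarrow> Im z < Y \<Longrightarrow>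
      F z \<noteq> 0 \<and> Im (deriv F z / F z) \<le> - 1 * Im z"
    using dec unfolding logderiv_decays_def by metis
  have F': "deriv F holomorphic_on strip Y" by (intro holomorphic_deriv F open_strip)
  have re': "deriv F (of_real x) \<in> \<real>" for x
    by (rule deriv_real_on_reals[OF open_strip F]) (use re Y in \<open>auto simp: strip_def\<close>)
  have dF: "((\<lambda>x. Re (F (of_real x))) has_real_derivative Re (deriv F (of_real x))) (at x)" for x
  proof -
    have "((\<lambda>x. F (of_real x)) has_vector_derivative deriv F (of_real x)) (at x)"
      by (intro has_vector_derivative_real_field holomorphic_derivI[OF F open_strip] of_real_in_strip Y)
    hence "((\<lambda>x. Re (F (of_real x))) has_vector_derivative Re (deriv F (of_real x))) (at x)"
      by (rule bounded_linear.has_vector_derivative[OF bounded_linear_Re])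
    thus ?thesis by (simp add: has_real_derivative_iff_has_vector_derivative)
  qed
  have Re0: "z = 0" if "z \<in> \<real>" "Re z = 0" for z :: complex
    using that by (simp add: complex_is_Real_iff complex_eq_iff)
  show ?thesis
  proof (rule exI[of _ "max 1 X"], intro conjI allI impI)
    show "max 1 X > 0" by simp
    fix a b assume "max 1 X < a \<and> a < b \<and> F (of_real a) = 0 \<and> F (of_real b) = 0 \<and>
           (\<forall>x. a < x \<and> x < b \<longrightarrow> F (of_real x) \<noteq> 0)"
    hence a: "X < a" "a < b" "F (of_real a) = 0" "F (of_real b) = 0"
      and nz: "\<And>x. a < x \<Longrightarrow> x < b \<Longrightarrow> F (of_real x) \<noteq> 0" by auto
    obtain u where u: "a < u" "u < b" "Re (deriv F (of_real u)) = 0"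
    proof -
      have "\<exists>u>a. u < b \<and> Re (F (of_real b)) - Re (F (of_real a)) = (b - a) * Re (deriv F (of_real u))"
        by (rule MVT2[OF a(2) dF])
      thus ?thesis using that a by auto
    qed
    define q where "q = (\<lambda>z. deriv F z / F z)"
    have dq: "\<exists>d. ((\<lambda>x. Re (q (of_real x))) has_real_derivative d) (at x) \<and> d \<le> -1"
      if x: "a < x" "x < b" for x
    proof -
      have nzx: "F (of_real x) \<noteq> 0" using nz x by simp
      have "\<exists>d. (q has_field_derivative d) (at (of_real x))"
        unfolding q_def
        using DERIV_divide[OF holomorphic_derivI[OF F' open_strip of_real_in_strip[OF Y]]
            holomorphic_derivI[OF F open_strip of_real_in_strip[OF Y]] nzx] by blast
      then obtain d where d: "(q has_field_derivative d) (at (of_real x))" by blast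
      have "((\<lambda>x. q (of_real x)) has_vector_derivative d) (at x)"
        by (rule has_vector_derivative_real_field[OF d])
      hence "((\<lambda>x. Re (q (of_real x))) has_vector_derivative Re d) (at x)"
        by (rule bounded_linear.has_vector_derivative[OF bounded_linear_Re])
      hence 1: "((\<lambda>x. Re (q (of_real x))) has_real_derivative Re d) (at x)"
        by (simp add: has_real_derivative_iff_has_vector_derivative)
      have qx: "Im (q (of_real x)) = 0"
        using re re' unfolding q_def complex_is_Real_iff[symmetric] by (intro Reals_divide) auto
      \<comment> \<open>Increments in the imaginary direction, all of height less than
        \<open>Y\<close>: the derivative along the axis is computed from points above it.\<close>
      define h where "h = (\<lambda>k::nat. \<i> * of_real (Y / (2 + real k)))"
      have hl: "filterlim h (at 0) sequentially"
      proof -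
        have "(\<lambda>k::nat. Y / (2 + real k)) \<longlonglongrightarrow> 0"
          by (intro real_tendsto_divide_at_top[OF tendsto_const]
              filterlim_tendsto_add_at_top[OF tendsto_const] filterlim_real_sequentially)
        hence "h \<longlonglongrightarrow> \<i> * of_real 0" unfolding h_def by (intro tendsto_intros)
        moreover have "h k \<noteq> 0" for k
        proof -
          have "Y / (2 + real k) \<noteq> 0" using Y by (simp add: add_nonneg_eq_0_iff)
          thus ?thesis unfolding h_def mult_eq_0_iff of_real_eq_0_iff by simp
        qed
        ultimately show ?thesis unfolding filterlim_at by simp
      qed
      have "(\<lambda>k. (q (of_real x + h k) - q (of_real x)) / h k) \<longlonglongrightarrow> d"
        using d hl unfolding DERIV_def by (rule filterlim_compose)
      hence lim: "(\<lambda>k. Re ((q (of_real x + h k) - q (of_real x)) / h k)) \<longlonglongrightarrow> Re d"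
        by (rule tendsto_Re)
      have "Re ((q (of_real x + h k) - q (of_real x)) / h k) \<le> -1" for k
      proof -
        define y where "y = Y / (2 + real k)"
        have hk: "h k = \<i> * of_real y" by (simp only: h_def y_def)
        have y: "y > 0" "y < Y" using Y by (auto simp: y_def divide_less_eq distrib_left intro: add_pos_nonneg)
        have "Im (q (of_real x + h k)) \<le> - 1 * y"
          using X[of "of_real x + h k"] x a y by (simp add: q_def hk)
        moreover have "Re ((q (of_real x + h k) - q (of_real x)) / h k) = Im (q (of_real x + h k)) / y"
          using y qx by (simp add: hk Re_divide power2_eq_square)
        moreover have "Im (q (of_real x + h k)) / y \<le> -1"
          using calculation(1) y by (simp add: divide_le_eq)
        ultimately show ?thesis by simp
      qed
      hence "Re d \<le> -1" using LIMSEQ_le_const2[OF lim] by blast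
      thus ?thesis using 1 by blast
    qed
    have q0: "Re (q (of_real v)) = 0" if "deriv F (of_real v) = 0" for v
      using that by (simp add: q_def)
    have uniq: False if "a < v" "v < w" "w < b" "deriv F (of_real v) = 0" "deriv F (of_real w) = 0" for v w
    proof -
      obtain d where d: "\<And>x. a < x \<Longrightarrow> x < b \<Longrightarrow>
          ((\<lambda>x. Re (q (of_real x))) has_real_derivative d x) (at x) \<and> d x \<le> -1"
        using dq by metis
      have "\<exists>u>v. u < w \<and> Re (q (of_real w)) - Re (q (of_real v)) = (w - v) * d u"
        by (rule MVT2[OF that(2)]) (use d that in auto)
      moreover have "Re (q (of_real w)) - Re (q (of_real v)) = 0"
        using q0 that(4,5) by simp
      ultimately obtain u where u: "v < u" "u < w" "(w - v) * d u = 0"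
        by metis
      thus False using d[of u] that by auto
    qed
    show "\<exists>!u. a < u \<and> u < b \<and> deriv F (of_real u) = 0"
    proof (rule ex1I[of _ u])
      show "a < u \<and> u < b \<and> deriv F (of_real u) = 0" using u Re0[OF re'] by auto
      fix v assume "a < v \<and> v < b \<and> deriv F (of_real v) = 0"
      thus "v = u" using uniq[of v u] uniq[of u v] u Re0[OF re'] by (cases v u rule: linorder_cases) auto
    qed
  qed
qed

section \<open>Entire functions with real zeros\<close>

text \<open>The local factor near \<open>a\<close> and the quotient by the power of
  \<open>w - a\<close> elsewhere agree where both are defined, so they glue to an entire
  function.\<close>

lemma entire_factor_zero:
  fixes g :: "complex \<Rightarrow> complex"
  assumes g: "g holomorphic_on UNIV" and nz: "g b \<noteq> 0"
  obtains g2 k where "g2 holomorphic_on UNIV" "\<And>w. g w = (w - a) ^ k * g2 w" "g2 a \<noteq> 0"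
proof (cases "g a = 0")
  case False
  show ?thesis by (rule that[of g 0]) (use g False in auto)
next
  case True
  have "\<not> g constant_on UNIV" using True nz unfolding constant_on_def by (metis UNIV_I)
  from holomorphic_factor_zero_nonconstant[OF g open_UNIV connected_UNIV UNIV_I True this]
  obtain h r n where h: "0 < r" "h holomorphic_on ball a r"
    and gh: "\<And>w. w \<in> ball a r \<Longrightarrow> g w = (w - a) ^ n * h w"
    and hnz: "\<And>w. w \<in> ball a r \<Longrightarrow> h w \<noteq> 0" by metis
  define g2 where "g2 = (\<lambda>w. if w \<in> ball a r then h w else g w / (w - a) ^ n)"
  have "g2 holomorphic_on (ball a r \<union> (UNIV - {a}))"
    unfolding g2_def
  proof (rule holomorphic_on_If_Un)
    show "(\<lambda>w. g w / (w - a) ^ n) holomorphic_on UNIV - {a}"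
      by (intro holomorphic_intros holomorphic_on_subset[OF g]) auto
  qed (use h gh in auto)
  moreover have "ball a r \<union> (UNIV - {a}) = UNIV" using h(1) by auto
  ultimately have "g2 holomorphic_on UNIV" by simp
  moreover have "g w = (w - a) ^ n * g2 w" for w
  proof (cases "w \<in> ball a r")
    case False
    hence "w \<noteq> a" using h(1) by auto
    thus ?thesis using False by (simp add: g2_def)
  qed (simp add: g2_def gh)
  moreover have "g2 a \<noteq> 0" using h(1) hnz[of a] by (simp add: g2_def)
  ultimately show ?thesis by (rule that)
qed

text \<open>The formula for the logarithmic derivative is carried through the induction, so that the
  finite product never has to be differentiated as a whole. A point of \<open>A\<close> where
  \<open>f\<close> does not vanish gets exponent 0.\<close>

lemma entire_factor_zeros:
  fixes f :: "complex \<Rightarrow> complex"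
  assumes f: "f holomorphic_on UNIV" and nz: "f b \<noteq> 0" and A: "finite A"
  shows "\<exists>n g. g holomorphic_on UNIV \<and> (\<forall>w. f w = (\<Prod>a\<in>A. (w - a) ^ n a) * g w) \<and>
           (\<forall>a\<in>A. g a \<noteq> 0) \<and>
           (\<forall>w. f w \<noteq> 0 \<longrightarrow> w \<notin> A \<longrightarrow>
              deriv f w / f w = (\<Sum>a\<in>A. of_nat (n a) / (w - a)) + deriv g w / g w)"
  using A
proof induction
  case empty
  show ?case using f by (intro exI[of _ "\<lambda>_. 0"] exI[of _ f]) auto
next
  case (insert a A)
  obtain n g where IH: "g holomorphic_on UNIV \<and> (\<forall>w. f w = (\<Prod>a\<in>A. (w - a) ^ n a) * g w) \<and>
           (\<forall>a\<in>A. g a \<noteq> 0) \<and>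
           (\<forall>w. f w \<noteq> 0 \<longrightarrow> w \<notin> A \<longrightarrow>
              deriv f w / f w = (\<Sum>a\<in>A. of_nat (n a) / (w - a)) + deriv g w / g w)"
    using insert.IH by (elim exE)
  have g: "g holomorphic_on UNIV" "\<And>w. f w = (\<Prod>a\<in>A. (w - a) ^ n a) * g w"
    and gA: "\<And>a. a \<in> A \<Longrightarrow> g a \<noteq> 0"
    and ld: "\<And>w. f w \<noteq> 0 \<Longrightarrow> w \<notin> A \<Longrightarrow>
              deriv f w / f w = (\<Sum>a\<in>A. of_nat (n a) / (w - a)) + deriv g w / g w"
    using IH by blast+
  have gb: "g b \<noteq> 0" using nz g(2)[of b] by auto
  obtain g2 k where g2: "g2 holomorphic_on UNIV" "\<And>w. g w = (w - a) ^ k * g2 w" "g2 a \<noteq> 0"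
    by (rule entire_factor_zero[OF g(1) gb, of a]) (rule that)
  define n' where "n' = n(a := k)"
  have n': "n' a = k" "\<And>c. c \<in> A \<Longrightarrow> n' c = n c" using insert.hyps by (auto simp: n'_def)
  have pr: "(\<Prod>c\<in>A. (w - c) ^ n' c) = (\<Prod>c\<in>A. (w - c) ^ n c)" for w
    by (intro prod.cong) (auto simp: n')
  have sm: "(\<Sum>c\<in>A. of_nat (n' c) / (w - c)) = (\<Sum>c\<in>A. of_nat (n c) / (w - c))" for w :: complex
    by (intro sum.cong) (auto simp: n')
  show ?case
  proof (intro exI[of _ n'] exI[of _ g2] conjI allI impI ballI)
    show "g2 holomorphic_on UNIV" by fact
    show "f w = (\<Prod>a\<in>insert a A. (w - a) ^ n' a) * g2 w" for w
      using insert.hyps by (simp add: n' pr g(2)[of w] g2(2)[of w] mult_ac)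
    show "g2 c \<noteq> 0" if "c \<in> insert a A" for c
      using that g2(3) gA[of c] g2(2)[of c] by auto
    fix w assume w: "f w \<noteq> 0" "w \<notin> insert a A"
    have "g w \<noteq> 0" using w(1) g(2)[of w] by auto
    hence "g2 w \<noteq> 0" using g2(2)[of w] by auto
    have "g = (\<lambda>w. (w - a) ^ k * g2 w)" using g2(2) by blast
    hence "deriv g w / g w = of_nat k / (w - a) + deriv g2 w / g2 w"
      using logderiv_power_mult[OF holomorphic_derivI[OF g2(1) open_UNIV UNIV_I], of w a k] w \<open>g2 w \<noteq> 0\<close>
      by auto
    thus "deriv f w / f w = (\<Sum>a\<in>insert a A. of_nat (n' a) / (w - a)) + deriv g2 w / g2 w"
      using ld[of w] w insert.hyps by (simp add: n' sm)
  qed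
qed

text \<open>\<open>G / (2 * M - G)\<close> maps the disc into the unit disc and vanishes at
  \<open>c\<close>, so by the Schwarz lemma its modulus is at most 1/2 on the concentric disc of
  half the radius, which means \<open>norm G \<le> 2 * M\<close> there. Cauchy's inequality with
  radii up to \<open>R / 4\<close> then gives \<open>2 * (2 * M) / (R / 4)\<^sup>2\<close>.\<close>

lemma Borel_Caratheodory_second_deriv:
  assumes G: "G holomorphic_on ball c R" and R: "R > 0" and Gc: "G c = 0"
    and M: "M > 0" "\<And>w. w \<in> ball c R \<Longrightarrow> Re (G w) < M"
    and w: "w \<in> cball c (R / 4)"
  shows "norm (deriv (deriv G) w) \<le> 64 * M / R\<^sup>2"
proof -
  define \<phi> where "\<phi> = (\<lambda>z. G (c + of_real R * z) / (2 * of_real M - G (c + of_real R * z)))"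
  have inb: "c + of_real R * z \<in> ball c R" if "norm z < 1" for z
    using that R by (simp add: dist_norm norm_mult)
  have nz: "2 * of_real M - G z \<noteq> 0" if "z \<in> ball c R" for z
  proof
    assume "2 * of_real M - G z = 0"
    hence "Re (G z) = 2 * M" by (simp add: complex_eq_iff)
    thus False using M(2)[OF that] M(1) by simp
  qed
  have Gc': "(\<lambda>z. G (c + of_real R * z)) holomorphic_on ball 0 1"
    by (rule holomorphic_on_compose_gen[OF _ G, unfolded o_def])
       (use inb in \<open>auto intro!: holomorphic_intros\<close>)
  have 1: "\<phi> holomorphic_on ball 0 1"
    unfolding \<phi>_def using nz inb by (intro holomorphic_intros Gc') auto
  have 2: "\<phi> 0 = 0" by (simp add: \<phi>_def Gc)
  have 3: "norm (\<phi> z) < 1" if "norm z < 1" for z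
  proof -
    define u where "u = G (c + of_real R * z)"
    have u: "Re u < M" using M(2)[OF inb[OF that]] by (simp add: u_def)
    have "0 < 4 * M * (M - Re u)" using M(1) u by simp
    hence "(Re u)\<^sup>2 + (Im u)\<^sup>2 < (2 * M - Re u)\<^sup>2 + (Im u)\<^sup>2"
      by (simp add: power2_eq_square algebra_simps)
    hence "norm u < norm (2 * of_real M - u)" by (simp add: cmod_def)
    thus ?thesis using nz[OF inb[OF that]] by (simp add: \<phi>_def norm_divide u_def)
  qed
  have Gb: "norm (G z) \<le> 2 * M" if z: "z \<in> ball c (R / 2)" for z
  proof -
    define v where "v = (z - c) / of_real R"
    have v: "norm v < 1 / 2" using z R by (simp add: v_def norm_divide dist_norm norm_minus_commute field_simps)
    have zv: "z = c + of_real R * v" using R by (simp add: v_def)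
    have zb: "z \<in> ball c R" using z R by auto
    have "norm (\<phi> v) \<le> norm v" using Schwarz_Lemma(1)[OF 1 2 3, of v] v by simp
    hence "norm (\<phi> v) \<le> 1 / 2" using v by simp
    hence "norm (G z) / norm (2 * of_real M - G z) \<le> 1 / 2"
      by (simp add: \<phi>_def zv norm_divide)
    hence "norm (G z) \<le> norm (2 * of_real M - G z) / 2"
      using nz[OF zb] by (simp add: field_simps)
    moreover have "norm (2 * of_real M - G z) \<le> 2 * M + norm (G z)"
      using norm_triangle_ineq4[of "2 * of_real M" "G z"] M(1) by simp
    ultimately show ?thesis by simp
  qed
  have sub: "ball w (R / 4) \<subseteq> ball c (R / 2)"
  proof
    fix z assume "z \<in> ball w (R / 4)"
    thus "z \<in> ball c (R / 2)" using w dist_triangle[of c z w] by simp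
  qed
  \<comment> \<open>The closed disc of radius \<open>R / 4\<close> may reach the edge of
    \<open>ball c (R / 2)\<close>, so Cauchy's inequality is used for smaller radii, followed by a
    limit.\<close>
  have "norm ((deriv ^^ 2) G w) \<le> fact 2 * (2 * M + 0) / (R / 4) ^ 2"
  proof (rule field_le_epsilon)
    fix e :: real assume "e > 0"
    have lim: "((\<lambda>\<rho>. fact 2 * (2 * M) / \<rho> ^ 2) \<longlongrightarrow> fact 2 * (2 * M) / (R / 4) ^ 2) (at_left (R / 4))"
      by (intro tendsto_intros) (use R in auto)
    have "eventually (\<lambda>\<rho>. norm ((deriv ^^ 2) G w) \<le> fact 2 * (2 * M) / \<rho> ^ 2) (at_left (R / 4))"
    proof -
      have "eventually (\<lambda>\<rho>. \<rho> \<in> {0<..<R/4}) (at_left (R / 4))"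
        using R by (intro eventually_at_leftI[of 0]) auto
      thus ?thesis
      proof eventually_elim
        case (elim \<rho>)
        have cb: "cball w \<rho> \<subseteq> ball c (R / 2)" using elim sub by (auto simp: subset_iff)
        have cb': "cball w \<rho> \<subseteq> ball c R" using cb R by (auto simp: subset_iff)
        have hol: "G holomorphic_on cball w \<rho>" by (rule holomorphic_on_subset[OF G cb'])
        show ?case
          by (rule Cauchy_inequality)
             (use elim cb Gb hol in \<open>auto intro: holomorphic_on_subset holomorphic_on_imp_continuous_on simp: dist_norm subset_iff\<close>)
      qed
    qed
    hence "norm ((deriv ^^ 2) G w) \<le> fact 2 * (2 * M) / (R / 4) ^ 2"
      using tendsto_lowerbound[OF lim] by simp
    thus "norm ((deriv ^^ 2) G w) \<le> fact 2 * (2 * M + 0) / (R / 4) ^ 2 + e" using \<open>e > 0\<close> by simp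
  qed
  thus ?thesis by (simp add: numeral_2_eq_2 field_simps)
qed


text \<open>Dividing out the zeros in a disc of radius \<open>R\<close> leaves a zero-free function whose logarithm has second
  derivative \<open>O(log M(R) / R\<^sup>2) = o(1)\<close> near the centre; each of the removed real zeros contributes
  negatively to \<open>Im (f'/f)\<close>.\<close>

lemma Im_logderiv_entire_real_zeros:
  fixes f :: "complex \<Rightarrow> complex"
  assumes f: "f holomorphic_on UNIV" and re: "\<And>x::real. f (of_real x) \<in> \<real>"
    and zr: "\<And>z. f z = 0 \<Longrightarrow> Im z = 0"
    and gr: "\<And>\<epsilon>::real. \<epsilon> > 0 \<Longrightarrow> \<exists>R0. \<forall>z. norm z \<ge> R0 \<longrightarrow> norm (f z) \<le> exp (\<epsilon> * (norm z)\<^sup>2)"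
    and z: "Im z > 0"
  shows "Im (deriv f z / f z) \<le> 0"
proof (rule field_le_epsilon)
  fix e :: real assume e: "e > 0"
  define y where "y = Im z"
  have y: "y > 0" using z by (simp add: y_def)
  \<comment> \<open>Chosen so that the final error \<open>64 * M / R\<^sup>2 * y\<close>, with
    \<open>M \<le> 17 * \<epsilon> * R\<^sup>2\<close>, is at most \<open>e\<close>.\<close>
  define \<epsilon> where "\<epsilon> = e / (64 * 17 * y)"
  have \<epsilon>: "\<epsilon> > 0" using e y by (simp add: \<epsilon>_def)
  \<comment> \<open>A non-real centre, so that \<open>f c \<noteq> 0\<close>.\<close>
  define c :: complex where "c = \<i>"
  have fc: "f c \<noteq> 0" using zr[of c] by (auto simp: c_def)
  obtain R0 where R0: "\<And>w. norm w \<ge> R0 \<Longrightarrow> norm (f w) \<le> exp (\<epsilon> * (norm w)\<^sup>2)" using gr[OF \<epsilon>] by auto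
  define k where "k = \<bar>ln (norm (f c))\<bar> + 1"
  have k: "k > 0" by (simp add: k_def add_nonneg_pos)
  \<comment> \<open>The demands on \<open>R\<close>: \<open>k\<close> is absorbed by
    \<open>\<epsilon> * R\<^sup>2\<close>, the growth bound holds on the circle of radius
    \<open>3 * R\<close> about \<open>c\<close>, and \<open>z\<close> and its projection to the real
    axis are within \<open>R / 4\<close> of \<open>c\<close>.\<close>
  define R where "R = Max {1, k / \<epsilon>, R0, 4 * (norm z + 1)}"
  have R: "R \<ge> 1" "R \<ge> k / \<epsilon>" "R \<ge> R0" "R \<ge> 4 * (norm z + 1)" unfolding R_def by simp_all
  have Rp: "R > 0" using R(1) by simp
  \<comment> \<open>On that circle \<open>norm w \<le> 4 * R\<close>, whence
    \<open>16 * \<epsilon> * R\<^sup>2\<close>; \<open>k\<close> accounts for the normalisation at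
    \<open>c\<close> and makes the bound on the real part strict.\<close>
  define M where "M = 16 * \<epsilon> * R\<^sup>2 + k"
  have M0: "M > 0" unfolding M_def using \<epsilon> k by (intro add_nonneg_pos) auto
  have "k \<le> \<epsilon> * R" using R(2) \<epsilon> by (simp add: divide_le_eq mult.commute)
  also have "\<dots> \<le> \<epsilon> * R\<^sup>2" using \<epsilon> R(1) by (intro mult_left_mono) (auto simp: power2_eq_square)
  finally have M17: "M \<le> 17 * \<epsilon> * R\<^sup>2" by (simp add: M_def)
  define A where "A = {w \<in> cball c R. f w = 0}"
  have finA: "finite A"
  proof (cases "f constant_on UNIV")
    case True
    hence const: "f w = f c" for w unfolding constant_on_def by (metis UNIV_I)
    have "f w \<noteq> 0" for w using const[of w] fc by simp
    hence "A = {}" by (auto simp: A_def)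
    thus ?thesis by simp
  next
    case False
    thus ?thesis unfolding A_def
      by (intro holomorphic_compact_finite_zeros[OF f open_UNIV connected_UNIV]) auto
  qed
  have Areal: "Im a = 0" if "a \<in> A" for a using that zr by (auto simp: A_def)
  obtain n g where gg: "g holomorphic_on UNIV \<and> (\<forall>w. f w = (\<Prod>a\<in>A. (w - a) ^ n a) * g w) \<and>
           (\<forall>a\<in>A. g a \<noteq> 0) \<and>
           (\<forall>w. f w \<noteq> 0 \<longrightarrow> w \<notin> A \<longrightarrow>
              deriv f w / f w = (\<Sum>a\<in>A. of_nat (n a) / (w - a)) + deriv g w / g w)"
    using entire_factor_zeros[OF f fc finA] by (elim exE)
  have g: "g holomorphic_on UNIV" and fg: "\<And>w. f w = (\<Prod>a\<in>A. (w - a) ^ n a) * g w"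
    and gA: "\<And>a. a \<in> A \<Longrightarrow> g a \<noteq> 0"
    and ld: "\<And>w. f w \<noteq> 0 \<Longrightarrow> w \<notin> A \<Longrightarrow>
              deriv f w / f w = (\<Sum>a\<in>A. of_nat (n a) / (w - a)) + deriv g w / g w"
    using gg by blast+
  define P where "P = (\<lambda>w. \<Prod>a\<in>A. (w - a) ^ n a)"
  have gnz: "g w \<noteq> 0" if "w \<in> cball c R" for w
  proof (cases "w \<in> A")
    case False
    hence "f w \<noteq> 0" using that by (simp add: A_def)
    thus ?thesis using fg[of w] by auto
  qed (rule gA)
  have Pc: "norm (P c) > 0" using fc fg[of c] by (auto simp: P_def)
  \<comment> \<open>A zero in \<open>A\<close> is within \<open>R\<close> of \<open>c\<close> and at
    least \<open>2 * R\<close> away from \<open>w\<close>, so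
    \<open>norm (P c) \<le> norm (P w)\<close>: dividing out the zeros does not spoil the growth
    bound relative to \<open>c\<close>.\<close>
  have sph: "norm (g w) \<le> exp (16 * \<epsilon> * R\<^sup>2) / norm (P c)" if w: "dist c w = 3 * R" for w
  proof -
    have n1: "norm w \<le> 4 * R" "norm w \<ge> R0"
      using norm_triangle_ineq2[of w c] norm_triangle_ineq2[of c w] norm_triangle_ineq4[of w c] w R
      by (simp_all add: dist_norm norm_minus_commute c_def)
    have "norm (f w) \<le> exp (\<epsilon> * (norm w)\<^sup>2)" by (rule R0[OF n1(2)])
    also have "(norm w)\<^sup>2 \<le> (4 * R)\<^sup>2" using n1(1) by (intro power_mono) auto
    hence "exp (\<epsilon> * (norm w)\<^sup>2) \<le> exp (16 * \<epsilon> * R\<^sup>2)"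
      using \<epsilon> by (simp add: power_mult_distrib)
    finally have fw: "norm (f w) \<le> exp (16 * \<epsilon> * R\<^sup>2)" .
    have "norm (P c) \<le> norm (P w)"
      unfolding P_def prod_norm[symmetric] norm_power
    proof (intro prod_mono conjI power_mono)
      fix a assume "a \<in> A"
      hence "dist c a \<le> R" by (simp add: A_def)
      moreover have "dist c w \<le> dist c a + dist w a" by (metis dist_triangle2 dist_commute)
      ultimately show "norm (c - a) \<le> norm (w - a)" using w Rp by (simp add: dist_norm)
    qed auto
    hence "norm (g w) * norm (P c) \<le> norm (g w) * norm (P w)" by (intro mult_left_mono) auto
    also have "\<dots> = norm (f w)" using fg[of w] by (simp add: P_def norm_mult)
    finally show ?thesis using fw Pc by (simp add: pos_le_divide_eq)
  qed
  have gball: "norm (g w) \<le> exp (16 * \<epsilon> * R\<^sup>2) / norm (P c)" if "w \<in> ball c (3 * R)" for w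
  proof (rule maximum_modulus_frontier[of g "ball c (3 * R)"])
    show "continuous_on (closure (ball c (3 * R))) g"
      using g holomorphic_on_imp_continuous_on continuous_on_subset by blast
    show "norm (g u) \<le> exp (16 * \<epsilon> * R\<^sup>2) / norm (P c)" if "u \<in> frontier (ball c (3 * R))" for u
      using that Rp sph[of u] by simp
  qed (use that g in \<open>auto intro: holomorphic_on_subset\<close>)
  obtain G0 where G0: "G0 holomorphic_on ball c R" "\<And>w. w \<in> ball c R \<Longrightarrow> g w = exp (G0 w)"
  proof (rule contractible_imp_holomorphic_log[of g "ball c R"])
    show "g holomorphic_on ball c R" using g by (rule holomorphic_on_subset) auto
    show "contractible (ball c R)" by (intro convex_imp_contractible convex_ball)
    show "g w \<noteq> 0" if "w \<in> ball c R" for w using gnz[of w] that by auto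
  qed (rule that)
  define G where "G = (\<lambda>w. G0 w - G0 c)"
  have G: "G holomorphic_on ball c R" unfolding G_def by (intro holomorphic_intros G0)
  have ReG: "Re (G w) < M" if w: "w \<in> ball c R" for w
  proof -
    have cb: "c \<in> ball c R" using Rp by simp
    have "exp (G w) = g w / g c"
      unfolding G_def exp_diff G0(2)[OF w, symmetric] G0(2)[OF cb, symmetric] ..
    hence "exp (Re (G w)) = norm (g w) / norm (g c)"
      by (metis norm_exp_eq_Re norm_divide)
    also have "\<dots> \<le> exp (16 * \<epsilon> * R\<^sup>2) / norm (P c) / norm (g c)"
      using w Rp by (intro divide_right_mono gball) auto
    also have "\<dots> = exp (16 * \<epsilon> * R\<^sup>2) / norm (f c)"
      using fg[of c] by (simp add: P_def norm_mult)
    also have "\<dots> = exp (16 * \<epsilon> * R\<^sup>2 - ln (norm (f c)))"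
      using fc by (simp add: exp_diff)
    finally have "Re (G w) \<le> 16 * \<epsilon> * R\<^sup>2 - ln (norm (f c))" by simp
    thus ?thesis by (simp add: M_def k_def)
  qed
  have dG: "deriv G w = deriv g w / g w" if w: "w \<in> ball c R" for w
  proof -
    have "(G0 has_field_derivative deriv G0 w) (at w)"
      by (rule holomorphic_derivI[OF G0(1) open_ball w])
    hence d: "((\<lambda>w. exp (G0 w)) has_field_derivative exp (G0 w) * deriv G0 w) (at w)"
      and d2: "(G has_field_derivative deriv G0 w) (at w)"
      unfolding G_def by (auto intro!: derivative_eq_intros)
    have "(g has_field_derivative exp (G0 w) * deriv G0 w) (at w)"
      by (rule has_field_derivative_transform_within_open[OF d open_ball w]) (simp add: G0(2))
    hence "deriv g w = g w * deriv G0 w" using G0(2)[OF w] by (simp add: DERIV_imp_deriv)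
    moreover have "g w \<noteq> 0" using gnz[of w] w by simp
    ultimately show ?thesis using DERIV_imp_deriv[OF d2] by simp
  qed
  \<comment> \<open>\<open>deriv G\<close> is real at the foot \<open>x0\<close> of
    \<open>z\<close>, so \<open>Im (deriv G z)\<close> is bounded by the change of
    \<open>deriv G\<close> along a segment of length \<open>y\<close>.\<close>
  define x0 :: complex where "x0 = of_real (Re z)"
  have nx0: "norm x0 \<le> norm z" by (simp add: x0_def abs_Re_le_cmod)
  have zc: "z \<in> cball c (R / 4)" "x0 \<in> cball c (R / 4)"
    using norm_triangle_ineq4[of c z] norm_triangle_ineq4[of c x0] R nx0
    by (simp_all add: dist_norm c_def)
  have sub: "cball c (R / 4) \<subseteq> ball c R" using Rp by auto
  have G': "deriv G holomorphic_on ball c R" by (intro holomorphic_deriv G) auto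
  have "norm (deriv G z - deriv G x0) \<le> (64 * M / R\<^sup>2) * norm (z - x0)"
  proof (rule field_differentiable_bound[of "cball c (R / 4)" _ "deriv (deriv G)"])
    fix w assume w: "w \<in> cball c (R / 4)"
    show "(deriv G has_field_derivative deriv (deriv G) w) (at w within cball c (R / 4))"
      using holomorphic_derivI[OF G' open_ball] w sub has_field_derivative_at_within by blast
    show "norm (deriv (deriv G) w) \<le> 64 * M / R\<^sup>2"
      by (rule Borel_Caratheodory_second_deriv[OF G Rp _ M0 ReG w]) (simp_all add: G_def)
  qed (use zc in auto)
  also have "norm (z - x0) = y" using y
    by (simp add: x0_def y_def cmod_def)
  also have "64 * M / R\<^sup>2 * y \<le> 64 * (17 * \<epsilon> * R\<^sup>2) / R\<^sup>2 * y"
    using M17 y by (intro mult_right_mono divide_right_mono) auto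
  also have "\<dots> = e" using Rp y by (simp add: \<epsilon>_def)
  finally have bound: "norm (deriv G z - deriv G x0) \<le> e" .
  \<comment> \<open>Away from the finitely many removed zeros \<open>g\<close> is a quotient of
    reals; the condition is closed and that set is dense.\<close>
  have greal: "g (of_real x) \<in> \<real>" for x :: real
  proof -
    define B where "B = {x::real. Im (g (of_real x)) = 0}"
    have contg: "continuous_on UNIV g" using g by (rule holomorphic_on_imp_continuous_on)
    have "closed B" unfolding B_def
      by (intro closed_Collect_eq continuous_intros continuous_on_compose2[OF contg]) auto
    moreover have "- (Re ` A) \<subseteq> B"
    proof
      fix x assume "x \<in> - (Re ` A)"
      have nA: "a \<noteq> of_real x" if "a \<in> A" for a
      proof
        assume "a = of_real x"
        hence "Re a = x" by simp
        thus False using that \<open>x \<in> - (Re ` A)\<close> by blast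
      qed
      have "(\<Prod>a\<in>A. (of_real x - a) ^ n a) \<in> \<real>"
        using Areal by (intro prod_in_Reals Reals_power Reals_diff) (auto simp: complex_is_Real_iff)
      moreover have "(\<Prod>a\<in>A. (of_real x - a) ^ n a) \<noteq> 0" using nA finA by auto
      moreover from this have "g (of_real x) = f (of_real x) / (\<Prod>a\<in>A. (of_real x - a) ^ n a)"
        using fg[of "of_real x"] by simp
      ultimately have "g (of_real x) \<in> \<real>" using re by (simp add: Reals_divide)
      thus "x \<in> B" by (simp add: B_def complex_is_Real_iff)
    qed
    ultimately have "closure (- (Re ` A)) \<subseteq> B" by (simp add: closure_minimal)
    moreover have "closure (- (Re ` A)) = UNIV"
      using finA by (simp add: closure_complement empty_interior_finite)
    ultimately show ?thesis by (auto simp: B_def complex_is_Real_iff)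
  qed
  have "deriv G x0 \<in> \<real>"
    using dG[of x0] zc(2) sub deriv_real_on_reals[OF open_UNIV g greal] greal
    by (auto simp: x0_def intro!: Reals_divide)
  hence "Im (deriv G x0) = 0" by (simp add: complex_is_Real_iff)
  hence "Im (deriv G z) \<le> e"
    using bound abs_Im_le_cmod[of "deriv G z - deriv G x0"] by simp
  moreover have "Im (\<Sum>a\<in>A. of_nat (n a) / (z - a)) \<le> 0"
    unfolding Im_sum
  proof (rule sum_nonpos)
    fix a assume "a \<in> A"
    thus "Im (of_nat (n a) / (z - a)) \<le> 0"
      using Areal[of a] z by (simp add: Im_divide divide_nonpos_nonneg)
  qed
  moreover have "deriv f z / f z = (\<Sum>a\<in>A. of_nat (n a) / (z - a)) + deriv G z"
  proof -
    have "z \<in> ball c R" using zc(1) sub by blast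
    moreover have "f z \<noteq> 0" "z \<notin> A" using zr[of z] z Areal[of z] by auto
    ultimately show ?thesis using ld dG by simp
  qed
  ultimately show "Im (deriv f z / f z) \<le> 0 + e" by simp
qed

text \<open>The barrier is \<open>sin (w - x0)\<close>, whose imaginary part
  \<open>cos (Re w - x0) * sinh (Im w)\<close> vanishes on the real axis and on the lines
  \<open>Re w = x0 \<plusminus> pi / 2\<close>. On a rectangle of width \<open>pi\<close> the decay
  is therefore needed on the top edge only; the sides use \<open>nonpos\<close>, the bottom the sign
  at real points.\<close>

lemma logderiv_decays_from_above:
  fixes f :: "complex \<Rightarrow> complex"
  assumes f: "f holomorphic_on UNIV" and re: "\<And>x::real. f (of_real x) \<in> \<real>"
    and zr: "\<And>z. f z = 0 \<Longrightarrow> Im z = 0"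
    and nonpos: "\<And>z. Im z > 0 \<Longrightarrow> Im (deriv f z / f z) \<le> 0"
    and Y: "Y > 0"
    and top: "\<And>L. \<exists>X. \<forall>x>X. Im (deriv f (Complex x Y) / f (Complex x Y)) \<le> - L"
  shows "logderiv_decays f Y"
  unfolding logderiv_decays_def
proof
  fix L :: real
  \<comment> \<open>The hyperbolic sine. The factor 2 in front of \<open>\<bar>L\<bar>\<close> comes
    from the bound \<open>y \<le> 2 * b y\<close> for \<open>y > 0\<close>.\<close>
  define b where "b = (\<lambda>y::real. (exp y - exp (- y)) / 2)"
  obtain X where X: "\<And>x. x > X \<Longrightarrow> Im (deriv f (Complex x Y) / f (Complex x Y)) \<le> - (2 * \<bar>L\<bar> * b Y)"
    using top[of "2 * \<bar>L\<bar> * b Y"] by blast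
  have Im_sin': "Im (sin (w - of_real x0)) = cos (Re w - x0) * b (Im w)" for w x0
    by (simp add: Im_sin b_def)
  have f': "deriv f holomorphic_on UNIV" by (intro holomorphic_deriv f) auto
  show "\<exists>X. \<forall>z. X < Re z \<and> 0 < Im z \<and> Im z < Y \<longrightarrow>
      f z \<noteq> 0 \<and> Im (deriv f z / f z) \<le> - L * Im z"
  \<comment> \<open>Half the width of the rectangle, \<open>pi / 2\<close>, is less than 2.\<close>
  proof (rule exI[of _ "X + 2"], intro allI impI, elim conjE)
    fix z assume z: "X + 2 < Re z" "0 < Im z" "Im z < Y"
    define x0 where "x0 = Re z"
    define G where "G = (\<lambda>w. deriv f w / f w + of_real (2 * \<bar>L\<bar>) * sin (w - of_real x0))"
    define D where "D = box (Complex (x0 - pi/2) 0) (Complex (x0 + pi/2) Y)"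
    have D: "w \<in> D \<longleftrightarrow> x0 - pi/2 < Re w \<and> Re w < x0 + pi/2 \<and> 0 < Im w \<and> Im w < Y" for w
      by (auto simp: D_def in_box_complex_iff)
    have nz: "f w \<noteq> 0" if "Im w > 0" for w using zr[of w] that by auto
    have hol: "G holomorphic_on {w. Im w > 0}"
      unfolding G_def using nz
      by (intro holomorphic_intros holomorphic_on_subset[OF f] holomorphic_on_subset[OF f']) auto
    have "Im (G z) \<le> 0"
    proof (rule Im_maximum_principle[of D G z])
      show "open D" "connected D" "bounded D"
        unfolding D_def by (auto intro: convex_connected bounded_box)
      show "G holomorphic_on D" by (rule holomorphic_on_subset[OF hol]) (auto simp: D)
      show "z \<in> D" using z by (simp add: D x0_def)
      fix \<zeta> and \<epsilon> :: real assume \<zeta>: "\<zeta> \<in> frontier D" and \<epsilon>: "\<epsilon> > 0"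
      have "closure D \<subseteq> cbox (Complex (x0 - pi/2) 0) (Complex (x0 + pi/2) Y)"
        unfolding D_def by (rule closure_minimal[OF box_subset_cbox closed_cbox])
      hence "\<zeta> \<in> cbox (Complex (x0 - pi/2) 0) (Complex (x0 + pi/2) Y)"
        using \<zeta> by (auto simp: frontier_def)
      hence \<zeta>c: "x0 - pi/2 \<le> Re \<zeta>" "Re \<zeta> \<le> x0 + pi/2" "0 \<le> Im \<zeta>" "Im \<zeta> \<le> Y"
        by (auto simp: in_cbox_complex_iff)
      have \<zeta>D: "\<zeta> \<notin> D" using \<zeta> \<open>open D\<close> by (simp add: frontier_def interior_open)
      show "eventually (\<lambda>w. Im (G w) < \<epsilon>) (at \<zeta> within D)"
      proof (cases "Im \<zeta> = 0")
        case True
        define p where "p = Re \<zeta>"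
        have p: "\<zeta> = of_real p" using True by (simp add: p_def complex_eq_iff)
        have 1: "eventually (\<lambda>w. Im (deriv f w / f w) < \<epsilon> / 2) (at \<zeta> within {w. Im w > 0})"
          unfolding p
          by (rule Im_logderiv_at_real_point[OF open_UNIV connected_UNIV f re UNIV_I UNIV_I nz[OF z(2)]])
             (use \<epsilon> in simp)
        have 2: "eventually (\<lambda>w. Im (of_real (2 * \<bar>L\<bar>) * sin (w - of_real x0)) < \<epsilon> / 2) (at \<zeta> within {w. Im w > 0})"
        proof -
          have "((\<lambda>w. Im (of_real (2 * \<bar>L\<bar>) * sin (w - of_real x0))) \<longlongrightarrow>
              Im (of_real (2 * \<bar>L\<bar>) * sin (\<zeta> - of_real x0))) (at \<zeta> within {w. Im w > 0})"
            by (intro tendsto_intros)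
          moreover have "Im (of_real (2 * \<bar>L\<bar>) * sin (\<zeta> - of_real x0)) = 0"
            using True Im_sin'[of \<zeta> x0] by (simp add: b_def)
          ultimately show ?thesis using \<epsilon> by (intro order_tendstoD[of _ 0]) auto
        qed
        have "eventually (\<lambda>w. Im (G w) < \<epsilon>) (at \<zeta> within {w. Im w > 0})"
          using 1 2
        proof eventually_elim
          case (elim w)
          have "Im (G w) = Im (deriv f w / f w) + Im (of_real (2 * \<bar>L\<bar>) * sin (w - of_real x0))"
            unfolding G_def by (rule plus_complex.simps(2))
          thus ?case using elim by linarith
        qed
        moreover have "at \<zeta> within D \<le> at \<zeta> within {w. Im w > 0}"
          by (rule at_le) (auto simp: D)
        ultimately show ?thesis by (simp add: le_filter_def)
      next
        case False
        hence i: "Im \<zeta> > 0" using \<zeta>c by simp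
        have "open {w. Im w > 0}" by (rule open_halfspace_Im_gt)
        hence "isCont G \<zeta>"
          using holomorphic_on_imp_continuous_on[OF hol] i by (simp add: continuous_on_eq_continuous_at)
        hence lim: "(\<lambda>w. Im (G w)) \<midarrow>\<zeta>\<rightarrow> Im (G \<zeta>)" unfolding isCont_def by (rule tendsto_Im)
        have ImG: "Im (G \<zeta>) = Im (deriv f \<zeta> / f \<zeta>) + 2 * \<bar>L\<bar> * (cos (Re \<zeta> - x0) * b (Im \<zeta>))"
          using Im_sin'[of \<zeta> x0] by (simp add: G_def)
        have "Im (G \<zeta>) \<le> 0"
        proof (cases "Im \<zeta> = Y")
          case True
          have "Re \<zeta> > X" using \<zeta>c(1) z(1) pi_less_4 by (simp add: x0_def)
          moreover have "\<zeta> = Complex (Re \<zeta>) Y" using True by (simp add: complex_eq_iff)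
          ultimately have "Im (deriv f \<zeta> / f \<zeta>) \<le> - (2 * \<bar>L\<bar> * b Y)" using X[of "Re \<zeta>"] by simp
          moreover have "b Y \<ge> 0" using Y by (simp add: b_def)
          hence "2 * \<bar>L\<bar> * (cos (Re \<zeta> - x0) * b (Im \<zeta>)) \<le> 2 * \<bar>L\<bar> * (1 * b Y)"
            unfolding True by (intro mult_left_mono mult_right_mono) auto
          ultimately show ?thesis unfolding ImG by simp
        next
          case False
          hence "Re \<zeta> - x0 = pi/2 \<or> Re \<zeta> - x0 = - (pi/2)"
            using \<zeta>D \<zeta>c i by (auto simp: D)
          hence "cos (Re \<zeta> - x0) = 0" by (metis cos_minus cos_pi_half)
          thus ?thesis using nonpos[OF i] ImG by simp
        qed
        hence "eventually (\<lambda>w. Im (G w) < \<epsilon>) (at \<zeta>)"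
          using \<epsilon> by (intro order_tendstoD[OF lim]) auto
        thus ?thesis by (rule filter_leD[OF at_le, rotated]) simp
      qed
    qed
    moreover have "Im (G z) = Im (deriv f z / f z) + 2 * \<bar>L\<bar> * b (Im z)"
      using Im_sin'[of z x0] by (simp add: G_def x0_def)
    moreover have "L * Im z \<le> 2 * \<bar>L\<bar> * b (Im z)"
    proof -
      define p q where "p = exp (Im z)" and "q = exp (- Im z)"
      have "p \<ge> 1 + Im z" unfolding p_def by (rule exp_ge_add_one_self)
      moreover have "q \<le> 1" using z by (simp add: q_def)
      moreover have "2 * b (Im z) = p - q" by (simp add: b_def p_def q_def)
      ultimately have "Im z \<le> 2 * b (Im z)" by linarith
      hence "\<bar>L\<bar> * Im z \<le> \<bar>L\<bar> * (2 * b (Im z))" by (intro mult_left_mono) auto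
      moreover have "L * Im z \<le> \<bar>L\<bar> * Im z" using z by (intro mult_right_mono) auto
      ultimately show ?thesis by simp
    qed
    ultimately show "f z \<noteq> 0 \<and> Im (deriv f z / f z) \<le> - L * Im z" using nz[OF z(2)] by simp
  qed
qed

lemma logderiv_mult:
  assumes "(f has_field_derivative f') (at z)" "(g has_field_derivative g') (at z)"
    and "f z \<noteq> 0" "g z \<noteq> (0::complex)"
  shows "deriv (\<lambda>z. f z * g z) z / (f z * g z) = f' / f z + g' / g z"
proof -
  have "deriv (\<lambda>z. f z * g z) z = f' * g z + g' * f z"
    by (rule DERIV_imp_deriv[OF DERIV_mult[OF assms(1,2)]])
  thus ?thesis using assms(3,4) by (simp add: field_simps)
qed

text \<open>Logarithmic derivatives add, so a factor that contributes at most
  \<open>C * Im z\<close> turns the constant \<open>L + C\<close> into \<open>L\<close>. This serves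
  to pass from \<open>Xi\<close> to the Hardy function.\<close>

lemma logderiv_decays_mult_exp:
  assumes dec: "logderiv_decays f Y" and f: "f holomorphic_on strip Y"
    and a: "\<And>z. z \<in> strip Y \<Longrightarrow> X0 < Re z \<Longrightarrow> (a has_field_derivative a' z) (at z)"
    and bound: "\<And>z. X0 < Re z \<Longrightarrow> 0 < Im z \<Longrightarrow> Im z < Y \<Longrightarrow> a z \<noteq> 0 \<and> Im (a' z / a z) \<le> C * Im z"
  shows "logderiv_decays (\<lambda>z. f z * a z) Y"
  unfolding logderiv_decays_def
proof
  fix L
  obtain X where X: "\<And>z. X < Re z \<Longrightarrow> 0 < Im z \<Longrightarrow> Im z < Y \<Longrightarrow>
      f z \<noteq> 0 \<and> Im (deriv f z / f z) \<le> - (L + C) * Im z"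
    using dec unfolding logderiv_decays_def by metis
  show "\<exists>X. \<forall>z. X < Re z \<and> 0 < Im z \<and> Im z < Y \<longrightarrow> f z * a z \<noteq> 0 \<and>
       Im (deriv (\<lambda>z. f z * a z) z / (f z * a z)) \<le> - L * Im z"
  proof (rule exI[of _ "max X X0"], intro allI impI, elim conjE)
    fix z assume z: "max X X0 < Re z" "0 < Im z" "Im z < Y"
    have zs: "z \<in> strip Y" using z by (simp add: strip_def)
    have fz: "f z \<noteq> 0" "Im (deriv f z / f z) \<le> - (L + C) * Im z" using X[of z] z by auto
    have az: "a z \<noteq> 0" "Im (a' z / a z) \<le> C * Im z" using bound[of z] z by auto
    have "deriv (\<lambda>z. f z * a z) z / (f z * a z) = deriv f z / f z + a' z / a z"
      by (rule logderiv_mult[OF holomorphic_derivI[OF f open_strip zs] a]) (use fz az zs z in auto)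
    hence "Im (deriv (\<lambda>z. f z * a z) z / (f z * a z)) \<le> - (L + C) * Im z + C * Im z"
      using fz az by simp
    thus "f z * a z \<noteq> 0 \<and> Im (deriv (\<lambda>z. f z * a z) z / (f z * a z)) \<le> - L * Im z"
      using fz az by (simp add: algebra_simps)
  qed
qed

section \<open>The functional equation of the theta function\<close>

text \<open>Jacobi's theta function is \<open>1 + 2 * theta_tail x\<close>.\<close>

definition theta_tail :: "real \<Rightarrow> real" where
  "theta_tail x = (\<Sum>n. exp (- pi * (real (Suc n))\<^sup>2 * x))"

lemma theta_term_le:
  assumes "x > 0"
  shows "exp (- pi * (real (Suc n))\<^sup>2 * x) \<le> exp (- pi * x) * exp (- pi * x) ^ n"
proof -
  have "real (Suc n) \<le> (real (Suc n))\<^sup>2" by (simp add: power2_eq_square)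
  hence "exp (- pi * (real (Suc n))\<^sup>2 * x) \<le> exp (- pi * real (Suc n) * x)"
    using assms by (simp add: mult_left_mono)
  also have "\<dots> = exp (- pi * x) * exp (- pi * x) ^ n"
    by (simp add: exp_of_nat_mult[symmetric] exp_add[symmetric] algebra_simps)
  finally show ?thesis .
qed

lemma theta_tail_summable:
  assumes "x > 0"
  shows "summable (\<lambda>n. exp (- pi * (real (Suc n))\<^sup>2 * x))"
proof (rule summable_comparison_test')
  show "summable (\<lambda>n. exp (- pi * x) * exp (- pi * x) ^ n)"
    using assms by (intro summable_mult summable_geometric) simp
  show "norm (exp (- pi * (real (Suc n))\<^sup>2 * x)) \<le> exp (- pi * x) * exp (- pi * x) ^ n" if "n \<ge> 0" for n
    using theta_term_le[OF assms] by simp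
qed

section \<open>Poisson summation for the Gaussian\<close>

context
  fixes x :: real
  assumes x: "x > 0"
begin

definition gauss :: "complex \<Rightarrow> complex" where
  "gauss z = exp (- (of_real (pi * x) * z\<^sup>2))"

text \<open>The sum of all integer translates of the Gaussian, with \<open>n\<close> and
  \<open>-n\<close> paired to give an ordinary series.\<close>

definition gauss_per :: "complex \<Rightarrow> complex" where
  "gauss_per z = gauss z + (\<Sum>n. gauss (z + of_nat (Suc n)) + gauss (z - of_nat (Suc n)))"

lemma norm_gauss: "norm (gauss z) = exp (pi * x * ((Im z)\<^sup>2 - (Re z)\<^sup>2))"
  by (simp add: gauss_def norm_exp_eq_Re power2_eq_square algebra_simps)

text \<open>The inequality \<open>u\<^sup>2 \<ge> 2 * u - 1\<close> weakens the quadratic decay in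
  the exponent to a linear one, which gives a geometric majorant for the Weierstrass test.\<close>

lemma gauss_pair_bound:
  assumes "norm z \<le> B"
  shows "norm (gauss (z + of_nat (Suc n)) + gauss (z - of_nat (Suc n)))
     \<le> 2 * exp (pi * x * (B\<^sup>2 + 2 * B)) * exp (- pi * x) ^ n"
proof -
  have B: "\<bar>Re z\<bar> \<le> B" "\<bar>Im z\<bar> \<le> B"
    using assms abs_Re_le_cmod[of z] abs_Im_le_cmod[of z] by linarith+
  have im: "(Im z)\<^sup>2 \<le> B\<^sup>2" using power_mono[OF B(2), of 2] by simp
  have sq: "(u::real)\<^sup>2 \<ge> 2 * u - 1" for u
    using zero_le_power2[of "u - 1"] by (simp add: power2_eq_square algebra_simps)
  have b1: "(Im z)\<^sup>2 - (Re z + real (Suc n))\<^sup>2 \<le> B\<^sup>2 + 2 * B - real n"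
    using sq[of "Re z + real (Suc n)"] im B by simp
  have b2: "(Im z)\<^sup>2 - (Re z - real (Suc n))\<^sup>2 \<le> B\<^sup>2 + 2 * B - real n"
    using sq[of "real (Suc n) - Re z"] im B by (simp add: power2_commute)
  have px: "pi * x \<ge> 0" using x by simp
  have "norm (gauss (z + of_nat (Suc n))) \<le> exp (pi * x * (B\<^sup>2 + 2 * B - real n))"
    unfolding norm_gauss using mult_left_mono[OF b1 px] by simp
  moreover have "norm (gauss (z - of_nat (Suc n))) \<le> exp (pi * x * (B\<^sup>2 + 2 * B - real n))"
    unfolding norm_gauss using mult_left_mono[OF b2 px] by simp
  moreover have "exp (pi * x * (B\<^sup>2 + 2 * B - real n)) = exp (pi * x * (B\<^sup>2 + 2 * B)) * exp (- pi * x) ^ n"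
    by (simp add: exp_of_nat_mult[symmetric] exp_add[symmetric] algebra_simps)
  ultimately show ?thesis
    using norm_triangle_ineq[of "gauss (z + of_nat (Suc n))" "gauss (z - of_nat (Suc n))"] by linarith
qed

definition gauss_part :: "nat \<Rightarrow> complex \<Rightarrow> complex" where
  "gauss_part N z = gauss z + (\<Sum>n<N. gauss (z + of_nat (Suc n)) + gauss (z - of_nat (Suc n)))"

lemma gauss_part_uniform: "uniform_limit (cball 0 B) gauss_part gauss_per sequentially"
proof -
  have "uniform_limit (cball 0 B) (\<lambda>N z. \<Sum>n<N. gauss (z + of_nat (Suc n)) + gauss (z - of_nat (Suc n)))
      (\<lambda>z. \<Sum>n. gauss (z + of_nat (Suc n)) + gauss (z - of_nat (Suc n))) sequentially"
  proof (rule Weierstrass_m_test)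
    show "summable (\<lambda>n. 2 * exp (pi * x * (B\<^sup>2 + 2 * B)) * exp (- pi * x) ^ n)"
      using x by (intro summable_mult summable_geometric) simp
  qed (use gauss_pair_bound in \<open>simp add: dist_norm\<close>)
  thus ?thesis unfolding gauss_part_def gauss_per_def
    by (intro uniform_limit_add uniform_limit_const)
qed

lemma gauss_part_holomorphic: "gauss_part N holomorphic_on A"
  unfolding gauss_part_def gauss_def by (intro holomorphic_intros)

lemma gauss_per_holomorphic: "gauss_per holomorphic_on UNIV"
proof (rule holomorphic_uniform_sequence[of _ gauss_part])
  fix z :: complex
  have "uniform_limit (cball z 1) gauss_part gauss_per sequentially"
    by (rule uniform_limit_on_subset[OF gauss_part_uniform[of "norm z + 1"]])
       (auto simp: dist_norm intro!: order_trans[OF norm_triangle_sub[of _ z]] simp: norm_minus_commute)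
  thus "\<exists>d. 0 < d \<and> cball z d \<subseteq> UNIV \<and> uniform_limit (cball z d) gauss_part gauss_per sequentially"
    by (intro exI[of _ 1]) auto
qed (auto intro: gauss_part_holomorphic)

lemma gauss_per_0: "gauss_per 0 = of_real (1 + 2 * theta_tail x)"
proof -
  have t: "gauss (0 + of_nat (Suc n)) + gauss (0 - of_nat (Suc n)) = of_real (2 * exp (- pi * (real (Suc n))\<^sup>2 * x))" for n
    by (simp add: gauss_def exp_of_real[symmetric] mult_ac del: of_nat_Suc)
  have "(\<lambda>n. 2 * exp (- pi * (real (Suc n))\<^sup>2 * x)) sums (2 * theta_tail x)"
    unfolding theta_tail_def by (intro sums_mult summable_sums theta_tail_summable x)
  hence "(\<lambda>n. of_real (2 * exp (- pi * (real (Suc n))\<^sup>2 * x)) :: complex) sums of_real (2 * theta_tail x)"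
    by (rule sums_of_real)
  thus ?thesis unfolding gauss_per_def t by (simp add: sums_iff gauss_def)
qed

definition wave :: "int \<Rightarrow> complex \<Rightarrow> complex" where
  "wave m z = exp (- (2 * of_real pi * \<i> * of_int m * z))"

lemma wave_shift: "wave m (z + of_int k) = wave m z"
proof -
  have "wave m (z + of_int k) = wave m z * exp (2 * of_int (- (m * k)) * of_real pi * \<i>)"
    by (simp add: wave_def exp_add[symmetric] algebra_simps)
  also have "exp (2 * of_int (- (m * k)) * of_real pi * \<i>) = 1"
    by (auto simp: exp_eq_1 intro!: exI[of _ "- (m * k)"])
  finally show ?thesis by simp
qed

lemma wave_holomorphic: "wave m holomorphic_on A"
  unfolding wave_def by (intro holomorphic_intros)

lemma norm_wave_real: "norm (wave m (of_real u)) = 1"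
  by (simp add: wave_def norm_exp_eq_Re)

lemma gauss_wave_cont: "continuous_on A (\<lambda>u::real. gauss (of_real u) * wave m (of_real u))"
  unfolding gauss_def wave_def by (intro continuous_intros)

lemma has_integral_shift_real:
  fixes f :: "real \<Rightarrow> complex"
  assumes "(f has_integral I) {a + c..b + c}"
  shows "((\<lambda>u. f (u + c)) has_integral I) {a..b}"
  using has_integral_affinity'[of f I "a + c" "b + c" 1 c] assms by simp

text \<open>The waves have period 1, so the translates of the unit interval by
  \<open>-N, ..., N\<close> line up to a single interval of the real line.\<close>

lemma gauss_part_integral:
  "((\<lambda>u. gauss_part N (of_real u) * wave m (of_real u)) has_integral
     integral {- real N - 1/2..real N + 1/2} (\<lambda>u. gauss (of_real u) * wave m (of_real u))) {-1/2..1/2}"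
proof (induction N)
  case 0
  show ?case
    by (simp add: gauss_part_def) (intro integrable_integral integrable_continuous_real gauss_wave_cont)
next
  case (Suc N)
  let ?f = "\<lambda>u::real. gauss (of_real u) * wave m (of_real u)"
  have i: "?f integrable_on {a..b}" for a b
    by (intro integrable_continuous_real gauss_wave_cont)
  have r: "((\<lambda>u. ?f (u + real (Suc N))) has_integral integral {real N + 1/2..real (Suc N) + 1/2} ?f) {-1/2..1/2}"
    by (rule has_integral_shift_real) (use integrable_integral[OF i, of "real N + 1/2" "real (Suc N) + 1/2"] in \<open>simp add: algebra_simps\<close>)
  have l: "((\<lambda>u. ?f (u + (- real (Suc N)))) has_integral integral {- real (Suc N) - 1/2..- real N - 1/2} ?f) {-1/2..1/2}"
  proof (rule has_integral_shift_real)
    have "- 1 / 2 + - real (Suc N) = - real (Suc N) - 1 / 2" "1 / 2 + - real (Suc N) = - real N - 1 / 2"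
      by simp_all
    thus "(?f has_integral integral {- real (Suc N) - 1/2..- real N - 1/2} ?f)
        {- 1 / 2 + - real (Suc N)..1 / 2 + - real (Suc N)}"
      by (simp only: integrable_integral[OF i])
  qed
  have wr: "wave m (of_real (u + real k)) = wave m (of_real u)" for u k
    using wave_shift[of m "of_real u" "int k"] by simp
  have wl: "wave m (of_real (u + (- real k))) = wave m (of_real u)" for u k
    using wave_shift[of m "of_real u" "- int k"] by simp
  have eq: "gauss_part (Suc N) (of_real u) * wave m (of_real u) =
      gauss_part N (of_real u) * wave m (of_real u) + ?f (u + real (Suc N)) + ?f (u + (- real (Suc N)))" for u
    unfolding wr wl by (simp add: gauss_part_def algebra_simps)
  have "integral {- real (Suc N) - 1/2..real (Suc N) + 1/2} ?f =
      integral {- real (Suc N) - 1/2..- real N - 1/2} ?f + integral {- real N - 1/2..real (Suc N) + 1/2} ?f"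
    by (rule Henstock_Kurzweil_Integration.integral_combine[symmetric]) (auto intro: i)
  also have "integral {- real N - 1/2..real (Suc N) + 1/2} ?f =
      integral {- real N - 1/2..real N + 1/2} ?f + integral {real N + 1/2..real (Suc N) + 1/2} ?f"
    by (rule Henstock_Kurzweil_Integration.integral_combine[symmetric]) (auto intro: i)
  finally have s: "integral {- real (Suc N) - 1/2..real (Suc N) + 1/2} ?f =
     integral {- real N - 1/2..real N + 1/2} ?f + integral {real N + 1/2..real (Suc N) + 1/2} ?f
      + integral {- real (Suc N) - 1/2..- real N - 1/2} ?f" by simp
  show ?case unfolding s eq by (intro has_integral_add Suc.IH r l)
qed

text \<open>After scaling by \<open>c = sqrt (2 * pi * x)\<close> the integrand is a multiple of the
  standard normal density times a character, so the value is read off from the characteristic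
  function of the normal distribution at \<open>t\<close>.\<close>

lemma gauss_wave_integral:
  "integrable lborel (\<lambda>u::real. gauss (of_real u) * wave m (of_real u))"
  "(\<integral>u. gauss (of_real u) * wave m (of_real u) \<partial>lborel) = of_real (exp (- pi * (real_of_int m)\<^sup>2 * (1 / x)) / sqrt x)"
proof -
  define t where "t = - 2 * pi * real_of_int m / sqrt (2 * pi * x)"
  define c where "c = sqrt (2 * pi * x)"
  have c: "c > 0" "c\<^sup>2 = 2 * pi * x" using x by (simp_all add: c_def)
  define F where "F = (\<lambda>u::real. normal_density 0 1 u *\<^sub>R iexp (t * u))"
  have eq: "F (c * u) = of_real (1 / sqrt (2 * pi)) * (gauss (of_real u) * wave m (of_real u))" for u
  proof -
    have e: "t * (c * u) = - (2 * pi * real_of_int m * u)" using c(1) by (simp add: t_def c_def[symmetric])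
    have "(c * u)\<^sup>2 / 2 = pi * x * u\<^sup>2" by (simp add: power_mult_distrib c(2))
    hence "normal_density 0 1 (c * u) = 1 / sqrt (2 * pi) * exp (- (pi * x * u\<^sup>2))"
      by (simp add: normal_density_def)
    moreover have "gauss (of_real u) = of_real (exp (- (pi * x * u\<^sup>2)))"
      by (simp add: gauss_def exp_of_real[symmetric])
    moreover have "iexp (t * (c * u)) = wave m (of_real u)"
      unfolding e by (simp add: wave_def mult_ac)
    ultimately show ?thesis unfolding F_def by (simp add: scaleR_conv_of_real)
  qed
  have intF: "integrable lborel F"
  proof -
    have "integrable std_normal_distribution (\<lambda>u. iexp (t * u))"
    proof -
      interpret real_distribution std_normal_distribution by (rule real_dist_normal_dist)
      show ?thesis by (rule integrable_iexp) auto
    qed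
    thus ?thesis unfolding F_def
      by (subst (asm) integrable_density) (auto simp: normal_density_nonneg)
  qed
  have valF: "(\<integral>u. F u \<partial>lborel) = of_real (exp (- t\<^sup>2 / 2))"
  proof -
    have "(\<integral>u. F u \<partial>lborel) = char std_normal_distribution t"
      unfolding char_def F_def by (subst integral_density) (auto simp: normal_density_nonneg)
    thus ?thesis by (simp add: char_std_normal_distribution)
  qed
  have "integrable lborel (\<lambda>u. F (0 + c * u))"
    using intF c by (subst lborel_integrable_real_affine_iff) auto
  hence "integrable lborel (\<lambda>u. of_real (1 / sqrt (2 * pi)) * (gauss (of_real u) * wave m (of_real u)))"
    by (simp only: eq add_0_left)
  hence "integrable lborel (\<lambda>u. of_real (sqrt (2 * pi)) * (of_real (1 / sqrt (2 * pi)) * (gauss (of_real u) * wave m (of_real u))))"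
    by (rule integrable_mult_right)
  moreover have eq2: "of_real (sqrt (2 * pi)) * (of_real (1 / sqrt (2 * pi)) * w) = w" for w :: complex
    by (simp add: field_simps)
  ultimately show "integrable lborel (\<lambda>u::real. gauss (of_real u) * wave m (of_real u))"
    by (subst (asm) eq2)
  have "(\<integral>u. F u \<partial>lborel) = \<bar>c\<bar> *\<^sub>R (\<integral>u. F (0 + c * u) \<partial>lborel)"
    by (rule lborel_integral_real_affine) (use c in auto)
  also have "\<dots> = of_real c * (of_real (1 / sqrt (2 * pi)) * (\<integral>u. gauss (of_real u) * wave m (of_real u) \<partial>lborel))"
    using c by (simp add: eq scaleR_conv_of_real)
  finally have "of_real (exp (- t\<^sup>2 / 2)) =
      of_real (c / sqrt (2 * pi)) * (\<integral>u. gauss (of_real u) * wave m (of_real u) \<partial>lborel)"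
    by (simp add: valF)
  moreover have "c / sqrt (2 * pi) = sqrt x" by (simp add: c_def real_sqrt_mult)
  moreover have "t\<^sup>2 / 2 = pi * (real_of_int m)\<^sup>2 * (1 / x)"
    using x c by (simp add: t_def power_divide power_mult_distrib power2_eq_square c_def[symmetric])
  ultimately show "(\<integral>u. gauss (of_real u) * wave m (of_real u) \<partial>lborel) = of_real (exp (- pi * (real_of_int m)\<^sup>2 * (1 / x)) / sqrt x)"
    using x by (simp add: field_simps)
qed

text \<open>The coefficients of the partial sums have two limits, which must agree: the coefficient
  of \<open>gauss_per\<close> by uniform convergence, and the integral over the real line by
  dominated convergence.\<close>

lemma gauss_per_coeff:
  "((\<lambda>u. gauss_per (of_real u) * wave m (of_real u)) has_integral
     of_real (exp (- pi * (real_of_int m)\<^sup>2 * (1 / x)) / sqrt x)) {-1/2..1/2}"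
proof -
  let ?f = "\<lambda>u::real. gauss (of_real u) * wave m (of_real u)"
  have u1: "uniform_limit {-1/2..1/2} (\<lambda>N u. gauss_part N (of_real u)) (\<lambda>u::real. gauss_per (of_real u)) sequentially"
    by (rule uniform_limit_compose'[OF gauss_part_uniform[of 1]]) auto
  have u2: "uniform_limit {-1/2..1/2} (\<lambda>N u. gauss_part N (of_real u) * wave m (of_real u))
      (\<lambda>u::real. gauss_per (of_real u) * wave m (of_real u)) sequentially"
  proof (rule uniform_limitI)
    fix e :: real assume "e > 0"
    from uniform_limitD[OF u1 this]
    show "\<forall>\<^sub>F N in sequentially. \<forall>u\<in>{-1/2..1/2}. dist (gauss_part N (of_real u) * wave m (of_real u)) (gauss_per (of_real u) * wave m (of_real u)) < e"
      by eventually_elim (simp add: dist_norm left_diff_distrib[symmetric] norm_mult norm_wave_real)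
  qed
  obtain I J where IJ: "\<And>N. ((\<lambda>u. gauss_part N (of_real u) * wave m (of_real u)) has_integral I N) {-1/2..1/2}"
    "((\<lambda>u::real. gauss_per (of_real u) * wave m (of_real u)) has_integral J) {-1/2..1/2}" "I \<longlonglongrightarrow> J"
  proof (rule uniform_limit_integral[OF u2])
    show "continuous_on {-1/2..1/2} (\<lambda>u. gauss_part N (of_real u) * wave m (of_real u))" for N
      unfolding gauss_part_def gauss_def wave_def by (intro continuous_intros)
  qed auto
  have I: "I N = integral {- real N - 1/2..real N + 1/2} ?f" for N
    using has_integral_unique[OF IJ(1) gauss_part_integral] .
  have I2: "I N = (\<integral>u. indicator {- real N - 1/2..real N + 1/2} u *\<^sub>R ?f u \<partial>lborel)" for N
  proof -
    have "set_integrable lborel {- real N - 1/2..real N + 1/2} ?f"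
      unfolding set_integrable_def by (intro integrable_mult_indicator gauss_wave_integral) auto
    from set_borel_integral_eq_integral(2)[OF this] show ?thesis
      unfolding I set_lebesgue_integral_def by simp
  qed
  have "I \<longlonglongrightarrow> (\<integral>u. ?f u \<partial>lborel)"
    unfolding I2
  proof (rule integral_dominated_convergence[where w = "\<lambda>u. norm (?f u)"])
    show "integrable lborel (\<lambda>u. norm (?f u))" by (intro integrable_norm gauss_wave_integral)
    show "AE u in lborel. (\<lambda>N. indicator {- real N - 1/2..real N + 1/2} u *\<^sub>R ?f u) \<longlonglongrightarrow> ?f u"
    proof (rule AE_I2)
      fix u :: real
      have "eventually (\<lambda>N. indicator {- real N - 1/2..real N + 1/2} u *\<^sub>R ?f u = ?f u) sequentially"
        using eventually_ge_at_top[of "nat \<lceil>\<bar>u\<bar>\<rceil>"]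
      proof eventually_elim
        case (elim N)
        hence "\<bar>u\<bar> \<le> real N" by linarith
        thus ?case by (auto simp: indicator_def)
      qed
      thus "(\<lambda>N. indicator {- real N - 1/2..real N + 1/2} u *\<^sub>R ?f u) \<longlonglongrightarrow> ?f u"
        by (rule tendsto_eventually)
    qed
    show "AE u in lborel. norm (indicator {- real N - 1/2..real N + 1/2} u *\<^sub>R ?f u) \<le> norm (?f u)" for N
      by (auto simp: indicator_def)
  qed (use gauss_wave_integral(1) in auto)
  with IJ(3) have "J = (\<integral>u. ?f u \<partial>lborel)" by (rule LIMSEQ_unique)
  thus ?thesis using IJ(2) gauss_wave_integral(2) by simp
qed

text \<open>Multiplication by \<open>exp (2 * pi * \<i> * z)\<close> lowers the frequency by one,
  which is the source of the telescoping.\<close>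

lemma wave_product:
  "(exp (2 * of_real pi * \<i> * z) - 1) * wave m z = wave (m - 1) z - wave m z"
  by (simp add: wave_def algebra_simps exp_add[symmetric] exp_diff[symmetric])

lemma wave_integral_zero:
  assumes "m \<noteq> 0"
  shows "((\<lambda>u::real. wave m (of_real u)) has_integral 0) {-1/2..1/2}"
proof -
  define c where "c = - (2 * of_real pi * \<i> * of_int m)"
  have c: "c \<noteq> 0" using assms by (simp add: c_def)
  have d: "((\<lambda>u::real. wave m (of_real u) / c) has_vector_derivative wave m (of_real u)) (at u within S)" for u S
  proof -
    have "((\<lambda>z. wave m z / c) has_field_derivative wave m (of_real u)) (at (of_real u))"
      unfolding wave_def using c by (auto intro!: derivative_eq_intros simp: c_def)
    from has_vector_derivative_real_field[OF this] show ?thesis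
      by (rule has_vector_derivative_at_within)
  qed
  have "((\<lambda>u::real. wave m (of_real u)) has_integral wave m (of_real (1/2)) / c - wave m (of_real (-1/2)) / c) {-1/2..1/2}"
    by (rule fundamental_theorem_of_calculus) (use d in auto)
  moreover have "wave m (of_real (1/2)) = wave m (of_real (-1/2))"
    using wave_shift[of m "of_real (-1/2)" 1] by simp
  ultimately show ?thesis by simp
qed

text \<open>Poisson summation after Chernoff: the Fourier coefficients of \<open>g - g 0\<close>, for \<open>g\<close> the periodised
  Gaussian, are differences of consecutive Fourier coefficients of the quotient below, so their sum
  telescopes to something that tends to 0.\<close>

lemma quotient_exists:
  obtains k where "k holomorphic_on ball 0 1"
    "\<And>z. z \<in> ball 0 1 \<Longrightarrow> gauss_per z - gauss_per 0 = (exp (2 * of_real pi * \<i> * z) - 1) * k z"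
proof -
  define E where "E = (\<lambda>z::complex. exp (2 * of_real pi * \<i> * z) - 1)"
  define k where "k = (\<lambda>z. (gauss_per z - gauss_per 0) / E z)"
  have Enz: "E z \<noteq> 0" if z: "z \<in> ball 0 1 - {0}" for z
  proof
    assume "E z = 0"
    hence "exp (2 * of_real pi * \<i> * z) = 1" by (simp add: E_def)
    then obtain n :: int where "Im z = 0" "Re z = of_int n" by (auto simp: exp_eq_1)
    moreover from this have "\<bar>real_of_int n\<bar> < 1" using z abs_Re_le_cmod[of z] by simp
    ultimately have "z = 0" by (simp add: complex_eq_iff)
    thus False using z by simp
  qed
  have hol: "k holomorphic_on ball 0 1 - {0}"
    unfolding k_def using Enz unfolding E_def
    by (intro holomorphic_intros holomorphic_on_subset[OF gauss_per_holomorphic]) auto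
  have dE: "(E has_field_derivative 2 * of_real pi * \<i>) (at 0)"
    unfolding E_def by (auto intro!: derivative_eq_intros)
  have dg: "(gauss_per has_field_derivative deriv gauss_per 0) (at 0)"
    by (rule holomorphic_derivI[OF gauss_per_holomorphic open_UNIV UNIV_I])
  \<comment> \<open>The denominator vanishes only at 0 in the unit disc; the quotient extends there
    by the ratio of the derivatives.\<close>
  define c where "c = deriv gauss_per 0 / (2 * of_real pi * \<i>)"
  have "((\<lambda>h. ((gauss_per (0 + h) - gauss_per 0) / h) / ((E (0 + h) - E 0) / h)) \<longlongrightarrow> c) (at 0)"
    unfolding c_def using dE dg unfolding DERIV_def by (intro tendsto_divide) auto
  moreover have "eventually (\<lambda>h. ((gauss_per (0 + h) - gauss_per 0) / h) / ((E (0 + h) - E 0) / h) = k h) (at 0)"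
    unfolding eventually_at by (intro exI[of _ 1]) (auto simp: k_def E_def)
  ultimately have lim: "k \<midarrow>0\<rightarrow> c" by (rule Lim_transform_eventually)
  have "(\<lambda>y. if y = 0 then c else k y) holomorphic_on ball 0 1"
    by (rule removable_singularity[OF hol open_ball lim])
  moreover have "gauss_per z - gauss_per 0 = (exp (2 * of_real pi * \<i> * z) - 1) * (if z = 0 then c else k z)"
    if "z \<in> ball 0 1" for z
    using Enz[of z] that by (auto simp: k_def E_def)
  ultimately show ?thesis by (rule that)
qed

text \<open>One integration by parts. The boundary terms are bounded by \<open>2 * B\<close> and the
  remaining integral by \<open>B'\<close>, all divided by
  \<open>norm c = 2 * pi * \<bar>m\<bar>\<close>.\<close>

lemma wave_coeff_decay:
  assumes k: "k holomorphic_on ball 0 1"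
  shows "\<exists>C. \<forall>m I. m \<noteq> 0 \<longrightarrow> ((\<lambda>u::real. k (of_real u) * wave m (of_real u)) has_integral I) {-1/2..1/2}
            \<longrightarrow> norm I \<le> C / \<bar>real_of_int m\<bar>"
proof -
  have Sb: "of_real u \<in> ball (0::complex) 1" if "u \<in> {-1/2..1/2}" for u :: real using that by auto
  have k': "deriv k holomorphic_on ball 0 1" by (intro holomorphic_deriv k) auto
  have contk: "continuous_on {-1/2..1/2} (\<lambda>u::real. k (of_real u))"
    by (rule continuous_on_compose2[OF holomorphic_on_imp_continuous_on[OF k]]) (use Sb in \<open>auto intro!: continuous_intros\<close>)
  have contk': "continuous_on {-1/2..1/2} (\<lambda>u::real. deriv k (of_real u))"
    by (rule continuous_on_compose2[OF holomorphic_on_imp_continuous_on[OF k']]) (use Sb in \<open>auto intro!: continuous_intros\<close>)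
  have "bounded ((\<lambda>u::real. k (of_real u)) ` {-1/2..1/2})"
    by (rule compact_imp_bounded[OF compact_continuous_image[OF contk compact_Icc]])
  then obtain B where "\<forall>y\<in>(\<lambda>u::real. k (of_real u)) ` {-1/2..1/2}. norm y \<le> B"
    unfolding bounded_iff by blast
  hence B: "norm (k (of_real u)) \<le> B" if "u \<in> {-1/2..1/2}" for u :: real using that by blast
  have "bounded ((\<lambda>u::real. deriv k (of_real u)) ` {-1/2..1/2})"
    by (rule compact_imp_bounded[OF compact_continuous_image[OF contk' compact_Icc]])
  then obtain B' where "\<forall>y\<in>(\<lambda>u::real. deriv k (of_real u)) ` {-1/2..1/2}. norm y \<le> B'"
    unfolding bounded_iff by blast
  hence B': "norm (deriv k (of_real u)) \<le> B'" if "u \<in> {-1/2..1/2}" for u :: real using that by blast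
  have z0: "(0::real) \<in> {-1/2..1/2}" by simp
  have B0: "B \<ge> 0" "B' \<ge> 0"
    by (rule order_trans[OF norm_ge_zero B[OF z0]], rule order_trans[OF norm_ge_zero B'[OF z0]])
  have "norm I \<le> (2 * B + B') / \<bar>real_of_int m\<bar>" if m: "m \<noteq> 0"
    and I: "((\<lambda>u::real. k (of_real u) * wave m (of_real u)) has_integral I) {-1/2..1/2}" for m I
  proof -
    define c where "c = - (2 * of_real pi * \<i> * of_int m)"
    have c: "c \<noteq> 0" using m by (simp add: c_def)
    have nc: "norm c = 2 * pi * \<bar>real_of_int m\<bar>" by (simp add: c_def norm_mult)
    have d: "((\<lambda>u::real. k (of_real u) * (wave m (of_real u) / c)) has_vector_derivative
        (deriv k (of_real u) * (wave m (of_real u) / c) + k (of_real u) * wave m (of_real u))) (at u within T)"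
      if "u \<in> {-1/2..1/2}" for u T
    proof -
      have "(k has_field_derivative deriv k (of_real u)) (at (of_real u))"
        by (rule holomorphic_derivI[OF k open_ball Sb[OF that]])
      moreover have "((\<lambda>z. wave m z / c) has_field_derivative wave m (of_real u)) (at (of_real u))"
        unfolding wave_def using c by (auto intro!: derivative_eq_intros simp: c_def)
      ultimately have D: "((\<lambda>z. k z * (wave m z / c)) has_field_derivative
          deriv k (of_real u) * (wave m (of_real u) / c) + wave m (of_real u) * k (of_real u)) (at (of_real u))"
        by (rule DERIV_mult)
      have "((\<lambda>u. k (of_real u) * (wave m (of_real u) / c)) has_vector_derivative
          deriv k (of_real u) * (wave m (of_real u) / c) + wave m (of_real u) * k (of_real u)) (at u)"
        by (rule has_vector_derivative_real_field[where f = "\<lambda>z. k z * (wave m z / c)", OF D])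
      hence "((\<lambda>u. k (of_real u) * (wave m (of_real u) / c)) has_vector_derivative
          deriv k (of_real u) * (wave m (of_real u) / c) + wave m (of_real u) * k (of_real u)) (at u within T)"
        by (rule has_vector_derivative_at_within)
      thus ?thesis by (simp only: mult.commute[of "wave m (of_real u)" "k (of_real u)"])
    qed
    define V where "V = k (of_real (1/2)) * (wave m (of_real (1/2)) / c) - k (of_real (-1/2)) * (wave m (of_real (-1/2)) / c)"
    have "((\<lambda>u::real. deriv k (of_real u) * (wave m (of_real u) / c) + k (of_real u) * wave m (of_real u)) has_integral V) {-1/2..1/2}"
      unfolding V_def by (rule fundamental_theorem_of_calculus) (use d in auto)
    from has_integral_diff[OF this I]
    have J: "((\<lambda>u::real. deriv k (of_real u) * (wave m (of_real u) / c)) has_integral (V - I)) {-1/2..1/2}" by simp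
    have "norm (V - I) \<le> (B' / norm c) * measure lborel {-1/2..1/2::real}"
      by (rule has_integral_bound_real[OF _ finite.emptyI J])
         (use B' B0 in \<open>auto simp: norm_mult norm_divide norm_wave_real divide_right_mono\<close>)
    hence 1: "norm (V - I) \<le> B' / norm c" by simp
    have "norm V \<le> norm (k (of_real (1/2)) * (wave m (of_real (1/2)) / c)) + norm (k (of_real (-1/2)) * (wave m (of_real (-1/2)) / c))"
      unfolding V_def by (rule norm_triangle_ineq4)
    also have "\<dots> \<le> B / norm c + B / norm c"
      unfolding norm_mult norm_divide norm_wave_real
      using B[of "1/2"] B[of "-1/2"] by (intro add_mono) (simp_all add: divide_right_mono)
    finally have 2: "norm V \<le> 2 * B / norm c" by simp
    have "norm I \<le> norm V + norm (V - I)" using norm_triangle_ineq4[of V "V - I"] by simp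
    also have "\<dots> \<le> (2 * B + B') / norm c" using 1 2 by (simp add: add_divide_distrib)
    also have "\<dots> \<le> (2 * B + B') / \<bar>real_of_int m\<bar>"
    proof (rule divide_left_mono)
      show "\<bar>real_of_int m\<bar> \<le> norm c"
        unfolding nc using pi_ge_two mult_right_mono[of 1 "2 * pi" "\<bar>real_of_int m\<bar>"] by simp
    qed (use B0 m c in auto)
    finally show ?thesis .
  qed
  thus ?thesis by blast
qed

lemma theta_functional_aux:
  "1 + 2 * theta_tail x = (1 + 2 * theta_tail (1 / x)) / sqrt x"
proof -
  define q where "q = (\<lambda>m::int. exp (- pi * (real_of_int m)\<^sup>2 * (1 / x)) / sqrt x)"
  obtain k where k: "k holomorphic_on ball 0 1"
    and gk: "\<And>z. z \<in> ball 0 1 \<Longrightarrow> gauss_per z - gauss_per 0 = (exp (2 * of_real pi * \<i> * z) - 1) * k z"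
    by (rule quotient_exists) (rule that)
  have contk: "continuous_on {-1/2..1/2} (\<lambda>u::real. k (of_real u) * wave m (of_real u))" for m
    by (intro continuous_on_mult continuous_on_compose2[OF holomorphic_on_imp_continuous_on[OF k]]
         continuous_on_compose2[OF holomorphic_on_imp_continuous_on[OF wave_holomorphic[of m UNIV]]])
       (auto intro!: continuous_intros)
  define K where "K = (\<lambda>m. integral {-1/2..1/2} (\<lambda>u::real. k (of_real u) * wave m (of_real u)))"
  have K: "((\<lambda>u::real. k (of_real u) * wave m (of_real u)) has_integral K m) {-1/2..1/2}" for m
    unfolding K_def by (intro integrable_integral integrable_continuous_real contk)
  obtain C where C: "\<And>m. m \<noteq> 0 \<Longrightarrow> norm (K m) \<le> C / \<bar>real_of_int m\<bar>"
    using wave_coeff_decay[OF k] K by blast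
  \<comment> \<open>Subtracting the constant \<open>gauss_per 0\<close> changes only the coefficient
    with \<open>m = 0\<close>.\<close>
  have coeff: "of_real (q m) - (if m = 0 then gauss_per 0 else 0) = K (m - 1) - K m" for m
  proof -
    have "((\<lambda>u::real. k (of_real u) * wave (m - 1) (of_real u) - k (of_real u) * wave m (of_real u)) has_integral K (m - 1) - K m) {-1/2..1/2}"
      by (intro has_integral_diff K)
    hence 1: "((\<lambda>u::real. (gauss_per (of_real u) - gauss_per 0) * wave m (of_real u)) has_integral K (m - 1) - K m) {-1/2..1/2}"
    proof (rule has_integral_eq[rotated])
      fix u :: real assume "u \<in> {-1/2..1/2}"
      hence "of_real u \<in> ball (0::complex) 1" by auto
      note g = gk[OF this]
      have "k (of_real u) * wave (m - 1) (of_real u) - k (of_real u) * wave m (of_real u) =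
          k (of_real u) * ((exp (2 * of_real pi * \<i> * of_real u) - 1) * wave m (of_real u))"
        unfolding wave_product by (rule right_diff_distrib[symmetric])
      also have "\<dots> = (exp (2 * of_real pi * \<i> * of_real u) - 1) * k (of_real u) * wave m (of_real u)"
        by (simp only: mult_ac)
      finally show "k (of_real u) * wave (m - 1) (of_real u) - k (of_real u) * wave m (of_real u) =
          (gauss_per (of_real u) - gauss_per 0) * wave m (of_real u)"
        unfolding g .
    qed
    have w: "((\<lambda>u::real. wave m (of_real u)) has_integral (if m = 0 then 1 else 0)) {-1/2..1/2}"
    proof (cases "m = 0")
      case True
      have "((\<lambda>u::real. 1::complex) has_integral (measure lborel {-1/2..1/2::real} *\<^sub>R 1)) {-1/2..1/2}"
        by (rule has_integral_const_real)
      thus ?thesis using True by (simp add: wave_def)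
    qed (use wave_integral_zero in auto)
    have "((\<lambda>u::real. gauss_per (of_real u) * wave m (of_real u) - gauss_per 0 * wave m (of_real u)) has_integral
        of_real (q m) - gauss_per 0 * (if m = 0 then 1 else 0)) {-1/2..1/2}"
      unfolding q_def by (intro has_integral_diff gauss_per_coeff has_integral_mult_right w)
    hence "((\<lambda>u::real. (gauss_per (of_real u) - gauss_per 0) * wave m (of_real u)) has_integral
        of_real (q m) - (if m = 0 then gauss_per 0 else 0)) {-1/2..1/2}"
      by (simp add: left_diff_distrib if_distrib[of "\<lambda>c. gauss_per 0 * c"] cong: if_cong)
    thus ?thesis using 1 by (rule has_integral_unique)
  qed
  have q: "q (int n) = exp (- pi * (real n)\<^sup>2 * (1 / x)) / sqrt x" "q (- int n) = q (int n)" for n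
    by (simp_all add: q_def)
  \<comment> \<open>The sum of \<open>coeff\<close> over \<open>m\<close> from \<open>-N\<close> to
    \<open>N\<close>, folded by the evenness of \<open>q\<close>.\<close>
  have tele: "of_real (q 0 + (\<Sum>n<N. 2 * q (int (Suc n)))) - gauss_per 0 = K (- int N - 1) - K (int N)" for N
  proof (induction N)
    case 0
    show ?case using coeff[of 0] by simp
  next
    case (Suc N)
    have "of_real (q 0 + (\<Sum>n<Suc N. 2 * q (int (Suc n)))) - gauss_per 0 =
       (of_real (q 0 + (\<Sum>n<N. 2 * q (int (Suc n)))) - gauss_per 0) + of_real (q (int (Suc N))) + of_real (q (- int (Suc N)))"
      unfolding q(2) by simp
    also have "\<dots> = K (- int N - 1) - K (int N) + (K (int (Suc N) - 1) - K (int (Suc N))) + (K (- int (Suc N) - 1) - K (- int (Suc N)))"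
      using coeff[of "int (Suc N)"] coeff[of "- int (Suc N)"] Suc.IH by simp
    also have "\<dots> = K (- int (Suc N) - 1) - K (int (Suc N))"
    proof -
      have i: "int (Suc N) - 1 = int N" "- int (Suc N) = - int N - 1" by simp_all
      have "a - b + (b - c) + (d - a) = d - c" for a b c d :: complex by simp
      thus ?thesis unfolding i .
    qed
    finally show ?case .
  qed
  have Kn: "(\<lambda>N. C / real N) \<longlonglongrightarrow> 0" by (rule lim_const_over_n)
  have K1: "(\<lambda>N. K (int N)) \<longlonglongrightarrow> 0"
  proof (rule Lim_null_comparison[OF _ Kn])
    have "norm (K (int N)) \<le> C / real N" if "N \<ge> 1" for N using C[of "int N"] that by simp
    thus "\<forall>\<^sub>F N in sequentially. norm (K (int N)) \<le> C / real N"
      unfolding eventually_at_top_linorder by blast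
  qed
  have K2: "(\<lambda>N. K (- int N - 1)) \<longlonglongrightarrow> 0"
  proof (rule Lim_null_comparison[OF _ LIMSEQ_Suc[OF Kn]], rule always_eventually, rule allI)
    fix N
    have "\<bar>real_of_int (- int N - 1)\<bar> = real (Suc N)" by simp
    thus "norm (K (- int N - 1)) \<le> C / real (Suc N)" using C[of "- int N - 1"] by simp
  qed
  have "(\<lambda>N. of_real (q 0 + (\<Sum>n<N. 2 * q (int (Suc n)))) - gauss_per 0) \<longlonglongrightarrow> 0 - 0"
    unfolding tele by (intro tendsto_diff K1 K2)
  hence "(\<lambda>N. of_real ((q 0 + (\<Sum>n<N. 2 * q (int (Suc n)))) - (1 + 2 * theta_tail x)) :: complex) \<longlonglongrightarrow> of_real 0"
    by (simp add: gauss_per_0)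
  hence l1: "(\<lambda>N. (q 0 + (\<Sum>n<N. 2 * q (int (Suc n)))) - (1 + 2 * theta_tail x)) \<longlonglongrightarrow> 0"
    by (subst (asm) tendsto_of_real_iff)
  have "(\<lambda>n. exp (- pi * (real (Suc n))\<^sup>2 * (1 / x))) sums theta_tail (1 / x)"
    unfolding theta_tail_def by (intro summable_sums theta_tail_summable) (use x in simp)
  hence "(\<lambda>n. 2 * (exp (- pi * (real (Suc n))\<^sup>2 * (1 / x)) / sqrt x)) sums (2 * (theta_tail (1 / x) / sqrt x))"
    by (intro sums_mult sums_divide)
  hence "(\<lambda>n. 2 * q (int (Suc n))) sums (2 * (theta_tail (1 / x) / sqrt x))" by (simp only: q(1))
  hence "(\<lambda>N. (q 0 + (\<Sum>n<N. 2 * q (int (Suc n)))) - (1 + 2 * theta_tail x)) \<longlonglongrightarrow>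
      (q 0 + (2 * (theta_tail (1 / x) / sqrt x))) - (1 + 2 * theta_tail x)"
    unfolding sums_def by (intro tendsto_intros)
  hence "(q 0 + (2 * (theta_tail (1 / x) / sqrt x))) - (1 + 2 * theta_tail x) = 0"
    using l1 by (rule LIMSEQ_unique)
  thus ?thesis by (simp add: q_def add_divide_distrib)
qed

end

lemma theta_functional_equation:
  assumes "x > 0"
  shows "1 + 2 * theta_tail (1 / x) = sqrt x * (1 + 2 * theta_tail x)"
  using theta_functional_aux[OF assms] assms by simp

section \<open>The Euler product and zero-freeness on the line 1\<close>

definition dirichlet_zeta :: "complex \<Rightarrow> complex" where
  "dirichlet_zeta s = (\<Sum>n. 1 / of_nat (Suc n) powr s)"

lemma norm_of_nat_powr: "norm (of_nat n powr s :: complex) = real n powr Re s"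
proof -
  have "norm (of_real (real n) powr s :: complex) = real n powr Re s"
    by (subst norm_powr_real_powr) auto
  thus ?thesis by simp
qed

lemma of_nat_mult_powr:
  "(of_nat (m * n) :: complex) powr s = of_nat m powr s * of_nat n powr s"
proof -
  have "(of_real (real m) * of_real (real n) :: complex) powr s
      = of_real (real m) powr s * of_real (real n) powr s"
    by (rule powr_times_real) auto
  thus ?thesis by simp
qed

lemma summable_norm_dirichlet:
  assumes "Re s > 1"
  shows "summable (\<lambda>n. norm (of_nat n powr - s :: complex))"
  using assms by (simp add: norm_of_nat_powr summable_real_powr_iff)

lemma dirichlet_summable_on:
  assumes "Re s > 1"
  shows "(\<lambda>n. of_nat n powr - s :: complex) summable_on A"
  using summable_on_subset_banach[OF norm_summable_imp_summable_on[OF summable_norm_dirichlet[OF assms]]]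
  by blast

lemma dirichlet_zeta_sums:
  assumes "Re s > 1"
  shows "(\<lambda>n. 1 / of_nat (Suc n) powr s) sums dirichlet_zeta s"
proof -
  have "summable (\<lambda>n. of_nat n powr - s :: complex)"
    by (rule summable_norm_cancel[OF summable_norm_dirichlet[OF assms]])
  hence "summable (\<lambda>n. of_nat (Suc n) powr - s :: complex)" by (subst summable_Suc_iff)
  thus ?thesis unfolding dirichlet_zeta_def
    by (intro summable_sums) (simp only: powr_minus inverse_eq_divide)
qed

lemma dirichlet_zeta_infsum:
  assumes "Re s > 1"
  shows "dirichlet_zeta s = (\<Sum>\<^sub>\<infinity>n. of_nat n powr - s)"
proof -
  have "(\<lambda>n. of_nat (Suc n) powr - s) sums dirichlet_zeta s"
    using dirichlet_zeta_sums[OF assms] by (simp only: powr_minus inverse_eq_divide)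
  \<comment> \<open>The added term is \<open>0 powr - s\<close>, which is 0.\<close>
  hence "(\<lambda>n. of_nat n powr - s) sums (dirichlet_zeta s + of_nat 0 powr - s)"
    by (rule sums_Suc)
  hence "(\<lambda>n. of_nat n powr - s) sums dirichlet_zeta s" by simp
  from norm_summable_imp_has_sum[OF summable_norm_dirichlet[OF assms] this]
  show ?thesis by (rule infsumI[symmetric])
qed

text \<open>The sieve of Eratosthenes: the numbers divisible by no prime of \<open>P\<close> split
  into those not divisible by \<open>q\<close> either and the multiples \<open>q * n\<close> with
  \<open>n\<close> again in the set. Removing the latter multiplies the sum by
  \<open>1 - q powr - s\<close>.\<close>

lemma euler_factor_step:
  assumes s: "Re s > 1" and P: "finite P" "\<And>p. p \<in> P \<Longrightarrow> prime p"
  shows "(\<Prod>p\<in>P. 1 - of_nat p powr - s) * dirichlet_zeta s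
       = (\<Sum>\<^sub>\<infinity>n\<in>{n::nat. \<forall>p\<in>P. \<not> p dvd n}. of_nat n powr - s)"
  using P
proof (induction P rule: finite_induct)
  case empty
  show ?case by (simp add: dirichlet_zeta_infsum[OF s])
next
  case (insert q P)
  let ?f = "\<lambda>n::nat. of_nat n powr - s :: complex"
  define A where "A = {n::nat. \<forall>p\<in>P. \<not> p dvd n}"
  define B where "B = {n::nat. \<forall>p\<in>insert q P. \<not> p dvd n}"
  have q: "prime q" using insert.prems by simp
  have q0: "q > 0" using q by (rule prime_gt_0_nat)
  have iff: "p dvd q * n \<longleftrightarrow> p dvd n" if "p \<in> P" for p n
  proof -
    have p: "prime p" using insert.prems that by simp
    have "p \<noteq> q" using that insert.hyps by auto
    hence "\<not> p dvd q" using primes_dvd_imp_eq[OF p q] by blast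
    thus ?thesis using p by (simp add: prime_dvd_mult_iff)
  qed
  have inB: "n \<in> B \<longleftrightarrow> \<not> q dvd n \<and> n \<in> A" for n by (auto simp: A_def B_def)
  have qA: "q * n \<in> A \<longleftrightarrow> n \<in> A" for n by (auto simp: A_def iff)
  have AB: "A = B \<union> (\<lambda>n. q * n) ` A"
  proof (intro set_eqI iffI)
    fix n assume n: "n \<in> A"
    show "n \<in> B \<union> (\<lambda>n. q * n) ` A"
    proof (cases "q dvd n")
      case True
      then obtain m where "n = q * m" by (elim dvdE)
      with n show ?thesis using qA by blast
    next
      case False
      thus ?thesis using n inB by blast
    qed
  qed (use inB qA in blast)
  have disj: "B \<inter> (\<lambda>n. q * n) ` A = {}" by (auto simp: B_def)
  have "infsum ?f A = infsum ?f B + infsum ?f ((\<lambda>n. q * n) ` A)"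
    by (subst AB, rule infsum_Un_disjoint) (use disj dirichlet_summable_on[OF s] in auto)
  also have "infsum ?f ((\<lambda>n. q * n) ` A) = infsum (?f \<circ> (\<lambda>n. q * n)) A"
    by (rule infsum_reindex) (use q0 in \<open>auto intro: inj_onI\<close>)
  also have "\<dots> = infsum (\<lambda>n. ?f q * ?f n) A"
    by (simp only: o_def of_nat_mult_powr)
  also have "\<dots> = ?f q * infsum ?f A" by (rule infsum_cmult_right')
  finally have "infsum ?f B = (1 - ?f q) * infsum ?f A" by (simp add: algebra_simps)
  also have "infsum ?f A = (\<Prod>p\<in>P. 1 - ?f p) * dirichlet_zeta s"
    using insert.IH insert.prems by (simp add: A_def)
  finally show ?case using insert.hyps by (simp add: B_def mult.assoc)
qed

text \<open>After sieving by all primes up to \<open>N\<close> only 1 and numbers beyond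
  \<open>N\<close> remain, so the difference from 1 is bounded by the tail of the series.\<close>

lemma euler_product:
  assumes s: "Re s > 1"
  shows "(\<lambda>N. (\<Prod>p | prime p \<and> p \<le> N. 1 - of_nat p powr - s) * dirichlet_zeta s) \<longlonglongrightarrow> 1"
proof -
  let ?f = "\<lambda>n::nat. of_nat n powr - s :: complex"
  define T where "T = (\<lambda>N. \<Sum>n. norm (?f (n + Suc N)))"
  have sm: "summable (\<lambda>n. norm (?f n))" by (rule summable_norm_dirichlet[OF s])
  have T0: "T \<longlonglongrightarrow> 0"
    unfolding T_def by (rule LIMSEQ_Suc[OF suminf_exist_split2[OF sm]])
  have "norm ((\<Prod>p | prime p \<and> p \<le> N. 1 - ?f p) * dirichlet_zeta s - 1) \<le> T N" if N: "N \<ge> 2" for N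
  proof -
    define A where "A = {n::nat. \<forall>p\<in>{p. prime p \<and> p \<le> N}. \<not> p dvd n}"
    \<comment> \<open>\<open>N \<ge> 2\<close> makes 2 one of the sieving primes, which removes
      0.\<close>
    have "0 \<notin> A" using N two_is_prime_nat by (auto simp: A_def intro!: exI[of _ 2])
    have "1 \<in> A" by (auto simp: A_def)
    have big: "n > N" if "n \<in> A - {1}" for n
    proof (rule ccontr)
      assume "\<not> n > N"
      have "n \<in> A" "n \<noteq> 1" using that by auto
      hence "n \<noteq> 0" using \<open>0 \<notin> A\<close> by metis
      obtain p where p: "prime p" "p dvd n" using prime_factor_nat[OF \<open>n \<noteq> 1\<close>] by blast
      hence "p \<le> n" using \<open>n \<noteq> 0\<close> by (simp add: dvd_imp_le)
      thus False using p that \<open>\<not> n > N\<close> by (auto simp: A_def)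
    qed
    have "A = insert 1 (A - {1})" using \<open>1 \<in> A\<close> by auto
    hence "infsum ?f A = infsum ?f ({1} \<union> (A - {1}))" by simp
    also have "\<dots> = infsum ?f {1} + infsum ?f (A - {1})"
      by (rule infsum_Un_disjoint) (use dirichlet_summable_on[OF s] in auto)
    finally have eq: "infsum ?f A - 1 = infsum ?f (A - {1})" by simp
    have nsm: "(\<lambda>n. norm (?f n)) summable_on C" for C
      using summable_on_subset_banach[OF norm_summable_imp_summable_on[of "\<lambda>n. norm (?f n)"]] sm by auto
    have "norm (infsum ?f (A - {1})) \<le> infsum (\<lambda>n. norm (?f n)) (A - {1})"
      by (rule norm_infsum_bound[OF nsm])
    also have "\<dots> \<le> infsum (\<lambda>n. norm (?f n)) {N<..}"
      by (rule infsum_mono2[OF nsm nsm]) (use big in auto)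
    also have "{N<..} = (\<lambda>n. n + Suc N) ` UNIV"
      by (auto simp: image_iff) (metis add.commute add_Suc_right less_iff_Suc_add)
    also have "infsum (\<lambda>n. norm (?f n)) ((\<lambda>n. n + Suc N) ` UNIV) = infsum ((\<lambda>n. norm (?f n)) \<circ> (\<lambda>n. n + Suc N)) UNIV"
      by (rule infsum_reindex) (auto intro: inj_onI)
    also have "\<dots> = T N"
    proof -
      have sh: "summable (\<lambda>n. norm (?f (n + Suc N)))" using sm by (subst summable_iff_shift)
      have "((\<lambda>n. norm (?f (n + Suc N))) has_sum T N) UNIV"
        by (rule norm_summable_imp_has_sum) (use sh in \<open>auto simp: T_def summable_sums\<close>)
      thus ?thesis unfolding o_def by (rule infsumI)
    qed
    finally have "norm (infsum ?f A - 1) \<le> T N" unfolding eq .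
    moreover have "(\<Prod>p | prime p \<and> p \<le> N. 1 - ?f p) * dirichlet_zeta s = infsum ?f A"
      unfolding A_def by (rule euler_factor_step[OF s]) (auto intro: finite_subset[of _ "{..N}"])
    ultimately show ?thesis by simp
  qed
  hence "eventually (\<lambda>N. norm ((\<Prod>p | prime p \<and> p \<le> N. 1 - ?f p) * dirichlet_zeta s - 1) \<le> T N) sequentially"
    by (auto simp: eventually_at_top_linorder)
  hence "(\<lambda>N. (\<Prod>p | prime p \<and> p \<le> N. 1 - ?f p) * dirichlet_zeta s - 1) \<longlonglongrightarrow> 0"
    using T0 by (rule Lim_null_comparison)
  thus ?thesis by (simp add: LIM_zero_iff)
qed

lemma dirichlet_zeta_nonzero:
  assumes "Re s > 1"
  shows "dirichlet_zeta s \<noteq> 0"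
proof
  assume "dirichlet_zeta s = 0"
  with euler_product[OF assms] have "(\<lambda>N::nat. 0::complex) \<longlonglongrightarrow> 1" by simp
  thus False using LIMSEQ_unique tendsto_const zero_neq_one by blast
qed

lemma Re_Ln_one_minus_sums:
  assumes "norm (z::complex) < 1"
  shows "(\<lambda>n. Re (z ^ n) / real n) sums (- ln (norm (1 - z)))"
proof -
  have "1 - z \<noteq> 0" using assms by auto
  \<comment> \<open>The term for \<open>n = 0\<close> is a division by 0 and hence 0.\<close>
  have "(\<lambda>n. - ((- (- z)) ^ n) / of_nat n) sums ln (1 + - z)"
    by (rule Ln_series') (use assms in simp)
  hence "(\<lambda>n. Re (- (z ^ n / of_nat n))) sums Re (Ln (1 - z))" by (intro sums_Re) simp
  hence "(\<lambda>n. - Re (- (z ^ n / of_nat n))) sums (- Re (Ln (1 - z)))" by (rule sums_minus)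
  thus ?thesis using \<open>1 - z \<noteq> 0\<close> by (simp add: Re_Ln)
qed

text \<open>In minus the logarithm of the product, the n-th term is \<open>x ^ n / n\<close> times
  \<open>3 + 4 * cos \<phi> + cos (2 * \<phi>) = 2 * (1 + cos \<phi>)\<^sup>2\<close>, where
  \<open>cos \<phi> = Re (w ^ n)\<close>.\<close>

lemma three_four_one_factor:
  fixes w :: complex and x :: real
  assumes x: "0 < x" "x < 1" and w: "norm w = 1"
  shows "norm (1 - of_real x :: complex) ^ 3 * norm (1 - of_real x * w) ^ 4 * norm (1 - of_real x * w\<^sup>2) \<le> 1"
proof -
  have l1: "norm (of_real x :: complex) < 1" and l2: "norm (of_real x * w) < 1" and l3: "norm (of_real x * w\<^sup>2) < 1"
    using x w by (simp_all add: norm_mult norm_power)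
  have pos: "norm (1 - of_real x :: complex) > 0" "norm (1 - of_real x * w) > 0" "norm (1 - of_real x * w\<^sup>2) > 0"
    using l1 l2 l3 by (auto simp: zero_less_norm_iff)
  define L where "L = 3 * (- ln (norm (1 - of_real x :: complex))) + 4 * (- ln (norm (1 - of_real x * w)))
      + (- ln (norm (1 - of_real x * w\<^sup>2)))"
  have "(\<lambda>n. 3 * (Re (of_real x ^ n) / real n) + 4 * (Re ((of_real x * w) ^ n) / real n)
      + Re ((of_real x * w\<^sup>2) ^ n) / real n) sums L" (is "?g sums L")
    unfolding L_def
    by (intro sums_add sums_mult Re_Ln_one_minus_sums l1 l2 l3)
  moreover have "3 * (Re (of_real x ^ n) / real n) + 4 * (Re ((of_real x * w) ^ n) / real n)
      + Re ((of_real x * w\<^sup>2) ^ n) / real n \<ge> 0" for n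
  proof -
    define a b where "a = Re (w ^ n)" and "b = Im (w ^ n)"
    have "norm (w ^ n) = 1" using w by (simp add: norm_power)
    hence "a\<^sup>2 + b\<^sup>2 = 1" by (simp add: a_def b_def cmod_def)
    moreover have "Re ((w\<^sup>2) ^ n) = a\<^sup>2 - b\<^sup>2"
      by (simp add: power_mult[symmetric] mult.commute power_mult a_def b_def power2_eq_square)
         (metis (no_types) Re_power2 a_def b_def mult.commute power2_eq_square power_mult)
    ultimately have e3: "Re ((w\<^sup>2) ^ n) = 2 * a\<^sup>2 - 1" by simp
    have "3 * (Re (of_real x ^ n) / real n) + 4 * (Re ((of_real x * w) ^ n) / real n)
      + Re ((of_real x * w\<^sup>2) ^ n) / real n = x ^ n * (2 * (1 + a)\<^sup>2) / real n"
      by (simp add: power_mult_distrib of_real_power[symmetric] e3 a_def[symmetric] add_divide_distrib[symmetric]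
               del: of_real_power)
         (simp add: power2_eq_square algebra_simps)
    thus ?thesis using x by simp
  qed
  ultimately have "L \<ge> 0" by (intro sums_le[of "\<lambda>_. 0" ?g 0 L] sums_zero)
  have "ln (norm (1 - of_real x :: complex) ^ 3 * norm (1 - of_real x * w) ^ 4 * norm (1 - of_real x * w\<^sup>2)) = - L"
    using pos by (simp add: ln_mult ln_realpow L_def)
  also have "\<dots> \<le> 0" using \<open>L \<ge> 0\<close> by simp
  finally show ?thesis using pos by (simp add: ln_le_zero_iff)
qed

text \<open>The truncated Euler products approximate the reciprocals of the zeta values. Prime by
  prime their 3-4-1 product is at most 1, and the bound survives the limit.\<close>

lemma three_four_one:
  assumes \<sigma>: "\<sigma> > 1"
  shows "norm (dirichlet_zeta (of_real \<sigma>)) ^ 3 * norm (dirichlet_zeta (Complex \<sigma> t)) ^ 4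
      * norm (dirichlet_zeta (Complex \<sigma> (2 * t))) \<ge> 1"
proof -
  let ?a = "of_real \<sigma> :: complex" and ?b = "Complex \<sigma> t" and ?c = "Complex \<sigma> (2 * t)"
  define P where "P = (\<lambda>s N. \<Prod>p | prime p \<and> p \<le> N. 1 - of_nat p powr - s :: complex)"
  have lim: "(\<lambda>N. norm (P s N * dirichlet_zeta s)) \<longlonglongrightarrow> 1" if "Re s > 1" for s
    using tendsto_norm[OF euler_product[OF that]] by (simp add: P_def)
  have "(\<lambda>N. norm (P ?a N * dirichlet_zeta ?a) ^ 3 * norm (P ?b N * dirichlet_zeta ?b) ^ 4
      * norm (P ?c N * dirichlet_zeta ?c)) \<longlonglongrightarrow> 1 ^ 3 * 1 ^ 4 * 1"
    by (intro tendsto_intros lim) (use \<sigma> in auto)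
  hence l: "(\<lambda>N. norm (P ?a N * dirichlet_zeta ?a) ^ 3 * norm (P ?b N * dirichlet_zeta ?b) ^ 4
      * norm (P ?c N * dirichlet_zeta ?c)) \<longlonglongrightarrow> 1" by simp
  have le: "norm (P ?a N) ^ 3 * norm (P ?b N) ^ 4 * norm (P ?c N) \<le> 1" for N
  proof -
    have "norm (P ?a N) ^ 3 * norm (P ?b N) ^ 4 * norm (P ?c N) =
        (\<Prod>p | prime p \<and> p \<le> N. norm (1 - of_nat p powr - ?a :: complex) ^ 3 * norm (1 - of_nat p powr - ?b :: complex) ^ 4 *
          norm (1 - of_nat p powr - ?c :: complex))"
      by (simp add: P_def prod.distrib prod_norm[symmetric] prod_power_distrib)
    also have "\<dots> \<le> (\<Prod>p | prime p \<and> p \<le> N. 1)"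
    proof (rule prod_mono, intro conjI)
      fix p assume "p \<in> {p. prime p \<and> p \<le> N}"
      hence p: "prime p" by simp
      hence p1: "p > 1" by (rule prime_gt_1_nat)
      define x where "x = real p powr - \<sigma>"
      define w where "w = (of_nat p :: complex) powr (- Complex 0 t)"
      have x: "0 < x" "x < 1"
        using p1 \<sigma> by (auto simp: x_def powr_less_one)
      have w: "norm w = 1" using p1 by (simp add: w_def norm_of_nat_powr)
      have ea: "of_nat p powr - ?a = of_real x"
        unfolding x_def using powr_of_real[of "real p" "- \<sigma>"] by simp
      have e2: "- ?b = - ?a + - Complex 0 t" "- ?c = - ?a + (- Complex 0 t + - Complex 0 t)"
        by (simp_all add: complex_eq_iff)
      have eb: "of_nat p powr - ?b = of_real x * w"
        unfolding ea[symmetric] w_def e2(1) by (rule powr_add)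
      have ec: "of_nat p powr - ?c = of_real x * w\<^sup>2"
        unfolding ea[symmetric] w_def power2_eq_square e2(2) powr_add ..
      show "norm (1 - of_nat p powr - ?a :: complex) ^ 3 * norm (1 - of_nat p powr - ?b :: complex) ^ 4 *
          norm (1 - of_nat p powr - ?c :: complex) \<le> 1"
        unfolding ea eb ec by (rule three_four_one_factor[OF x w])
    qed auto
    finally show ?thesis by simp
  qed
  define Z where "Z = norm (dirichlet_zeta ?a) ^ 3 * norm (dirichlet_zeta ?b) ^ 4 * norm (dirichlet_zeta ?c)"
  have Z0: "Z \<ge> 0" by (simp add: Z_def)
  have "1 \<le> Z"
  proof (rule LIMSEQ_le_const2[OF l], intro exI allI impI)
    fix N
    have "norm (P ?a N * dirichlet_zeta ?a) ^ 3 * norm (P ?b N * dirichlet_zeta ?b) ^ 4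
      * norm (P ?c N * dirichlet_zeta ?c) = (norm (P ?a N) ^ 3 * norm (P ?b N) ^ 4 * norm (P ?c N)) * Z"
      by (simp add: Z_def norm_mult power_mult_distrib mult_ac)
    also have "\<dots> \<le> 1 * Z" by (intro mult_right_mono le Z0)
    finally show "norm (P ?a N * dirichlet_zeta ?a) ^ 3 * norm (P ?b N * dirichlet_zeta ?b) ^ 4
      * norm (P ?c N * dirichlet_zeta ?c) \<le> Z" by simp
  qed
  thus ?thesis by (simp add: Z_def)
qed

text \<open>The factor \<open>s - 1\<close> absorbs the pole at 1. If \<open>g\<close> vanished at
  \<open>1 + \<i> * t\<close>, then \<open>g (1 + h + \<i> * t) / h\<close> would converge as
  \<open>h\<close> tends to 0, and \<open>Q\<close>, with exponents 3, 4, 1 and one spare factor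
  \<open>h\<close>, would tend to 0; the 3-4-1 inequality keeps it above
  \<open>\<bar>t\<bar> ^ 4 * \<bar>2 * t\<bar>\<close>.\<close>

lemma nonzero_on_line_one:
  assumes g: "g holomorphic_on UNIV" and gz: "\<And>s. Re s > 1 \<Longrightarrow> g s = (s - 1) * dirichlet_zeta s"
    and t: "t \<noteq> 0"
  shows "g (Complex 1 t) \<noteq> 0"
proof
  assume g0: "g (Complex 1 t) = 0"
  define X where "X = (\<lambda>n. inverse (real (Suc n)))"
  have X: "X \<longlonglongrightarrow> 0" "\<And>n. X n > 0" unfolding X_def by (rule LIMSEQ_inverse_real_of_nat) simp
  have cont: "isCont g s" for s
    using holomorphic_on_imp_continuous_on[OF g] by (simp add: continuous_on_eq_continuous_at)
  have lim: "(\<lambda>n. g (Complex 1 u + of_real (X n))) \<longlonglongrightarrow> g (Complex 1 u)" for u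
  proof -
    have "(\<lambda>n. Complex 1 u + of_real (X n)) \<longlonglongrightarrow> Complex 1 u + of_real 0"
      by (intro tendsto_intros X)
    thus ?thesis using isCont_tendsto_compose[OF cont] by fastforce
  qed
  define D where "D = deriv g (Complex 1 t)"
  have "(g has_field_derivative D) (at (Complex 1 t))"
    unfolding D_def by (rule holomorphic_derivI[OF g open_UNIV UNIV_I])
  hence "((\<lambda>h. (g (Complex 1 t + h) - g (Complex 1 t)) / h) \<longlongrightarrow> D) (at 0)" by (simp add: DERIV_def)
  moreover have "filterlim (\<lambda>n. of_real (X n) :: complex) (at 0) sequentially"
    unfolding filterlim_at using X(2) tendsto_of_real[OF X(1), where 'a=complex]
    by (auto simp: less_imp_neq[THEN not_sym])
  ultimately have k: "(\<lambda>n. g (Complex 1 t + of_real (X n)) / of_real (X n)) \<longlonglongrightarrow> D"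
    using g0 filterlim_compose by fastforce
  define Q where "Q = (\<lambda>n. norm (g (Complex 1 0 + of_real (X n))) ^ 3 *
      norm (g (Complex 1 t + of_real (X n)) / of_real (X n)) ^ 4 * norm (g (Complex 1 (2*t) + of_real (X n))) * X n)"
  have "Q \<longlonglongrightarrow> norm (g (Complex 1 0)) ^ 3 * norm D ^ 4 * norm (g (Complex 1 (2*t))) * 0"
    unfolding Q_def by (intro tendsto_intros lim k X)
  hence Q0: "Q \<longlonglongrightarrow> 0" by simp
  have "\<bar>t\<bar> ^ 4 * \<bar>2 * t\<bar> \<le> Q n" for n
  proof -
    define h where "h = X n"
    have h: "h > 0" using X(2) by (simp add: h_def)
    have c: "Complex 1 u + of_real h = Complex (1 + h) u" for u by (simp add: complex_eq_iff)
    have ng: "norm (g (Complex 1 u + of_real h)) = norm (Complex h u) * norm (dirichlet_zeta (Complex (1 + h) u))" for u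
    proof -
      have "g (Complex 1 u + of_real h) = (Complex (1 + h) u - 1) * dirichlet_zeta (Complex (1 + h) u)"
        unfolding c by (rule gz) (use h in simp)
      also have "Complex (1 + h) u - 1 = Complex h u" by (simp add: complex_eq_iff)
      finally show ?thesis by (simp add: norm_mult)
    qed
    have nu: "norm (Complex h u) \<ge> \<bar>u\<bar>" for u using abs_Im_le_cmod[of "Complex h u"] by simp
    have r: "Complex (1 + h) 0 = of_real (1 + h)" by (simp add: complex_eq_iff)
    have nh: "norm (Complex h 0) = h" using h by (simp add: cmod_def)
    define Z where "Z = norm (dirichlet_zeta (of_real (1 + h))) ^ 3 * norm (dirichlet_zeta (Complex (1 + h) t)) ^ 4
      * norm (dirichlet_zeta (Complex (1 + h) (2 * t)))"
    have Z: "Z \<ge> 1" unfolding Z_def by (rule three_four_one) (use h in simp)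
    have "\<bar>t\<bar> ^ 4 * \<bar>2 * t\<bar> \<le> norm (Complex h t) ^ 4 * norm (Complex h (2 * t))"
      by (intro mult_mono power_mono nu) auto
    also have "\<dots> \<le> norm (Complex h t) ^ 4 * norm (Complex h (2 * t)) * Z"
      using Z mult_left_mono[OF Z, of "norm (Complex h t) ^ 4 * norm (Complex h (2 * t))"] by simp
    also have "\<dots> = (h * norm (dirichlet_zeta (of_real (1 + h)))) ^ 3 *
        ((norm (Complex h t) * norm (dirichlet_zeta (Complex (1 + h) t))) / h) ^ 4 *
        (norm (Complex h (2 * t)) * norm (dirichlet_zeta (Complex (1 + h) (2 * t)))) * h"
      using h by (simp add: Z_def power_mult_distrib power_divide field_simps power3_eq_cube power4_eq_xxxx)
    also have "\<dots> = Q n"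
      unfolding Q_def h_def[symmetric] norm_divide ng nh r using h by simp
    finally show ?thesis .
  qed
  hence "\<bar>t\<bar> ^ 4 * \<bar>2 * t\<bar> \<le> 0" using LIMSEQ_le_const[OF Q0] by blast
  thus False using t by (simp add: mult_le_0_iff)
qed

section \<open>The Mellin transform of the theta function\<close>

lemma theta_tail_nonneg: "x > 0 \<Longrightarrow> theta_tail x \<ge> 0"
  unfolding theta_tail_def by (intro suminf_nonneg theta_tail_summable) auto

lemma theta_tail_le:
  assumes "x \<ge> 1"
  shows "theta_tail x \<le> 2 * exp (- 2 * x)"
proof -
  have x: "x > 0" using assms by simp
  define r where "r = exp (- pi * x)"
  have "1 \<le> pi * x" using mult_mono[of 1 pi 1 x] assms pi_ge_two by simp
  hence "r \<le> exp (- 1)" by (simp add: r_def)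
  also have "exp (- 1 :: real) \<le> 1 / 2"
    using exp_ge_add_one_self[of "1::real"] by (simp add: exp_minus field_simps)
  finally have r: "r \<le> 1 / 2" "r > 0" by (simp_all add: r_def)
  have gs: "summable (\<lambda>n. r * r ^ n)" using r by (intro summable_mult summable_geometric) simp
  have "theta_tail x \<le> (\<Sum>n. r * r ^ n)"
    unfolding theta_tail_def
    by (rule suminf_le[OF _ theta_tail_summable[OF x] gs]) (use theta_term_le[OF x] r_def in simp)
  also have "\<dots> = r * (1 / (1 - r))"
    using r by (subst suminf_mult) (auto intro: summable_geometric simp: suminf_geometric)
  also have "\<dots> \<le> r * 2" using r by (intro mult_left_mono) (auto simp: field_simps)
  also have "r \<le> exp (- 2 * x)" using x pi_ge_two by (simp add: r_def mult_right_mono)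
  finally show ?thesis by simp
qed

lemma theta_tail_measurable [measurable]: "theta_tail \<in> borel_measurable borel"
  unfolding theta_tail_def by measurable

text \<open>The substitution \<open>x = exp u\<close> turns the Mellin kernel
  \<open>x powr (s / 2)\<close> against \<open>dx / x\<close> into \<open>exp (u * (s / 2))\<close>.
  Only \<open>x \<ge> 1\<close> is kept; the functional equation folds the other half onto
  it.\<close>

definition theta_weight :: "real \<Rightarrow> real" where
  "theta_weight u = indicator {0..} u * theta_tail (exp u)"

lemma theta_weight_measurable [measurable]: "theta_weight \<in> borel_measurable borel"
  unfolding theta_weight_def by measurable

lemma theta_weight_nonneg: "theta_weight u \<ge> 0"
  by (simp add: theta_weight_def theta_tail_nonneg)

text \<open>Of the decay \<open>exp (- 2 * exp u)\<close> one half pays for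
  \<open>exp (u * a)\<close>, by the tangent bound for the exponential at \<open>ln a\<close>, and
  the other gives the integrable \<open>exp (- u)\<close>. The factor \<open>exp (a * ln a)\<close>
  is the source of the growth bound for \<open>xi\<close>.\<close>

lemma theta_weight_le:
  assumes a: "a \<ge> 1"
  shows "exp (u * a) * theta_weight u \<le> 2 * exp (a * ln a) * (indicator {0..} u * exp (- u))"
proof (cases "u \<ge> 0")
  case True
  have "exp u = a * exp (u - ln a)" using a by (simp add: exp_diff)
  also have "\<dots> \<ge> a * (1 + (u - ln a))" using a by (intro mult_left_mono exp_ge_add_one_self) auto
  finally have 1: "u * a - exp u \<le> a * ln a" using a by (simp add: algebra_simps)
  have 2: "u \<le> exp u" using exp_ge_add_one_self[of u] by linarith
  have "exp (u * a) * theta_weight u \<le> exp (u * a) * (2 * exp (- 2 * exp u))"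
    using True theta_tail_le[of "exp u"] by (intro mult_left_mono) (simp_all add: theta_weight_def)
  also have "\<dots> = 2 * exp (u * a - 2 * exp u)" by (simp add: exp_diff exp_minus field_simps)
  also have "u * a - 2 * exp u \<le> a * ln a - u" using 1 2 by linarith
  hence "2 * exp (u * a - 2 * exp u) \<le> 2 * exp (a * ln a - u)" by simp
  also have "\<dots> = 2 * exp (a * ln a) * (indicator {0..} u * exp (- u))"
    using True by (simp add: exp_diff exp_minus field_simps)
  finally show ?thesis .
qed (simp add: theta_weight_def)

lemma has_bochner_integral_exp_minus:
  assumes "c > (0::real)"
  shows "has_bochner_integral lborel (\<lambda>u. indicator {0..} u * exp (- c * u)) (1 / c)"
proof (rule has_bochner_integral_nn_integral)
  have "((\<lambda>u. exp (- c * u)) has_integral 1 / c) {0..}"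
    using has_integral_exp_minus_to_infinity[OF assms, of 0] by simp
  hence "((\<lambda>u. if u \<in> {0..} then exp (- c * u) else 0) has_integral 1 / c) UNIV"
    by (subst has_integral_restrict_UNIV)
  hence "((\<lambda>u. indicator {0..} u * exp (- c * u)) has_integral 1 / c) UNIV"
    by (rule has_integral_eq[rotated]) (auto simp: indicator_def)
  thus "(\<integral>\<^sup>+ u. ennreal (indicator {0..} u * exp (- c * u)) \<partial>lborel) = ennreal (1 / c)"
    by (intro nn_integral_has_integral_lborel) auto
qed (use assms in auto)

lemma integrable_theta_weight_exp: "integrable lborel (\<lambda>u. exp (u * a) * theta_weight u)"
proof -
  define b where "b = max 1 a"
  have b: "b \<ge> 1" "a \<le> b" by (simp_all add: b_def)
  have i: "integrable lborel (\<lambda>u. 2 * exp (b * ln b) * (indicator {0..} u * exp (- u)))"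
    using has_bochner_integral_exp_minus[of 1] by (intro integrable_mult_right) (simp add: has_bochner_integral_iff)
  show ?thesis
  proof (rule Bochner_Integration.integrable_bound[OF i])
    show "AE u in lborel. norm (exp (u * a) * theta_weight u) \<le> norm (2 * exp (b * ln b) * (indicator {0..} u * exp (- u)))"
    proof (rule AE_I2)
      fix u :: real
      have "exp (u * a) * theta_weight u \<le> exp (u * b) * theta_weight u"
      proof (cases "u \<ge> 0")
        case True
        thus ?thesis using b by (intro mult_right_mono theta_weight_nonneg) (simp add: mult_left_mono)
      qed (simp add: theta_weight_def)
      also have "\<dots> \<le> 2 * exp (b * ln b) * (indicator {0..} u * exp (- u))" by (rule theta_weight_le[OF b(1)])
      finally show "norm (exp (u * a) * theta_weight u) \<le> norm (2 * exp (b * ln b) * (indicator {0..} u * exp (- u)))"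
        using theta_weight_nonneg[of u] by simp
    qed
  qed measurable
qed

lemma theta_weight_exp_integral_le:
  assumes "a \<ge> 1"
  shows "(\<integral>u. exp (u * a) * theta_weight u \<partial>lborel) \<le> 2 * exp (a * ln a)"
proof -
  have h: "has_bochner_integral lborel (\<lambda>u::real. indicator {0..} u * exp (- u)) 1"
    using has_bochner_integral_exp_minus[of 1] by simp
  have "(\<integral>u. exp (u * a) * theta_weight u \<partial>lborel) \<le> (\<integral>u. 2 * exp (a * ln a) * (indicator {0..} u * exp (- u)) \<partial>lborel)"
    by (rule integral_mono[OF integrable_theta_weight_exp])
       (use h theta_weight_le[OF assms] in \<open>auto simp: has_bochner_integral_iff\<close>)
  also have "\<dots> = 2 * exp (a * ln a)" using h by (simp add: has_bochner_integral_iff)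
  finally show ?thesis .
qed

definition theta_mellin :: "complex \<Rightarrow> complex" where
  "theta_mellin s = (\<integral>u. exp (of_real u * (s / 2)) * of_real (theta_weight u) \<partial>lborel)"

lemma theta_mellin_norm_le:
  assumes "r \<ge> 1" "Re s / 2 \<le> r"
  shows "norm (theta_mellin s) \<le> 2 * exp (r * ln r)"
proof -
  have "norm (theta_mellin s) \<le> (\<integral>u. norm (exp (of_real u * (s / 2)) * of_real (theta_weight u)) \<partial>lborel)"
    unfolding theta_mellin_def by (rule integral_norm_bound)
  also have "\<dots> = (\<integral>u. exp (u * (Re s / 2)) * theta_weight u \<partial>lborel)"
    by (intro Bochner_Integration.integral_cong) (auto simp: norm_mult norm_exp_eq_Re theta_weight_nonneg)
  also have "\<dots> \<le> (\<integral>u. exp (u * r) * theta_weight u \<partial>lborel)"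
  proof (rule integral_mono[OF integrable_theta_weight_exp integrable_theta_weight_exp])
    fix u :: real
    show "exp (u * (Re s / 2)) * theta_weight u \<le> exp (u * r) * theta_weight u"
    proof (cases "u \<ge> 0")
      case True
      thus ?thesis using assms by (intro mult_right_mono theta_weight_nonneg) (simp only: exp_le_cancel_iff mult_left_mono)
    qed (simp add: theta_weight_def)
  qed
  also have "\<dots> \<le> 2 * exp (r * ln r)" by (rule theta_weight_exp_integral_le[OF assms(1)])
  finally show ?thesis .
qed

text \<open>The exponential is expanded and integrated termwise; the partial sums of norms are
  dominated by \<open>exp (u * norm (s / 2)) * theta_weight u\<close>. Convergence for every
  \<open>s\<close> makes the transform entire.\<close>

lemma theta_mellin_power_series:
  "(\<lambda>k. (\<integral>u. (of_real u / 2) ^ k /\<^sub>R fact k * of_real (theta_weight u) \<partial>lborel) * s ^ k) sums theta_mellin s"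
proof -
  define f where "f = (\<lambda>k u. (of_real u * (s / 2)) ^ k /\<^sub>R fact k * of_real (theta_weight u) :: complex)"
  define a where "a = norm (s / 2)"
  define g where "g = (\<lambda>u. exp (u * a) * theta_weight u)"
  have gi: "integrable lborel g" unfolding g_def by (rule integrable_theta_weight_exp)
  have nf: "norm (f k u) = (u * a) ^ k /\<^sub>R fact k * theta_weight u" for k u
  proof (cases "u \<ge> 0")
    case True
    thus ?thesis by (simp add: f_def norm_mult norm_power a_def theta_weight_nonneg)
  qed (simp add: f_def theta_weight_def)
  have part: "(\<Sum>k<n. norm (f k u)) \<le> g u" for n u
  proof (cases "u \<ge> 0")
    case True
    have "(\<Sum>k<n. norm (f k u)) = (\<Sum>k<n. (u * a) ^ k /\<^sub>R fact k) * theta_weight u"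
      by (simp only: nf sum_distrib_right)
    also have "(\<Sum>k<n. (u * a) ^ k /\<^sub>R fact k) \<le> (\<Sum>k. (u * a) ^ k /\<^sub>R fact k)"
      using True by (intro sum_le_suminf summable_exp_generic) (auto simp: a_def)
    hence "(\<Sum>k<n. (u * a) ^ k /\<^sub>R fact k) * theta_weight u \<le> exp (u * a) * theta_weight u"
      unfolding exp_def by (intro mult_right_mono theta_weight_nonneg)
    finally show ?thesis by (simp add: g_def)
  qed (simp add: f_def g_def theta_weight_def)
  have fm: "f k \<in> borel_measurable lborel" for k unfolding f_def by measurable
  have single: "norm (f k u) \<le> g u" for k u
  proof -
    have "norm (f k u) \<le> (\<Sum>k<Suc k. norm (f k u))" by (simp add: sum_nonneg)
    thus ?thesis using part[of u "Suc k"] by (rule order_trans)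
  qed
  have fi: "integrable lborel (f k)" for k
    by (rule Bochner_Integration.integrable_bound[OF gi fm])
       (use single order_trans[OF _ abs_ge_self] in \<open>auto intro!: AE_I2\<close>)
  have "(\<lambda>k. \<integral>u. f k u \<partial>lborel) sums (\<integral>u. (\<Sum>k. f k u) \<partial>lborel)"
  proof (rule sums_integral[OF fi])
    show "AE u in lborel. summable (\<lambda>k. norm (f k u))"
      by (intro AE_I2 summableI_nonneg_bounded[OF _ part]) auto
    show "summable (\<lambda>k. \<integral>u. norm (f k u) \<partial>lborel)"
    proof (rule summableI_nonneg_bounded)
      fix n
      have "(\<Sum>k<n. \<integral>u. norm (f k u) \<partial>lborel) = (\<integral>u. (\<Sum>k<n. norm (f k u)) \<partial>lborel)"
        by (subst Bochner_Integration.integral_sum) (auto intro: integrable_norm fi)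
      also have "\<dots> \<le> (\<integral>u. g u \<partial>lborel)"
        by (intro integral_mono Bochner_Integration.integrable_sum integrable_norm fi gi part)
      finally show "(\<Sum>k<n. \<integral>u. norm (f k u) \<partial>lborel) \<le> (\<integral>u. g u \<partial>lborel)" .
    qed auto
  qed
  moreover have "(\<Sum>k. f k u) = exp (of_real u * (s / 2)) * of_real (theta_weight u)" for u
    unfolding f_def exp_def by (subst suminf_mult2[symmetric]) (auto intro: summable_exp_generic)
  moreover have "(\<integral>u. f k u \<partial>lborel) = (\<integral>u. (of_real u / 2) ^ k /\<^sub>R fact k * of_real (theta_weight u) \<partial>lborel) * s ^ k" for k
  proof -
    have "f k = (\<lambda>u. ((of_real u / 2) ^ k /\<^sub>R fact k * of_real (theta_weight u)) * s ^ k)"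
      by (rule ext) (simp add: f_def power_mult_distrib power_divide)
    thus ?thesis by (simp only: integral_mult_left_zero)
  qed
  ultimately show ?thesis by (simp add: theta_mellin_def)
qed

lemma theta_mellin_holomorphic: "theta_mellin holomorphic_on A"
proof -
  have hol: "theta_mellin holomorphic_on ball 0 (norm z + 1)" for z :: complex
    by (rule power_series_holomorphic[of 0 _ "\<lambda>k. (\<integral>u. (of_real u / 2) ^ k /\<^sub>R fact k * of_real (theta_weight u) \<partial>lborel)"])
       (use theta_mellin_power_series in simp)
  have "theta_mellin field_differentiable at z" for z
    by (rule holomorphic_on_imp_differentiable_at[OF hol[of z] open_ball]) simp
  thus ?thesis unfolding holomorphic_on_def by (auto intro: field_differentiable_at_within)
qed

lemma theta_mellin_cnj: "theta_mellin (cnj s) = cnj (theta_mellin s)"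
proof -
  have "cnj (theta_mellin s) = (\<integral>u. cnj (exp (of_real u * (s / 2)) * of_real (theta_weight u)) \<partial>lborel)"
    unfolding theta_mellin_def by (rule Bochner_Integration.integral_cnj[symmetric])
  thus ?thesis by (simp add: theta_mellin_def exp_cnj)
qed

lemma theta_mellin_of_real:
  "theta_mellin (of_real s) = of_real (\<integral>u. exp (u * (s / 2)) * theta_weight u \<partial>lborel)"
proof -
  have "theta_mellin (of_real s) = (\<integral>u. of_real (exp (u * (s / 2)) * theta_weight u) \<partial>lborel)"
    unfolding theta_mellin_def by (intro Bochner_Integration.integral_cong) (auto simp: exp_of_real[symmetric])
  thus ?thesis by (simp only: integral_complex_of_real)
qed

section \<open>Riemann's integral representation\<close>

lemma gamma_integral_exp:
  assumes c: "c > 0" and z: "z > 0"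
  shows "has_bochner_integral lborel (\<lambda>u::real. exp (u * z) * exp (- c * exp u)) (c powr (- z) * Gamma z)"
proof -
  define h where "h = (\<lambda>t::real. t powr (z - 1) / exp t)"
  \<comment> \<open>The substitution \<open>t = c * exp u\<close> in the Gamma integral;
    \<open>g\<close> is its own derivative.\<close>
  define g where "g = (\<lambda>u::real. c * exp u)"
  have "(h has_integral Gamma z) {0..}" unfolding h_def by (rule Gamma_integral_real[OF z])
  hence "((\<lambda>t. if t \<in> {0<..} then h t else 0) has_integral Gamma z) {0..}"
    by (rule has_integral_eq[rotated]) (auto simp: h_def)
  hence hi: "(h has_integral Gamma z) {0<..}"
    by (subst (asm) has_integral_restrict) auto
  hence ha: "h absolutely_integrable_on {0<..}"
    by (intro nonnegative_absolutely_integrable_1) (auto simp: h_def integrable_on_def)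
  have im: "g ` UNIV = {0<..}"
  proof (intro set_eqI iffI)
    fix t :: real assume "t \<in> {0<..}"
    hence "t = g (ln (t / c))" using c by (simp add: g_def)
    thus "t \<in> g ` UNIV" by blast
  qed (use c in \<open>auto simp: g_def\<close>)
  have "(\<lambda>u. \<bar>g u\<bar> * h (g u)) absolutely_integrable_on UNIV \<and> integral UNIV (\<lambda>u. \<bar>g u\<bar> * h (g u)) = Gamma z
     \<longleftrightarrow> h absolutely_integrable_on (g ` UNIV) \<and> integral (g ` UNIV) h = Gamma z"
    by (rule has_absolute_integral_change_of_variables_1')
       (use c in \<open>auto simp: g_def inj_on_def intro!: derivative_eq_intros\<close>)
  hence "(\<lambda>u. \<bar>g u\<bar> * h (g u)) absolutely_integrable_on UNIV \<and> integral UNIV (\<lambda>u. \<bar>g u\<bar> * h (g u)) = Gamma z"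
    using ha hi unfolding im by (auto simp: integral_unique)
  hence "((\<lambda>u. \<bar>g u\<bar> * h (g u)) has_integral Gamma z) UNIV"
    using set_lebesgue_integral_eq_integral(1) by (metis integrable_integral)
  hence "((\<lambda>u. c powr (- z) * (\<bar>g u\<bar> * h (g u))) has_integral c powr (- z) * Gamma z) UNIV"
    by (rule has_integral_mult_right)
  moreover have "c powr (- z) * (\<bar>g u\<bar> * h (g u)) = exp (u * z) * exp (- c * exp u)" for u
  proof -
    have gp: "g u > 0" using c by (simp add: g_def)
    have "g u * g u powr (z - 1) = g u powr z"
      using gp powr_add[of "g u" 1 "z - 1"] by simp
    also have "\<dots> = c powr z * exp (u * z)"
      using c by (simp add: g_def powr_mult) (simp add: powr_def mult.commute)
    finally have "\<bar>g u\<bar> * h (g u) = c powr z * exp (u * z) * exp (- c * exp u)"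
      using gp by (simp add: h_def exp_minus g_def field_simps)
    thus ?thesis using c by (simp add: powr_minus field_simps)
  qed
  ultimately have 1: "((\<lambda>u. exp (u * z) * exp (- c * exp u)) has_integral c powr (- z) * Gamma z) UNIV" by simp
  show ?thesis
  proof (rule has_bochner_integral_nn_integral)
    show "(\<integral>\<^sup>+ u. ennreal (exp (u * z) * exp (- c * exp u)) \<partial>lborel) = ennreal (c powr (- z) * Gamma z)"
      by (rule nn_integral_has_integral_lborel[OF _ _ 1]) auto
    show "0 \<le> c powr (- z) * Gamma z" using Gamma_real_pos[OF z] by simp
  qed auto
qed

lemma theta_tail_exp_minus:
  "theta_tail (exp (- u)) = exp (u / 2) * theta_tail (exp u) + (exp (u / 2) - 1) / 2"
proof -
  have "1 + 2 * theta_tail (1 / exp u) = sqrt (exp u) * (1 + 2 * theta_tail (exp u))"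
    by (rule theta_functional_equation) simp
  moreover have "sqrt (exp u) = exp (u / 2)"
    by (rule real_sqrt_unique) (simp_all add: exp_double[symmetric])
  ultimately show ?thesis by (simp add: exp_minus field_simps)
qed

text \<open>Each term of the theta tail gives a Gamma integral, so the full Mellin transform is the
  Dirichlet series times the Gamma factor. For real \<open>s\<close> all terms are positive and the
  exchange of sum and integral needs only summability of the values; complex \<open>s\<close> is
  reached later by analytic continuation.\<close>

lemma mellin_theta_tail:
  fixes s :: real
  assumes s: "s > 1"
  shows "integrable lborel (\<lambda>u. exp (u * (s / 2)) * theta_tail (exp u))"
    and "(\<lambda>n. pi powr (- (s / 2)) * Gamma (s / 2) * real (Suc n) powr (- s)) sums
           (\<integral>u. exp (u * (s / 2)) * theta_tail (exp u) \<partial>lborel)"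
proof -
  define f where "f = (\<lambda>n u. exp (u * (s / 2)) * exp (- (pi * (real (Suc n))\<^sup>2) * exp u))"
  have fb: "has_bochner_integral lborel (f n) (pi powr (- (s / 2)) * Gamma (s / 2) * real (Suc n) powr (- s))" for n
  proof -
    have "has_bochner_integral lborel (f n) ((pi * (real (Suc n))\<^sup>2) powr (- (s / 2)) * Gamma (s / 2))"
      unfolding f_def by (rule gamma_integral_exp) (use s in auto)
    moreover have "(pi * (real (Suc n))\<^sup>2) powr (- (s / 2)) = pi powr (- (s / 2)) * real (Suc n) powr (- s)"
    proof -
      have "((real (Suc n))\<^sup>2) powr (- (s / 2)) = (real (Suc n) powr 2) powr (- (s / 2))"
        by (subst powr_numeral) auto
      also have "\<dots> = real (Suc n) powr (- s)" by (subst powr_powr) simp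
      finally show ?thesis by (subst powr_mult) auto
    qed
    ultimately show ?thesis by (simp only: mult_ac)
  qed
  have fi: "integrable lborel (f n)" for n using fb by (simp add: has_bochner_integral_iff)
  have fv: "(\<integral>u. f n u \<partial>lborel) = pi powr (- (s / 2)) * Gamma (s / 2) * real (Suc n) powr (- s)" for n
    using fb by (rule has_bochner_integral_integral_eq)
  have nf: "norm (f n u) = f n u" for n u by (simp add: f_def)
  have "summable (\<lambda>n. real n powr (- s))" using s by (simp add: summable_real_powr_iff)
  hence "summable (\<lambda>n. real (Suc n) powr (- s))" by (subst summable_Suc_iff)
  hence sv: "summable (\<lambda>n. \<integral>u. norm (f n u) \<partial>lborel)"
    unfolding nf fv by (rule summable_mult)
  have sums: "(\<lambda>n. f n u) sums (exp (u * (s / 2)) * theta_tail (exp u))" for u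
  proof -
    have "(\<lambda>n. exp (- pi * (real (Suc n))\<^sup>2 * exp u)) sums theta_tail (exp u)"
      unfolding theta_tail_def by (intro summable_sums theta_tail_summable) simp
    hence "(\<lambda>n. exp (u * (s / 2)) * exp (- pi * (real (Suc n))\<^sup>2 * exp u)) sums (exp (u * (s / 2)) * theta_tail (exp u))"
      by (rule sums_mult)
    thus ?thesis by (simp only: f_def mult_minus_left)
  qed
  have ae: "AE u in lborel. summable (\<lambda>n. norm (f n u))"
    unfolding nf using sums by (auto intro!: AE_I2 simp: sums_iff)
  have sm: "(\<Sum>n. f n u) = exp (u * (s / 2)) * theta_tail (exp u)" for u
    using sums by (simp add: sums_iff)
  show "integrable lborel (\<lambda>u. exp (u * (s / 2)) * theta_tail (exp u))"
    using integrable_suminf[OF fi ae sv] by (simp only: sm)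
  show "(\<lambda>n. pi powr (- (s / 2)) * Gamma (s / 2) * real (Suc n) powr (- s)) sums
           (\<integral>u. exp (u * (s / 2)) * theta_tail (exp u) \<partial>lborel)"
    using sums_integral[OF fi ae sv] by (simp only: sm fv)
qed

text \<open>The half line \<open>u < 0\<close> is reflected to \<open>u > 0\<close>, where
  \<open>theta_tail_exp_minus\<close> replaces \<open>s\<close> by \<open>1 - s\<close> and leaves
  two pure exponentials; their integrals are the polar terms \<open>1 / (s - 1)\<close> and
  \<open>- 1 / s\<close>.\<close>

lemma mellin_split:
  fixes s :: real
  assumes s: "s > 1"
  shows "(\<integral>u. exp (u * (s / 2)) * theta_tail (exp u) \<partial>lborel) =
     (\<integral>u. exp (u * (s / 2)) * theta_weight u \<partial>lborel) +
     (\<integral>u. exp (u * ((1 - s) / 2)) * theta_weight u \<partial>lborel) + 1 / (s - 1) - 1 / s"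
proof -
  define T where "T = (\<lambda>u. exp (u * (s / 2)) * theta_tail (exp u))"
  have T: "integrable lborel T" unfolding T_def by (rule mellin_theta_tail(1)[OF s])
  define N where "N = (\<lambda>u. T u - exp (u * (s / 2)) * theta_weight u)"
  have N: "integrable lborel N"
    unfolding N_def by (intro Bochner_Integration.integrable_diff T integrable_theta_weight_exp)
  have "(\<integral>u. T u \<partial>lborel) = (\<integral>u. exp (u * (s / 2)) * theta_weight u \<partial>lborel) + (\<integral>u. N u \<partial>lborel)"
    unfolding N_def by (subst Bochner_Integration.integral_diff[OF T integrable_theta_weight_exp]) simp
  also have "(\<integral>u. N u \<partial>lborel) = (\<integral>u. N (0 + (- 1) * u) \<partial>lborel)"
    using lborel_integral_real_affine[of "- 1" N 0] by simp
  also have "\<dots> = (\<integral>u. exp (u * ((1 - s) / 2)) * theta_weight u +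
      (1 / 2 * (indicator {0..} u * exp (- ((s - 1) / 2) * u)) - 1 / 2 * (indicator {0..} u * exp (- (s / 2) * u))) \<partial>lborel)"
  \<comment> \<open>Equality fails at the single point \<open>u = 0\<close>, which belongs to the
    support of the weight before and after the reflection.\<close>
  proof (rule integral_cong_AE)
    show "AE u in lborel. N (0 + (- 1) * u) = exp (u * ((1 - s) / 2)) * theta_weight u +
      (1 / 2 * (indicator {0..} u * exp (- ((s - 1) / 2) * u)) - 1 / 2 * (indicator {0..} u * exp (- (s / 2) * u)))"
      using AE_lborel_singleton[of "0::real"]
    proof eventually_elim
      case (elim u)
      show ?case
      proof (cases "u > 0")
        case True
        have e: "exp (- u * (s / 2)) * exp (u / 2) = exp (u * ((1 - s) / 2))"
          "exp (- u * (s / 2)) = exp (- (s / 2) * u)" "exp (u * ((1 - s) / 2)) = exp (- ((s - 1) / 2) * u)"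
          by (simp_all add: exp_add[symmetric] algebra_simps diff_divide_distrib)
        have "N (0 + (- 1) * u) = exp (- u * (s / 2)) * theta_tail (exp (- u))"
          using True by (simp add: N_def T_def theta_weight_def)
        also have "\<dots> = (exp (- u * (s / 2)) * exp (u / 2)) * theta_tail (exp u)
            + 1 / 2 * (exp (- u * (s / 2)) * exp (u / 2)) - 1 / 2 * exp (- u * (s / 2))"
          unfolding theta_tail_exp_minus by (simp add: algebra_simps diff_divide_distrib)
        also have "\<dots> = exp (u * ((1 - s) / 2)) * theta_tail (exp u)
            + 1 / 2 * exp (- ((s - 1) / 2) * u) - 1 / 2 * exp (- (s / 2) * u)"
          unfolding e(1) unfolding e(2) by (simp only: e(3))
        finally show ?thesis using True by (simp add: theta_weight_def)
      next
        case False
        thus ?thesis using elim by (simp add: N_def T_def theta_weight_def)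
      qed
    qed
  qed (use N in \<open>auto simp: N_def T_def\<close>)
  also have "\<dots> = (\<integral>u. exp (u * ((1 - s) / 2)) * theta_weight u \<partial>lborel) +
      (1 / 2 * (1 / ((s - 1) / 2)) - 1 / 2 * (1 / (s / 2)))"
  proof -
    have h1: "has_bochner_integral lborel (\<lambda>u. indicator {0..} u * exp (- ((s - 1) / 2) * u)) (1 / ((s - 1) / 2))"
      by (rule has_bochner_integral_exp_minus) (use s in simp)
    have h2: "has_bochner_integral lborel (\<lambda>u. indicator {0..} u * exp (- (s / 2) * u)) (1 / (s / 2))"
      by (rule has_bochner_integral_exp_minus) (use s in simp)
    have h3: "has_bochner_integral lborel (\<lambda>u. exp (u * ((1 - s) / 2)) * theta_weight u) (\<integral>u. exp (u * ((1 - s) / 2)) * theta_weight u \<partial>lborel)"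
      by (rule has_bochner_integral_integrable[OF integrable_theta_weight_exp])
    show ?thesis
      by (rule has_bochner_integral_integral_eq)
         (intro has_bochner_integral_add has_bochner_integral_diff has_bochner_integral_mult_right h1 h2 h3)
  qed
  finally show ?thesis by (simp add: T_def)
qed

text \<open>This is \<open>s * (s - 1) * pi powr (- s / 2) * Gamma (s / 2) * zeta s\<close>, twice
  the usual normalisation; the summand 1 is what the polar terms become. In this form it is visibly
  entire and invariant under \<open>s\<close> to \<open>1 - s\<close>.\<close>

definition xi :: "complex \<Rightarrow> complex" where
  "xi s = 1 + s * (s - 1) * (theta_mellin s + theta_mellin (1 - s))"

lemma xi_holomorphic: "xi holomorphic_on A"
proof -
  have "(\<lambda>s. theta_mellin (1 - s)) holomorphic_on A"
    by (rule holomorphic_on_compose_gen[OF _ theta_mellin_holomorphic[of UNIV], unfolded o_def])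
       (auto intro!: holomorphic_intros)
  thus ?thesis unfolding xi_def by (intro holomorphic_intros theta_mellin_holomorphic)
qed

lemma xi_symmetric: "xi (1 - s) = xi s"
  by (simp add: xi_def algebra_simps)

lemma xi_cnj: "xi (cnj s) = cnj (xi s)"
  using theta_mellin_cnj[of s] theta_mellin_cnj[of "1 - s"] by (simp add: xi_def)

lemma xi_growth:
  assumes "r \<ge> 1" "norm s \<le> r"
  shows "norm (xi s) \<le> 1 + 4 * (r + 1)\<^sup>2 * exp (r * ln r)"
proof -
  have re: "Re s \<le> r" "Re (1 - s) \<le> 1 + r"
    using assms(2) abs_Re_le_cmod[of s] by auto
  have t: "norm (theta_mellin s + theta_mellin (1 - s)) \<le> 4 * exp (r * ln r)"
    using norm_triangle_ineq[of "theta_mellin s" "theta_mellin (1 - s)"]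
      theta_mellin_norm_le[OF assms(1), of s] theta_mellin_norm_le[OF assms(1), of "1 - s"] re assms(1)
    by simp
  have "norm (s * (s - 1)) \<le> (r + 1) * (r + 1)"
    unfolding norm_mult using assms norm_triangle_ineq4[of s 1] by (intro mult_mono) auto
  hence "norm (s * (s - 1) * (theta_mellin s + theta_mellin (1 - s))) \<le> (r + 1)\<^sup>2 * (4 * exp (r * ln r))"
    unfolding norm_mult[of "s * (s - 1)"] power2_eq_square using t by (intro mult_mono) auto
  thus ?thesis unfolding xi_def
    using norm_triangle_ineq[of 1 "s * (s - 1) * (theta_mellin s + theta_mellin (1 - s))"] by simp
qed

section \<open>Analytic continuation of the zeta function\<close>

lemma dirichlet_zeta_of_real_sums:
  assumes "s > 1"
  shows "(\<lambda>n. of_real (real (Suc n) powr - s)) sums dirichlet_zeta (of_real s)"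
proof -
  have "(1 / of_nat (Suc n) powr of_real s :: complex) = of_real (real (Suc n) powr - s)" for n
  proof -
    have "of_nat (Suc n) powr of_real s = complex_of_real (real (Suc n) powr s)"
      using powr_of_real[of "real (Suc n)" s] by simp
    thus ?thesis by (simp add: powr_minus inverse_eq_divide)
  qed
  thus ?thesis using dirichlet_zeta_sums[of "of_real s"] assms by simp
qed

text \<open>The continuation of \<open>(s - 1) * zeta s\<close>. Writing
  \<open>s * Gamma (s / 2)\<close> as \<open>2 * Gamma (s / 2 + 1)\<close> and using the reciprocal
  \<open>rGamma\<close> avoids every pole.\<close>

definition zeta_num :: "complex \<Rightarrow> complex" where
  "zeta_num s = xi s * exp (s / 2 * of_real (ln pi)) * rGamma (s / 2 + 1) / 2"

lemma zeta_num_holomorphic: "zeta_num holomorphic_on A"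
  unfolding zeta_num_def by (intro holomorphic_intros xi_holomorphic) auto

lemma zeta_num_real:
  assumes s: "s > 1"
  shows "zeta_num (of_real s) = (of_real s - 1) * dirichlet_zeta (of_real s)"
proof -
  define g where "g = pi powr (- (s / 2)) * Gamma (s / 2)"
  define M where "M = (\<integral>u. exp (u * (s / 2)) * theta_tail (exp u) \<partial>lborel)"
  have "(\<lambda>n. of_real (g * real (Suc n) powr (- s)) :: complex) sums of_real M"
    unfolding g_def M_def by (intro sums_of_real mellin_theta_tail(2) s)
  moreover have "(\<lambda>n. of_real g * of_real (real (Suc n) powr - s)) sums (of_real g * dirichlet_zeta (of_real s))"
    by (intro sums_mult dirichlet_zeta_of_real_sums s)
  ultimately have gz: "of_real g * dirichlet_zeta (of_real s) = of_real M"
    by (simp add: sums_iff)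
  have M: "(of_real M :: complex) = theta_mellin (of_real s) + theta_mellin (of_real (1 - s)) + of_real (1 / (s - 1) - 1 / s)"
    unfolding M_def mellin_split[OF s] theta_mellin_of_real by simp
  have "of_real (s * (s - 1)) * of_real (1 / (s - 1) - 1 / s) = (1 :: complex)"
    unfolding of_real_mult[symmetric] using s by (simp add: field_simps)
  hence "xi (of_real s) = of_real (s * (s - 1)) * of_real M"
    unfolding M xi_def by (simp add: distrib_left)
  hence xi: "xi (of_real s) = of_real s * (of_real s - 1) * of_real g * dirichlet_zeta (of_real s)"
    using gz by (simp add: mult.assoc)
  have G: "Gamma (of_real s / 2 :: complex) = of_real (Gamma (s / 2))"
    using Gamma_complex_of_real[of "s / 2"] by simp
  have s2: "(of_real s / 2 :: complex) \<noteq> 0" "(of_real s / 2 :: complex) \<notin> \<int>\<^sub>\<le>\<^sub>0"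
    using s by (auto elim!: nonpos_Ints_cases simp: complex_eq_iff)
  have "Gamma (of_real s / 2 + 1 :: complex) = of_real s / 2 * of_real (Gamma (s / 2))"
    using Gamma_plus1[OF s2(2)] G by simp
  hence rG: "rGamma (of_real s / 2 + 1 :: complex) = inverse (of_real s / 2 * of_real (Gamma (s / 2)))"
    by (simp only: rGamma_inverse_Gamma)
  have pip: "exp (of_real s / 2 * of_real (ln pi) :: complex) = of_real (pi powr (s / 2))"
    by (simp add: powr_def exp_of_real[symmetric])
  have Gp: "Gamma (s / 2) > 0" using s by (intro Gamma_real_pos) simp
  have "zeta_num (of_real s) = of_real s * (of_real s - 1) * (of_real (pi powr (- (s / 2))) * of_real (Gamma (s / 2)))
     * dirichlet_zeta (of_real s) * of_real (pi powr (s / 2)) * inverse (of_real s / 2 * of_real (Gamma (s / 2))) / 2"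
    unfolding zeta_num_def xi pip rG g_def by simp
  also have "\<dots> = (of_real s - 1) * dirichlet_zeta (of_real s) * of_real (pi powr (- (s / 2)) * pi powr (s / 2))"
  proof -
    have "S * (S - 1) * (p * g) * D * q * inverse (S / 2 * g) / 2 = (S - 1) * D * (p * q)"
      if "S \<noteq> 0" "g \<noteq> 0" for S p g D q :: complex
      using that by (simp add: divide_simps mult_ac)
    moreover have "of_real (Gamma (s / 2)) \<noteq> (0::complex)"
      unfolding of_real_eq_0_iff using Gp by linarith
    moreover have "of_real s \<noteq> (0::complex)" using s by simp
    ultimately show ?thesis unfolding of_real_mult by blast
  qed
  also have "pi powr (- (s / 2)) * pi powr (s / 2) = 1" by (simp add: powr_add[symmetric])
  finally show ?thesis by simp
qed

lemma dirichlet_zeta_holomorphic: "dirichlet_zeta holomorphic_on {s. Re s > 1}"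
proof (rule holomorphic_uniform_sequence[of _ "\<lambda>N s. \<Sum>n<N. 1 / of_nat (Suc n) powr s"])
  show "open {s. Re s > 1}" by (rule open_halfspace_Re_gt)
  show "(\<lambda>s. \<Sum>n<N. 1 / of_nat (Suc n) powr s) holomorphic_on {s. Re s > 1}" for N
    by (intro holomorphic_intros) (auto simp: powr_def)
  fix s assume s: "s \<in> {s. Re s > 1}"
  define d where "d = (Re s - 1) / 2"
  have d: "d > 0" using s by (simp add: d_def)
  have re: "Re w \<ge> 1 + d" if "w \<in> cball s d" for w
  proof -
    have "\<bar>Re s - Re w\<bar> \<le> d" using that abs_Re_le_cmod[of "s - w"] by (simp add: dist_norm)
    hence "Re w \<ge> Re s - d" by linarith
    thus ?thesis by (simp add: d_def field_simps)
  qed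
  have "summable (\<lambda>n. real n powr (- (1 + d)))" using d by (simp add: summable_real_powr_iff)
  hence sm: "summable (\<lambda>n. real (Suc n) powr (- (1 + d)))" by (subst summable_Suc_iff)
  have "uniform_limit (cball s d) (\<lambda>N s. \<Sum>n<N. 1 / of_nat (Suc n) powr s) (\<lambda>s. \<Sum>n. 1 / of_nat (Suc n) powr s) sequentially"
  proof (rule Weierstrass_m_test[OF _ sm])
    fix n w assume "w \<in> cball s d"
    have "norm (1 / of_nat (Suc n) powr w :: complex) = real (Suc n) powr (- Re w)"
      unfolding norm_divide norm_of_nat_powr powr_minus by (simp add: inverse_eq_divide)
    also have "\<dots> \<le> real (Suc n) powr (- (1 + d))"
      using re[OF \<open>w \<in> cball s d\<close>] by (intro powr_mono) auto
    finally show "norm (1 / of_nat (Suc n) powr w :: complex) \<le> real (Suc n) powr (- (1 + d))" .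
  qed
  moreover have "cball s d \<subseteq> {s. Re s > 1}" using re d by force
  ultimately show "\<exists>d>0. cball s d \<subseteq> {s. Re s > 1} \<and>
      uniform_limit (cball s d) (\<lambda>N s. \<Sum>n<N. 1 / of_nat (Suc n) powr s) dirichlet_zeta sequentially"
    using d unfolding dirichlet_zeta_def[abs_def] by blast
qed

lemma zeta_num_eq:
  assumes "Re s > 1"
  shows "zeta_num s = (s - 1) * dirichlet_zeta s"
proof -
  let ?S = "{s. Re s > 1}"
  have "zeta_num s - (s - 1) * dirichlet_zeta s = 0"
  proof (rule analytic_continuation[of "\<lambda>s. zeta_num s - (s - 1) * dirichlet_zeta s" ?S "of_real ` {1<..}" "of_real 2" s])
    show "(\<lambda>s. zeta_num s - (s - 1) * dirichlet_zeta s) holomorphic_on ?S"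
      by (intro holomorphic_intros zeta_num_holomorphic dirichlet_zeta_holomorphic)
    show "open ?S" by (rule open_halfspace_Re_gt)
    show "connected ?S" by (intro convex_connected convex_halfspace_Re_gt)
    show "of_real ` {1<..} \<subseteq> ?S" by auto
    show "(of_real 2 :: complex) islimpt of_real ` {1<..}"
      unfolding islimpt_approachable
    proof (intro allI impI)
      fix e :: real assume e: "e > 0"
      have "dist (of_real (2 + e / 2) :: complex) (of_real 2) < e"
        unfolding dist_of_real using e by (simp add: dist_real_def)
      moreover have "(of_real (2 + e / 2) :: complex) \<noteq> of_real 2" unfolding of_real_eq_iff using e by simp
      moreover have "(of_real (2 + e / 2) :: complex) \<in> of_real ` {1<..}" using e by (intro imageI) simp
      ultimately show "\<exists>x'\<in>of_real ` {1<..}. x' \<noteq> (of_real 2 :: complex) \<and> dist x' (of_real 2) < e" by blast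
    qed
  qed (use assms zeta_num_real in auto)
  thus ?thesis by simp
qed

section \<open>The Riemann xi function on the critical line\<close>

text \<open>Uniqueness in the description is analytic continuation on the connected punctured plane.
  At \<open>s = 1\<close> the right-hand side is a division by 0, which agrees with the prescribed
  value 0.\<close>

lemma zeta_eq: "zeta s = zeta_num s / (s - 1)"
proof -
  define P where "P = (\<lambda>f. f holomorphic_on (- {1}) \<and>
     (\<forall>s. Re s > 1 \<longrightarrow> (\<lambda>n. 1 / of_nat (Suc n) powr s) sums f s) \<and> f 1 = (0::complex))"
  define f0 where "f0 = (\<lambda>s. zeta_num s / (s - 1))"
  have hol: "f0 holomorphic_on - {1}"
    unfolding f0_def by (intro holomorphic_intros zeta_num_holomorphic) auto
  have f0: "f0 s = dirichlet_zeta s" if "Re s > 1" for s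
    using zeta_num_eq[OF that] that by (auto simp: f0_def)
  have P0: "P f0"
    unfolding P_def using hol dirichlet_zeta_sums f0 by (auto simp: f0_def)
  have uniq: "f = f0" if "P f" for f
  proof
    fix s
    have f: "f holomorphic_on - {1}" "\<And>s. Re s > 1 \<Longrightarrow> (\<lambda>n. 1 / of_nat (Suc n) powr s) sums f s" "f 1 = 0"
      using that by (auto simp: P_def)
    show "f s = f0 s"
    proof (cases "s = 1")
      case False
      show ?thesis
      proof (rule analytic_continuation_open[of "{s. Re s > 1}" "- {1}" f f0 s])
        show "open {s. Re s > 1}" by (rule open_halfspace_Re_gt)
        show "{s. Re s > 1} \<noteq> {}" by (auto intro!: exI[of _ 2])
        show "connected (- {1::complex})" by (rule connected_punctured_universe) simp
        show "f z = f0 z" if "z \<in> {s. Re s > 1}" for z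
          using f(2)[of z] dirichlet_zeta_sums[of z] f0[of z] that by (auto simp: sums_iff)
      qed (use f hol False in auto)
    qed (simp add: f f0_def)
  qed
  have "zeta = f0"
  proof -
    have "(THE f. P f) = f0" by (rule the_equality[of P f0, OF P0 uniq])
    thus ?thesis unfolding zeta_def P_def .
  qed
  from fun_cong[OF this, of s] show ?thesis by (simp only: f0_def)
qed

text \<open>The Euler product settles \<open>Re s > 1\<close>, the 3-4-1 argument the line apart
  from 1, and at 1 itself the definition gives \<open>xi 1 = 1\<close>.\<close>

lemma xi_nonzero_right:
  assumes "Re s \<ge> 1"
  shows "xi s \<noteq> 0"
proof
  assume xi0: "xi s = 0"
  hence z0: "zeta_num s = 0" by (simp add: zeta_num_def)
  have "s \<noteq> 1" using xi0 by (auto simp: xi_def)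
  show False
  proof (cases "Re s > 1")
    case True
    thus ?thesis using zeta_num_eq[OF True] dirichlet_zeta_nonzero[OF True] z0 \<open>s \<noteq> 1\<close> by simp
  next
    case False
    hence s: "s = Complex 1 (Im s)" using assms by (simp add: complex_eq_iff)
    hence "Im s \<noteq> 0" using \<open>s \<noteq> 1\<close> by (auto simp: complex_eq_iff)
    thus ?thesis using nonzero_on_line_one[OF zeta_num_holomorphic zeta_num_eq] z0 s by metis
  qed
qed

text \<open>The hypothesis concerns zeros of \<open>zeta\<close> in the open critical strip; the
  zero-free half plane \<open>Re s \<ge> 1\<close> and its mirror image confine every zero of
  \<open>xi\<close> to that strip.\<close>

lemma xi_zero_critical_line:
  assumes rh: riemann_hypothesis and s: "xi s = 0"
  shows "Re s = 1 / 2"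
proof -
  have "Re s < 1" using xi_nonzero_right[of s] s by force
  moreover have "Re (1 - s) < 1" using xi_nonzero_right[of "1 - s"] s xi_symmetric[of s] by force
  moreover have "zeta s = 0" using s by (simp add: zeta_eq zeta_num_def)
  ultimately show ?thesis using rh by (auto simp: riemann_hypothesis_def)
qed

definition Xi :: "complex \<Rightarrow> complex" where
  "Xi t = xi (1 / 2 + \<i> * t)"

lemma Xi_holomorphic: "Xi holomorphic_on A"
  unfolding Xi_def
  by (rule holomorphic_on_compose_gen[OF _ xi_holomorphic[of UNIV], unfolded o_def])
     (auto intro!: holomorphic_intros)

lemma Xi_real: "Xi (of_real x) \<in> \<real>"
proof -
  have "cnj (1 / 2 + \<i> * of_real x) = 1 - (1 / 2 + \<i> * of_real x)" by (simp add: complex_eq_iff)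
  hence "cnj (Xi (of_real x)) = Xi (of_real x)"
    unfolding Xi_def using xi_cnj[of "1 / 2 + \<i> * of_real x"] xi_symmetric[of "1 / 2 + \<i> * of_real x"] by simp
  thus ?thesis by (simp add: Reals_cnj_iff)
qed

lemma Xi_growth:
  assumes "\<epsilon> > (0::real)"
  shows "\<exists>R0. \<forall>z. norm z \<ge> R0 \<longrightarrow> norm (Xi z) \<le> exp (\<epsilon> * (norm z)\<^sup>2)"
proof -
  have "eventually (\<lambda>x::real. 1 + 4 * ((x + 1) + 1)\<^sup>2 * exp ((x + 1) * ln (x + 1)) \<le> exp (\<epsilon> * x\<^sup>2)) at_top"
    using assms by real_asymp
  then obtain R0 where R0: "\<And>x::real. x \<ge> R0 \<Longrightarrow> 1 + 4 * ((x + 1) + 1)\<^sup>2 * exp ((x + 1) * ln (x + 1)) \<le> exp (\<epsilon> * x\<^sup>2)"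
    by (auto simp: eventually_at_top_linorder)
  have "norm (Xi z) \<le> exp (\<epsilon> * (norm z)\<^sup>2)" if "norm z \<ge> R0" for z
  proof -
    have "norm (1 / 2 + \<i> * z) \<le> norm z + 1"
      using norm_triangle_ineq[of "1 / 2" "\<i> * z"] by (simp add: norm_mult)
    from xi_growth[OF _ this] have "norm (Xi z) \<le> 1 + 4 * ((norm z + 1) + 1)\<^sup>2 * exp ((norm z + 1) * ln (norm z + 1))"
      by (simp add: Xi_def)
    also have "\<dots> \<le> exp (\<epsilon> * (norm z)\<^sup>2)" by (rule R0[OF that])
    finally show ?thesis .
  qed
  thus ?thesis by blast
qed

section \<open>Growth of the logarithmic derivative of xi\<close>

lemma Re_Digamma_large: "\<exists>B. \<forall>z::complex. Re z \<ge> 1 \<longrightarrow> \<bar>Im z\<bar> \<ge> B \<longrightarrow> Re (Digamma z) \<ge> M"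
proof -
  have "filterlim (harm :: nat \<Rightarrow> real) at_top sequentially" by (rule harm_at_top)
  hence "eventually (\<lambda>N. harm N \<ge> M + euler_mascheroni + 1) sequentially"
    by (rule filterlim_at_top[THEN iffD1, rule_format])
  then obtain N where N: "(harm N :: real) \<ge> M + euler_mascheroni + 1"
    by (auto simp: eventually_at_top_linorder)
  have "Re (Digamma z) \<ge> M" if z: "Re z \<ge> 1" "\<bar>Im z\<bar> \<ge> real N + 1" for z :: complex
  proof -
    \<comment> \<open>Real parts of the terms of the digamma series, nonnegative for
      \<open>Re z \<ge> 1\<close>. When \<open>\<bar>Im z\<bar> \<ge> N + 1\<close>, each of the
      first \<open>N\<close> falls short of \<open>1 / (k + 1)\<close> by at most
      \<open>1 / (N + 1)\<close>, so their sum is at least \<open>harm N - 1\<close>.\<close>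
    define b where "b = (\<lambda>k. Re (inverse (of_nat (Suc k)) - inverse (z + of_nat k)))"
    have z0: "z \<noteq> 0" using z by auto
    have ds: "(\<lambda>k. inverse (of_nat (Suc k)) - inverse (z + of_nat k)) sums (Digamma z + euler_mascheroni)"
      using summable_sums[OF summable_Digamma[OF z0]] by (simp add: Digamma_def)
    have "Re (euler_mascheroni :: complex) = euler_mascheroni"
      by (metis Re_complex_of_real of_real_euler_mascheroni)
    hence bs: "b sums (Re (Digamma z) + euler_mascheroni)"
      using sums_Re[OF ds] by (simp only: b_def plus_complex.simps)
    have br: "b k = 1 / real (Suc k) - (Re z + real k) / ((Re z + real k)\<^sup>2 + (Im z)\<^sup>2)" for k
    proof -
      have "Re (inverse (of_nat (Suc k) :: complex)) = 1 / real (Suc k)"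
        by (metis Re_complex_of_real inverse_eq_divide of_real_inverse of_real_of_nat_eq)
      thus ?thesis by (simp add: b_def)
    qed
    have b0: "b k \<ge> 0" for k
    proof -
      have p: "Re z + real k \<ge> real (Suc k)" "Re z + real k > 0" using z by simp_all
      have "(Re z + real k) / ((Re z + real k)\<^sup>2 + (Im z)\<^sup>2) \<le> (Re z + real k) / (Re z + real k)\<^sup>2"
        using p by (intro divide_left_mono mult_pos_pos) (auto simp: add_pos_nonneg)
      also have "\<dots> = 1 / (Re z + real k)" using p by (simp add: power2_eq_square)
      also have "\<dots> \<le> 1 / real (Suc k)" using p by (intro divide_left_mono mult_pos_pos) auto
      finally show ?thesis unfolding br by simp
    qed
    have b1: "b k \<ge> 1 / real (Suc k) - 1 / (real N + 1)" for k
    proof -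
      define a where "a = Re z + real k"
      have a: "a > 0" using z by (simp add: a_def)
      have N1: "real N + 1 > 0" by simp
      have "2 * a * \<bar>Im z\<bar> \<le> a\<^sup>2 + (Im z)\<^sup>2"
        using zero_le_power2[of "a - \<bar>Im z\<bar>"] by (simp add: power2_eq_square algebra_simps)
      moreover have "a * (real N + 1) \<le> a * \<bar>Im z\<bar>" using a z by (intro mult_left_mono) auto
      moreover have "a * \<bar>Im z\<bar> \<ge> 0" using a by simp
      ultimately have "a * (real N + 1) \<le> a\<^sup>2 + (Im z)\<^sup>2" by linarith
      moreover have "a\<^sup>2 + (Im z)\<^sup>2 > 0" using a by (simp add: add_pos_nonneg)
      ultimately have "a / (a\<^sup>2 + (Im z)\<^sup>2) \<le> 1 / (real N + 1)"
        using N1 by (simp add: divide_le_eq le_divide_eq mult.commute pos_divide_le_eq)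
      thus ?thesis unfolding br a_def[symmetric] by simp
    qed
    have "harm N - 1 \<le> (\<Sum>k<N. 1 / real (Suc k)) - real N * (1 / (real N + 1))"
    proof -
      have "(harm N :: real) = (\<Sum>k<N. 1 / real (Suc k))"
        unfolding harm_def by (simp add: sum.atLeast1_atMost_eq inverse_eq_divide)
      moreover have "real N * (1 / (real N + 1)) \<le> 1" by simp
      ultimately show ?thesis by linarith
    qed
    also have "\<dots> = (\<Sum>k<N. 1 / real (Suc k) - 1 / (real N + 1))" by (simp add: sum_subtractf)
    also have "\<dots> \<le> (\<Sum>k<N. b k)" by (intro sum_mono b1)
    also have "\<dots> \<le> suminf b" using bs b0 by (intro sum_le_suminf) (auto simp: sums_iff)
    also have "\<dots> = Re (Digamma z) + euler_mascheroni" using bs by (simp add: sums_iff)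
    finally show ?thesis using N by linarith
  qed
  thus ?thesis by blast
qed

lemma dirichlet_zeta_bound_2:
  assumes "Re s \<ge> 2"
  shows "norm (dirichlet_zeta s) \<le> 8 / 3"
proof -
  have sq: "(\<lambda>n. 1 / (real n + 1)\<^sup>2) sums (pi\<^sup>2 / 6)" using inverse_squares_sums by (simp add: add.commute)
  have "norm (dirichlet_zeta s) \<le> (\<Sum>n. 1 / (real n + 1)\<^sup>2)"
    unfolding dirichlet_zeta_def
  proof (rule norm_suminf_le)
    fix n
    have "norm (1 / of_nat (Suc n) powr s :: complex) = 1 / (real n + 1) powr Re s"
      unfolding norm_divide norm_of_nat_powr by (simp add: add.commute)
    also have "\<dots> \<le> 1 / (real n + 1) powr 2"
      using assms by (intro divide_left_mono powr_mono) auto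
    finally show "norm (1 / of_nat (Suc n) powr s :: complex) \<le> 1 / (real n + 1)\<^sup>2" by simp
  qed (use sq in \<open>simp add: sums_iff\<close>)
  also have "\<dots> = pi\<^sup>2 / 6" using sq by (simp add: sums_iff)
  also have "pi\<^sup>2 \<le> 4\<^sup>2" using pi_less_4 by (intro power_mono) auto
  finally show ?thesis by simp
qed

lemma dirichlet_zeta_lower_3:
  assumes "Re s = 3"
  shows "norm (dirichlet_zeta s) \<ge> 1 / 6"
proof -
  have sq: "(\<lambda>n. 1 / (real n + 1)\<^sup>2) sums (pi\<^sup>2 / 6)" using inverse_squares_sums by (simp add: add.commute)
  have "(\<lambda>n. 1 / (real (Suc n) + 1)\<^sup>2) sums (pi\<^sup>2 / 6 - 1 / (real 0 + 1)\<^sup>2)"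
    by (subst sums_Suc_iff) (use sq in simp)
  hence sq': "(\<lambda>n. 1 / 2 * (1 / (real (Suc n) + 1)\<^sup>2)) sums (1 / 2 * (pi\<^sup>2 / 6 - 1))"
    by (intro sums_mult) simp
  have ds: "(\<lambda>n. 1 / of_nat (Suc (Suc n)) powr s) sums (dirichlet_zeta s - 1)"
    using dirichlet_zeta_sums[of s] assms by (subst sums_Suc_iff) simp
  have "norm (dirichlet_zeta s - 1) \<le> (\<Sum>n. 1 / 2 * (1 / (real (Suc n) + 1)\<^sup>2))"
    unfolding sums_unique[OF ds]
  proof (rule norm_suminf_le)
    fix n
    have "norm (1 / of_nat (Suc (Suc n)) powr s :: complex) = 1 / (real n + 2) powr 3"
      unfolding norm_divide norm_of_nat_powr assms by (simp add: add.commute)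
    also have "\<dots> = 1 / (real n + 2) ^ 3" by simp
    also have "\<dots> \<le> 1 / (2 * (real n + 2)\<^sup>2)"
    proof (intro divide_left_mono)
      have "2 * (real n + 2)\<^sup>2 \<le> (real n + 2) * (real n + 2)\<^sup>2" by (intro mult_right_mono) auto
      thus "2 * (real n + 2)\<^sup>2 \<le> (real n + 2) ^ 3" by (simp add: power3_eq_cube power2_eq_square)
    qed auto
    finally show "norm (1 / of_nat (Suc (Suc n)) powr s :: complex) \<le> 1 / 2 * (1 / (real (Suc n) + 1)\<^sup>2)"
      by (simp add: add.commute)
  qed (use sq' in \<open>simp add: sums_iff\<close>)
  also have "\<dots> = 1 / 2 * (pi\<^sup>2 / 6 - 1)" using sums_unique[OF sq'] by simp
  also have "pi\<^sup>2 \<le> 4\<^sup>2" using pi_less_4 by (intro power_mono) auto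
  finally have "norm (dirichlet_zeta s - 1) \<le> 5 / 6" by simp
  thus ?thesis using norm_triangle_ineq2[of 1 "1 - dirichlet_zeta s"] by (simp add: norm_minus_commute)
qed

text \<open>Where the Dirichlet series converges, \<open>xi\<close> is a Gamma factor
  \<open>A\<close> times it. The logarithmic derivative of \<open>A\<close> contains
  \<open>Digamma (s / 2 + 1) / 2\<close>, whose real part grows without bound; by Cauchy's
  inequality on a unit circle the series contributes at most \<open>(8 / 3) / (1 / 6) = 16\<close>
  in modulus.\<close>

lemma xi_logderiv_large:
  "\<exists>X. \<forall>s. Re s = 3 \<longrightarrow> \<bar>Im s\<bar> \<ge> X \<longrightarrow> xi s \<noteq> 0 \<and> Re (deriv xi s / xi s) \<ge> L"
proof -
  obtain B where B: "\<And>z::complex. Re z \<ge> 1 \<Longrightarrow> \<bar>Im z\<bar> \<ge> B \<Longrightarrow> Re (Digamma z) \<ge> 2 * (L + ln pi / 2 + 16)"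
    using Re_Digamma_large by blast
  have "xi s \<noteq> 0 \<and> Re (deriv xi s / xi s) \<ge> L" if s: "Re s = 3" "\<bar>Im s\<bar> \<ge> 2 * B" for s
  proof
    show "xi s \<noteq> 0" using xi_nonzero_right[of s] s by simp
    let ?S = "{s. Re s > 1}"
    have oS: "open ?S" by (rule open_halfspace_Re_gt)
    have sS: "s \<in> ?S" using s by simp
    define A where "A = (\<lambda>w::complex. exp (ln_Gamma (w / 2 + 1) - w / 2 * of_real (ln pi)) * (2 * (w - 1)))"
    have xiA: "xi w = A w * dirichlet_zeta w" if "w \<in> ?S" for w
    proof -
      have np: "w / 2 + 1 \<notin> \<int>\<^sub>\<le>\<^sub>0" using that by (auto elim!: nonpos_Ints_cases simp: complex_eq_iff)
      have "exp (ln_Gamma (w / 2 + 1)) = Gamma (w / 2 + 1)"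
        using np by (simp add: Gamma_complex_altdef)
      hence r: "exp (ln_Gamma (w / 2 + 1)) * rGamma (w / 2 + 1) = 1"
        using np by (simp add: rGamma_inverse_Gamma Gamma_eq_zero_iff)
      have "A w * dirichlet_zeta w = exp (ln_Gamma (w / 2 + 1)) * exp (- (w / 2 * of_real (ln pi))) * 2 * zeta_num w"
      proof -
        have "exp (ln_Gamma (w / 2 + 1) - w / 2 * of_real (ln pi)) =
            exp (ln_Gamma (w / 2 + 1)) * exp (- (w / 2 * of_real (ln pi)))"
          by (simp only: exp_add[symmetric] diff_conv_add_uminus)
        moreover have "zeta_num w = (w - 1) * dirichlet_zeta w" using zeta_num_eq that by simp
        ultimately show ?thesis by (simp only: A_def mult_ac)
      qed
      also have "\<dots> = (exp (ln_Gamma (w / 2 + 1)) * rGamma (w / 2 + 1)) *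
          (exp (- (w / 2 * of_real (ln pi))) * exp (w / 2 * of_real (ln pi))) * xi w"
        by (simp add: zeta_num_def)
      also have "\<dots> = xi w" unfolding r by (simp add: exp_add[symmetric])
      finally show ?thesis by simp
    qed
    have np: "s / 2 + 1 \<notin> \<real>\<^sub>\<le>\<^sub>0" using s by (auto simp: complex_nonpos_Reals_iff)
    define E where "E = exp (ln_Gamma (s / 2 + 1) - s / 2 * of_real (ln pi))"
    have E0: "E \<noteq> 0" by (simp add: E_def)
    have dl: "((\<lambda>w. ln_Gamma (w / 2 + 1)) has_field_derivative Digamma (s / 2 + 1) * (1 / 2)) (at s)"
      by (rule DERIV_chain2[of ln_Gamma]) (use np in \<open>auto intro!: derivative_eq_intros\<close>)
    have dA: "(A has_field_derivative
        E * (Digamma (s / 2 + 1) / 2 - of_real (ln pi) / 2) * (2 * (s - 1)) + E * 2) (at s)"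
      unfolding A_def E_def by (rule derivative_eq_intros dl refl | simp)+
    have dz: "(dirichlet_zeta has_field_derivative deriv dirichlet_zeta s) (at s)"
      by (rule holomorphic_derivI[OF dirichlet_zeta_holomorphic oS sS])
    have A0: "A s \<noteq> 0" using s E0 by (auto simp: A_def E_def)
    have z0: "dirichlet_zeta s \<noteq> 0" using s by (intro dirichlet_zeta_nonzero) simp
    have "((\<lambda>w. A w * dirichlet_zeta w) has_field_derivative deriv xi s) (at s)"
      by (rule has_field_derivative_transform_within_open[OF holomorphic_derivI[OF xi_holomorphic[of UNIV] open_UNIV UNIV_I] oS sS])
         (simp add: xiA)
    hence "deriv xi s / xi s = deriv (\<lambda>w. A w * dirichlet_zeta w) s / (A s * dirichlet_zeta s)"
      by (simp add: DERIV_imp_deriv xiA[OF sS])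
    also have "\<dots> = (E * (Digamma (s / 2 + 1) / 2 - of_real (ln pi) / 2) * (2 * (s - 1)) + E * 2) / A s
        + deriv dirichlet_zeta s / dirichlet_zeta s"
      by (rule logderiv_mult[OF dA dz A0 z0])
    also have "A s = E * (2 * (s - 1))" by (simp add: A_def E_def)
    also have "(E * (Digamma (s / 2 + 1) / 2 - of_real (ln pi) / 2) * (2 * (s - 1)) + E * 2) / (E * (2 * (s - 1)))
       = (Digamma (s / 2 + 1) / 2 - of_real (ln pi) / 2) + 1 / (s - 1)"
    proof -
      have "(e * d * (2 * u) + e * 2) / (e * (2 * u)) = d + 1 / u" if "e \<noteq> 0" "u \<noteq> 0" for e d u :: complex
        using that by (simp add: divide_simps mult_ac distrib_left)
      moreover have "s - 1 \<noteq> 0" using s by auto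
      ultimately show ?thesis using E0 by blast
    qed
    finally have eq: "Re (deriv xi s / xi s) = Re (Digamma (s / 2 + 1)) / 2 - ln pi / 2 + Re (1 / (s - 1))
        + Re (deriv dirichlet_zeta s / dirichlet_zeta s)" by simp
    have "Re (1 / (s - 1)) \<ge> 0" using s by (simp add: Re_divide)
    moreover have "Re (Digamma (s / 2 + 1)) \<ge> 2 * (L + ln pi / 2 + 16)"
      by (rule B) (use s in auto)
    moreover have "Re (deriv dirichlet_zeta s / dirichlet_zeta s) \<ge> - 16"
    proof -
      have cb: "Re w \<ge> 2" if "w \<in> cball s 1" for w
        using that s abs_Re_le_cmod[of "s - w"] by (simp add: dist_norm)
      have hz: "dirichlet_zeta holomorphic_on cball s 1"
        by (rule holomorphic_on_subset[OF dirichlet_zeta_holomorphic]) (use cb in force)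
      have "norm ((deriv ^^ 1) dirichlet_zeta s) \<le> fact 1 * (8 / 3) / 1 ^ 1"
      proof (rule Cauchy_inequality)
        show "dirichlet_zeta holomorphic_on ball s 1" by (rule holomorphic_on_subset[OF hz]) auto
        show "continuous_on (cball s 1) dirichlet_zeta" by (rule holomorphic_on_imp_continuous_on[OF hz])
        show "norm (dirichlet_zeta x) \<le> 8 / 3" if "norm (s - x) = 1" for x
          using dirichlet_zeta_bound_2[of x] cb[of x] that by (simp add: dist_norm)
      qed simp
      hence "norm (deriv dirichlet_zeta s) \<le> 8 / 3" by simp
      hence "norm (deriv dirichlet_zeta s / dirichlet_zeta s) \<le> (8 / 3) / (1 / 6)"
        unfolding norm_divide using dirichlet_zeta_lower_3[OF s(1)] by (intro frac_le) auto
      also have "(8 / 3) / (1 / 6) = (16 :: real)" by simp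
      finally have "\<bar>Re (deriv dirichlet_zeta s / dirichlet_zeta s)\<bar> \<le> 16"
        by (rule order_trans[OF abs_Re_le_cmod])
      thus ?thesis by (simp only: abs_le_iff) linarith
    qed
    moreover have "L \<le> d / 2 - ln pi / 2 + r + q"
      if "0 \<le> r" "2 * (L + ln pi / 2 + 16) \<le> d" "- 16 \<le> q" for d r q
      using that by (simp add: field_simps)
    ultimately show "Re (deriv xi s / xi s) \<ge> L" unfolding eq by blast
  qed
  thus ?thesis by blast
qed

lemma Xi_logderiv_decays:
  assumes rh: riemann_hypothesis
  shows "logderiv_decays Xi (5 / 2)"
proof (rule logderiv_decays_from_above[OF Xi_holomorphic Xi_real])
  have dxi: "(xi has_field_derivative deriv xi s) (at s)" for s
    by (rule holomorphic_derivI[OF xi_holomorphic open_UNIV UNIV_I])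
  show zr: "Im z = 0" if "Xi z = 0" for z
    using xi_zero_critical_line[OF rh, of "1 / 2 + \<i> * z"] that by (simp add: Xi_def)
  show "Im (deriv Xi z / Xi z) \<le> 0" if "Im z > 0" for z
    by (rule Im_logderiv_entire_real_zeros[OF Xi_holomorphic Xi_real zr Xi_growth that])
  fix L :: real
  obtain X where X: "\<And>s. Re s = 3 \<Longrightarrow> \<bar>Im s\<bar> \<ge> X \<Longrightarrow> Re (deriv xi s / xi s) \<ge> L"
    using xi_logderiv_large by blast
  have "Im (deriv Xi (Complex x (5 / 2)) / Xi (Complex x (5 / 2))) \<le> - L" if "x > \<bar>X\<bar>" for x
  proof -
    define t where "t = Complex x (5 / 2)"
    define w where "w = 1 - (1 / 2 + \<i> * t)"
    have w: "Re w = 3" "Im w = - x" by (simp_all add: w_def t_def)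
    have eq: "Xi = (\<lambda>t. xi (1 - (1 / 2 + \<i> * t)))" by (rule ext) (simp only: Xi_def xi_symmetric)
    have "((\<lambda>t. xi (1 - (1 / 2 + \<i> * t))) has_field_derivative deriv xi w * (- \<i>)) (at t)"
      by (rule DERIV_chain2[of xi]) (use dxi in \<open>auto simp: w_def intro!: derivative_eq_intros\<close>)
    hence "deriv Xi t = deriv xi w * (- \<i>)" unfolding eq by (rule DERIV_imp_deriv)
    moreover have "Xi t = xi w" unfolding eq w_def ..
    ultimately have "deriv Xi t / Xi t = - (\<i> * (deriv xi w / xi w))" by simp
    moreover have "Im (- (\<i> * v)) = - Re v" for v by simp
    ultimately have "Im (deriv Xi t / Xi t) = - Re (deriv xi w / xi w)" by metis
    also have "\<dots> \<le> - L" using X[OF w(1)] w(2) that by simp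
    finally show ?thesis by (simp add: t_def)
  qed
  thus "\<exists>X. \<forall>x>X. Im (deriv Xi (Complex x (5 / 2)) / Xi (Complex x (5 / 2))) \<le> - L" by blast
qed simp

section \<open>The Hardy function\<close>

lemma cnj_ln_Gamma:
  assumes "Re z > 0"
  shows "ln_Gamma (cnj z) = cnj (ln_Gamma z)"
proof -
  have np: "w \<notin> \<int>\<^sub>\<le>\<^sub>0" if "Re w > 0" for w :: complex
    using that by (auto elim!: nonpos_Ints_cases)
  have cl: "ln (cnj w) = cnj (ln w)" if "Re w > 0" for w :: complex
    using that by (intro cnj_Ln[symmetric]) (auto simp: complex_nonpos_Reals_iff)
  have ser: "ln_Gamma_series (cnj z) n = cnj (ln_Gamma_series z n)" if "n > 0" for n
  proof -
    have 1: "cnj (ln (of_nat n :: complex)) = ln (of_nat n)" using cl[of "of_nat n"] that by simp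
    have 2: "ln (cnj z / of_nat k + 1) = cnj (ln (z / of_nat k + 1))" for k
    proof -
      have "Re (z / of_nat k + 1) > 0" using assms by (simp add: add_nonneg_pos)
      from cl[OF this] show ?thesis by simp
    qed
    show ?thesis unfolding ln_Gamma_series_def by (simp add: 1 2 cl[OF assms])
  qed
  have "(\<lambda>n. cnj (ln_Gamma_series z n)) \<longlonglongrightarrow> cnj (ln_Gamma z)"
    by (intro tendsto_cnj ln_Gamma_complex_LIMSEQ np assms)
  moreover have "(\<lambda>n. cnj (ln_Gamma_series z n)) \<longlonglongrightarrow> ln_Gamma (cnj z)"
  proof (rule Lim_transform_eventually)
    show "ln_Gamma_series (cnj z) \<longlonglongrightarrow> ln_Gamma (cnj z)"
      by (rule ln_Gamma_complex_LIMSEQ[OF np]) (use assms in simp)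
    show "\<forall>\<^sub>F n in sequentially. ln_Gamma_series (cnj z) n = cnj (ln_Gamma_series z n)"
      using eventually_gt_at_top[of "0::nat"] by eventually_elim (rule ser)
  qed
  ultimately show ?thesis by (rule LIMSEQ_unique[symmetric])
qed

lemma cnj_Digamma:
  assumes "z \<noteq> 0"
  shows "Digamma (cnj z) = cnj (Digamma z)"
proof -
  have "(\<lambda>m. cnj (of_real (ln (real m)) - (\<Sum>n<m. inverse (z + of_nat n)))) \<longlonglongrightarrow> cnj (Digamma z)"
    by (intro tendsto_cnj Digamma_LIMSEQ assms)
  moreover have "(\<lambda>m. cnj (of_real (ln (real m)) - (\<Sum>n<m. inverse (z + of_nat n)))) \<longlonglongrightarrow> Digamma (cnj z)"
    using Digamma_LIMSEQ[of "cnj z"] assms by simp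
  ultimately show ?thesis by (rule LIMSEQ_unique[symmetric])
qed

text \<open>A holomorphic logarithm of \<open>hardy_h\<close> on \<open>Re s > 0\<close>; its
  imaginary part on the critical line is a continuous argument that vanishes at
  \<open>t = 0\<close>.\<close>

definition ln_hardy_h :: "complex \<Rightarrow> complex" where
  "ln_hardy_h s = ln_Gamma (s / 2) - s / 2 * of_real (ln pi)"

lemma nonpos_Reals_half: "Re s > 0 \<Longrightarrow> s / 2 \<notin> \<real>\<^sub>\<le>\<^sub>0"
  by (auto simp: complex_nonpos_Reals_iff)

lemma ln_hardy_h_deriv:
  assumes "Re s > 0"
  shows "(ln_hardy_h has_field_derivative (Digamma (s / 2) - of_real (ln pi)) / 2) (at s)"
proof -
  have "((\<lambda>s. ln_Gamma (s / 2)) has_field_derivative Digamma (s / 2) * (1 / 2)) (at s)"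
    by (rule DERIV_chain2[where f = ln_Gamma and g = "\<lambda>s. s / 2",
          OF has_field_derivative_ln_Gamma_complex[OF nonpos_Reals_half[OF assms]]])
       (auto intro!: derivative_eq_intros)
  moreover have "((\<lambda>s. s / 2 * of_real (ln pi)) has_field_derivative of_real (ln pi) / 2) (at s)"
    by (auto intro!: derivative_eq_intros)
  ultimately have "((\<lambda>s. ln_Gamma (s / 2) - s / 2 * of_real (ln pi)) has_field_derivative
      Digamma (s / 2) * (1 / 2) - of_real (ln pi) / 2) (at s)"
    by (rule DERIV_diff)
  thus ?thesis unfolding ln_hardy_h_def by (simp add: diff_divide_distrib)
qed

lemma exp_ln_hardy_h:
  assumes "Re s > 0"
  shows "exp (ln_hardy_h s) = hardy_h s"
proof -
  have np: "s / 2 \<notin> \<int>\<^sub>\<le>\<^sub>0"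
    using nonpos_Reals_half[OF assms] nonpos_Ints_subset_nonpos_Reals by blast
  have "Ln (of_real pi) = of_real (ln pi)" by (simp add: Ln_of_real)
  hence "of_real pi powr (- s / 2) = exp (- (s / 2 * of_real (ln pi)))"
    by (simp add: powr_def)
  moreover have "Gamma (s / 2) = exp (ln_Gamma (s / 2))" using np by (simp add: Gamma_complex_altdef)
  moreover have "exp (ln_hardy_h s) = exp (ln_Gamma (s / 2)) * exp (- (s / 2 * of_real (ln pi)))"
    by (simp only: ln_hardy_h_def exp_add[symmetric] diff_conv_add_uminus)
  ultimately show ?thesis by (simp only: hardy_h_def mult.commute)
qed

lemma cnj_ln_hardy_h: "Re s > 0 \<Longrightarrow> ln_hardy_h (cnj s) = cnj (ln_hardy_h s)"
  using cnj_ln_Gamma[of "s / 2"] by (simp add: ln_hardy_h_def)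

lemma zeta_eq_xi:
  assumes "Re s > 0"
  shows "zeta s = xi s / (s * (s - 1)) * exp (- ln_hardy_h s)"
proof -
  have s0: "s \<noteq> 0" using assms by auto
  have np: "s / 2 \<notin> \<int>\<^sub>\<le>\<^sub>0"
    using nonpos_Reals_half[OF assms] nonpos_Ints_subset_nonpos_Reals by blast
  have r: "rGamma (s / 2 + 1) = 2 / s * rGamma (s / 2)"
  proof -
    have "2 / s * (s / 2 * y) = y" for y using s0 by simp
    thus ?thesis unfolding rGamma_plus1[of "s / 2", symmetric] by simp
  qed
  have "exp (ln_Gamma (s / 2)) = Gamma (s / 2)" using np by (simp add: Gamma_complex_altdef)
  hence "rGamma (s / 2) = exp (- ln_Gamma (s / 2))"
    by (simp add: rGamma_inverse_Gamma exp_minus)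
  hence "exp (s / 2 * of_real (ln pi)) * rGamma (s / 2) = exp (- ln_hardy_h s)"
    by (simp add: ln_hardy_h_def exp_add[symmetric])
  hence "zeta_num s = xi s / s * exp (- ln_hardy_h s)"
    unfolding zeta_num_def r by (simp add: mult_ac)
  thus ?thesis unfolding zeta_eq using s0 by (simp add: divide_divide_eq_left mult_ac)
qed

text \<open>Two continuous arguments differ by a continuous function with values in the integer
  multiples of \<open>2 * pi\<close>, hence by a constant, which the normalisation at 0 makes
  0.\<close>

lemma hardy_theta_eq: "hardy_theta t = Im (ln_hardy_h (Complex (1 / 2) t))"
proof -
  define \<phi> where "\<phi> = (\<lambda>t. Im (ln_hardy_h (Complex (1 / 2) t)))"
  define P where "P = (\<lambda>\<theta>. continuous_on UNIV \<theta> \<and>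
      (\<forall>t. is_Arg (hardy_h (Complex (1/2) t)) (\<theta> t)) \<and> \<theta> 0 = (0::real))"
  have c: "continuous_on UNIV \<phi>"
  proof -
    have "isCont (\<lambda>t. ln_hardy_h (Complex (1 / 2) t)) t" for t
    proof (rule isCont_o2[of t "\<lambda>t. Complex (1 / 2) t"])
      have "isCont (\<lambda>t. 1 / 2 + \<i> * of_real t) t" by (intro continuous_intros)
      moreover have "(\<lambda>t. 1 / 2 + \<i> * of_real t) = Complex (1 / 2)" by (rule ext) (simp add: complex_eq_iff)
      ultimately show "isCont (Complex (1 / 2)) t" by simp
      show "isCont ln_hardy_h (Complex (1 / 2) t)"
        by (rule DERIV_isCont[OF ln_hardy_h_deriv]) simp
    qed
    thus ?thesis unfolding \<phi>_def by (intro continuous_at_imp_continuous_on ballI isCont_Im) auto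
  qed
  have e: "exp (of_real (Re (ln_hardy_h (Complex (1/2) t)))) * exp (\<i> * of_real (\<phi> t)) = hardy_h (Complex (1/2) t)" for t
  proof -
    have "ln_hardy_h (Complex (1/2) t) = of_real (Re (ln_hardy_h (Complex (1/2) t))) + \<i> * of_real (\<phi> t)"
      unfolding \<phi>_def by (rule complex_eq)
    hence "exp (ln_hardy_h (Complex (1/2) t)) = exp (of_real (Re (ln_hardy_h (Complex (1/2) t)))) * exp (\<i> * of_real (\<phi> t))"
      by (metis exp_add)
    thus ?thesis using exp_ln_hardy_h[of "Complex (1/2) t"] by simp
  qed
  have n: "norm (hardy_h (Complex (1/2) t)) = exp (Re (ln_hardy_h (Complex (1/2) t)))" for t
    unfolding e[symmetric] by (simp add: norm_mult)
  have ar: "is_Arg (hardy_h (Complex (1/2) t)) (\<phi> t)" for t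
    unfolding is_Arg_def n using e[of t] by (simp add: exp_of_real)
  have z: "\<phi> 0 = 0"
  proof -
    have c: "Complex (1/2) 0 / 2 = of_real (1/4)" by (simp add: complex_eq_iff)
    have g: "ln_Gamma (of_real (1/4)) = complex_of_real (ln_Gamma (1/4))" by (rule ln_Gamma_complex_of_real) simp
    show ?thesis unfolding \<phi>_def ln_hardy_h_def c g by simp
  qed
  have P: "P \<phi>" unfolding P_def using c ar z by blast
  have uniq: "\<theta> = \<phi>" if "P \<theta>" for \<theta>
  proof -
    have \<theta>: "continuous_on UNIV \<theta>" "\<And>t. is_Arg (hardy_h (Complex (1/2) t)) (\<theta> t)" "\<theta> 0 = 0"
      using that by (auto simp: P_def)
    have h0: "hardy_h (Complex (1/2) t) \<noteq> 0" for t using n[of t] by auto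
    have ei: "exp (\<i> * of_real (\<theta> t)) = exp (\<i> * of_real (\<phi> t))" for t
      using \<theta>(2)[of t] ar[of t] h0[of t] unfolding is_Arg_def
      by (metis mult_left_cancel norm_eq_zero of_real_eq_0_iff)
    have int: "\<exists>k::int. \<theta> t - \<phi> t = 2 * pi * of_int k" for t
    proof -
      obtain k :: int where "\<i> * of_real (\<theta> t) = \<i> * of_real (\<phi> t) + (of_int (2 * k) * pi) * \<i>"
        using ei[of t] unfolding exp_eq by blast
      hence "Im (\<i> * of_real (\<theta> t)) = Im (\<i> * of_real (\<phi> t) + (of_int (2 * k) * pi) * \<i>)" by simp
      hence "\<theta> t = \<phi> t + 2 * of_int k * pi" by simp
      thus ?thesis by (intro exI[of _ k]) simp
    qed
    have "(\<lambda>t. \<theta> t - \<phi> t) constant_on UNIV"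
    proof (rule continuous_discrete_range_constant)
      show "continuous_on UNIV (\<lambda>t. \<theta> t - \<phi> t)" by (intro continuous_intros \<theta> c)
      fix x :: real
      show "\<exists>e>0. \<forall>y. y \<in> UNIV \<and> \<theta> y - \<phi> y \<noteq> \<theta> x - \<phi> x \<longrightarrow> e \<le> norm (\<theta> y - \<phi> y - (\<theta> x - \<phi> x))"
      proof (intro exI[of _ "2 * pi"] conjI allI impI)
        fix y assume y: "y \<in> UNIV \<and> \<theta> y - \<phi> y \<noteq> \<theta> x - \<phi> x"
        obtain j k :: int where jk: "\<theta> x - \<phi> x = 2 * pi * of_int j" "\<theta> y - \<phi> y = 2 * pi * of_int k"
          using int by metis
        hence "j \<noteq> k" using y by auto
        hence "1 \<le> \<bar>k - j\<bar>" by linarith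
        hence "1 \<le> \<bar>real_of_int (k - j)\<bar>" by linarith
        hence "2 * pi * 1 \<le> 2 * pi * \<bar>real_of_int (k - j)\<bar>" by (intro mult_left_mono) auto
        also have "\<dots> = norm (\<theta> y - \<phi> y - (\<theta> x - \<phi> x))"
          unfolding jk right_diff_distrib[symmetric] of_int_diff[symmetric] by (simp add: abs_mult)
        finally show "2 * pi \<le> norm (\<theta> y - \<phi> y - (\<theta> x - \<phi> x))" by simp
      qed simp
    qed simp
    then obtain c where "\<And>t. \<theta> t - \<phi> t = c" unfolding constant_on_def by auto
    from this[of 0] this show ?thesis using \<theta>(3) z by auto
  qed
  have "(THE \<theta>. P \<theta>) = \<phi>" by (rule the_equality[of P \<phi>, OF P uniq])
  hence "hardy_theta = \<phi>" unfolding hardy_theta_def P_def .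
  from fun_cong[OF this, of t] show ?thesis by (simp only: \<phi>_def)
qed

text \<open>On the real axis let \<open>l = ln_hardy_h s\<close> with
  \<open>s = 1 / 2 + \<i> * t\<close>. The phase \<open>exp (\<i> * Im l)\<close> times the factor
  \<open>exp (- l)\<close> from \<open>zeta_eq_xi\<close> is \<open>exp (- (l + cnj l) / 2)\<close>,
  and replacing \<open>cnj l\<close> by the value at \<open>1 / 2 - \<i> * t\<close> makes this
  holomorphic in \<open>t\<close>. The denominator is \<open>s * (s - 1)\<close>.\<close>

definition Z_factor :: "complex \<Rightarrow> complex" where
  "Z_factor t = exp (- (ln_hardy_h (1 / 2 + \<i> * t) + ln_hardy_h (1 / 2 - \<i> * t)) / 2) / - (t\<^sup>2 + 1 / 4)"

definition Z_ext :: "complex \<Rightarrow> complex" where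
  "Z_ext t = Xi t * Z_factor t"

lemma hardy_Z_eq: "hardy_Z x = Z_ext (of_real x)"
proof -
  define s where "s = Complex (1 / 2) x"
  define l where "l = ln_hardy_h s"
  have s: "1 / 2 + \<i> * of_real x = s" "1 / 2 - \<i> * of_real x = cnj s" by (simp_all add: s_def complex_eq_iff)
  have rs: "Re s > 0" by (simp add: s_def)
  have l: "ln_hardy_h (cnj s) = cnj l" using cnj_ln_hardy_h[OF rs] by (simp add: l_def)
  have "(of_real x)\<^sup>2 + 1 / 4 = - (s * (s - 1))"
    by (simp add: s_def complex_eq_iff power2_eq_square algebra_simps)
  hence q: "- ((of_real x)\<^sup>2 + 1 / 4) = s * (s - 1)" by simp
  have "hardy_Z x = exp (\<i> * of_real (Im l)) * (xi s / (s * (s - 1)) * exp (- l))"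
    unfolding hardy_Z_def hardy_theta_eq s_def[symmetric] zeta_eq_xi[OF rs] l_def ..
  also have "\<dots> = xi s / (s * (s - 1)) * exp (\<i> * of_real (Im l) - l)"
    by (simp add: exp_diff exp_minus divide_inverse mult_ac)
  also have "\<i> * of_real (Im l) - l = - (l + cnj l) / 2"
    by (simp add: complex_eq_iff)
  finally show ?thesis unfolding Z_ext_def Z_factor_def Xi_def s l q by (simp add: l_def)
qed

lemma Z_factor_deriv:
  assumes t: "t \<in> strip (1 / 4)"
  shows "(Z_factor has_field_derivative Z_factor t *
     (- (\<i> / 4) * (Digamma ((1 / 2 + \<i> * t) / 2) - Digamma ((1 / 2 - \<i> * t) / 2)) - 2 * t / (t\<^sup>2 + 1 / 4))) (at t)"
    and "t\<^sup>2 + 1 / 4 \<noteq> 0"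
proof -
  have im: "\<bar>Im t\<bar> < 1 / 4" using t by (simp add: strip_def)
  have fac: "t\<^sup>2 + 1 / 4 = (t - \<i> / 2) * (t + \<i> / 2)" by (simp add: power2_eq_square algebra_simps)
  show nz: "t\<^sup>2 + 1 / 4 \<noteq> 0"
  proof -
    have "Im (t - \<i> / 2) \<noteq> 0" "Im (t + \<i> / 2) \<noteq> 0" using im by auto
    hence "t - \<i> / 2 \<noteq> 0" "t + \<i> / 2 \<noteq> 0" by fastforce+
    thus ?thesis unfolding fac by simp
  qed
  define a b where "a = Digamma ((1 / 2 + \<i> * t) / 2)" and "b = Digamma ((1 / 2 - \<i> * t) / 2)"
  have d1: "((\<lambda>t. ln_hardy_h (1 / 2 + \<i> * t)) has_field_derivative (a - of_real (ln pi)) / 2 * \<i>) (at t)"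
    unfolding a_def by (rule DERIV_chain2[where f = ln_hardy_h and g = "\<lambda>t. 1 / 2 + \<i> * t", OF ln_hardy_h_deriv])
       (use im in \<open>auto intro!: derivative_eq_intros\<close>)
  have d2: "((\<lambda>t. ln_hardy_h (1 / 2 - \<i> * t)) has_field_derivative (b - of_real (ln pi)) / 2 * (- \<i>)) (at t)"
    unfolding b_def by (rule DERIV_chain2[where f = ln_hardy_h and g = "\<lambda>t. 1 / 2 - \<i> * t", OF ln_hardy_h_deriv])
       (use im in \<open>auto intro!: derivative_eq_intros\<close>)
  define E where "E = (\<lambda>t. exp (- (ln_hardy_h (1 / 2 + \<i> * t) + ln_hardy_h (1 / 2 - \<i> * t)) / 2))"
  have dE: "(E has_field_derivative E t * (- (\<i> / 4) * (a - b))) (at t)"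
  proof -
    have "((\<lambda>t. - (ln_hardy_h (1 / 2 + \<i> * t) + ln_hardy_h (1 / 2 - \<i> * t)) / 2) has_field_derivative
       - ((a - of_real (ln pi)) / 2 * \<i> + (b - of_real (ln pi)) / 2 * (- \<i>)) / 2) (at t)"
      by (intro DERIV_cdivide DERIV_minus DERIV_add d1 d2)
    from DERIV_chain2[where f = exp, OF DERIV_exp this]
    have "(E has_field_derivative E t * (- ((a - of_real (ln pi)) / 2 * \<i> + (b - of_real (ln pi)) / 2 * (- \<i>)) / 2)) (at t)"
      unfolding E_def .
    moreover have "- ((a - of_real (ln pi)) / 2 * \<i> + (b - of_real (ln pi)) / 2 * (- \<i>)) / 2 = - (\<i> / 4) * (a - b)"
      by (simp add: field_simps)
    ultimately show ?thesis by simp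
  qed
  have dq: "((\<lambda>t::complex. - (t\<^sup>2 + 1 / 4)) has_field_derivative - (2 * t)) (at t)"
    by (auto intro!: derivative_eq_intros)
  have Zf: "Z_factor = (\<lambda>t. E t / - (t\<^sup>2 + 1 / 4))" by (rule ext) (simp only: Z_factor_def E_def)
  have D: "((\<lambda>t. E t / - (t\<^sup>2 + 1 / 4)) has_field_derivative
      ((E t * (- (\<i> / 4) * (a - b))) * (- (t\<^sup>2 + 1 / 4)) - E t * (- (2 * t))) / ((- (t\<^sup>2 + 1 / 4)) * (- (t\<^sup>2 + 1 / 4)))) (at t)"
    by (rule DERIV_divide[OF dE dq]) (simp only: neg_equal_0_iff_equal nz simp_thms)
  have gen: "((e * g) * (- q) - e * (- (2 * t))) / ((- q) * (- q)) = e / - q * (g - 2 * t / q)"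
    if "q \<noteq> 0" for e g q :: complex
    using that by (simp add: divide_simps) (simp add: algebra_simps)
  show "(Z_factor has_field_derivative Z_factor t *
     (- (\<i> / 4) * (Digamma ((1 / 2 + \<i> * t) / 2) - Digamma ((1 / 2 - \<i> * t) / 2)) - 2 * t / (t\<^sup>2 + 1 / 4))) (at t)"
    unfolding Zf a_def[symmetric] b_def[symmetric] using D unfolding gen[OF nz] .
qed

lemma Z_ext_holomorphic: "Z_ext holomorphic_on strip (1 / 4)"
proof -
  have "Z_factor holomorphic_on strip (1 / 4)"
    using Z_factor_deriv(1) unfolding holomorphic_on_open[OF open_strip] by blast
  thus ?thesis unfolding Z_ext_def by (intro holomorphic_intros Xi_holomorphic)
qed

lemma Z_ext_real: "Z_ext (of_real x) \<in> \<real>"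
proof -
  define s where "s = 1 / 2 + \<i> * of_real x"
  have s: "1 / 2 - \<i> * of_real x = cnj s" "Re s > 0" by (simp_all add: s_def complex_eq_iff)
  have "- (ln_hardy_h s + ln_hardy_h (cnj s)) / 2 = of_real (- Re (ln_hardy_h s))"
    unfolding cnj_ln_hardy_h[OF s(2)] by (simp add: complex_eq_iff)
  hence "Z_factor (of_real x) = exp (of_real (- Re (ln_hardy_h s))) / - (of_real x ^ 2 + 1 / 4)"
    unfolding Z_factor_def s(1) s_def[symmetric] by (simp only:)
  also have "\<dots> = of_real (exp (- Re (ln_hardy_h s)) / - (x ^ 2 + 1 / 4))"
    by (simp add: exp_of_real[symmetric])
  finally have "Z_factor (of_real x) \<in> \<real>" by (metis Reals_of_real)
  thus ?thesis unfolding Z_ext_def by (intro Reals_mult Xi_real)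
qed

text \<open>\<open>norm (z + k) \<ge> 1 / 8 + k\<close> gives a convergent majorant of the trigamma
  series. The points \<open>(1 / 2 \<plusminus> \<i> * t) / 2\<close> stay in this half plane for
  \<open>\<bar>Im t\<bar> < 1 / 4\<close>.\<close>

lemma Polygamma_1_bounded: "\<exists>K. \<forall>z::complex. Re z \<ge> 1 / 8 \<longrightarrow> norm (Polygamma 1 z) \<le> K"
proof (intro exI allI impI)
  fix z :: complex assume z: "Re z \<ge> 1 / 8"
  hence z0: "z \<noteq> 0" by auto
  have "Polygamma 1 z = (\<Sum>k. inverse ((z + of_nat k) ^ 2))"
    using sums_unique[OF Polygamma_LIMSEQ[OF z0, of 1]] by (simp add: numeral_2_eq_2)
  also have "norm \<dots> \<le> (\<Sum>k. inverse ((1 / 8 + real k) ^ 2))"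
  proof (rule norm_suminf_le)
    fix k
    have "1 / 8 + real k \<le> Re (z + of_nat k)" using z by simp
    also have "\<dots> \<le> norm (z + of_nat k)" by (rule complex_Re_le_cmod)
    finally show "norm (inverse ((z + of_nat k) ^ 2)) \<le> inverse ((1 / 8 + real k) ^ 2)"
      unfolding norm_inverse norm_power by (intro le_imp_inverse_le power_mono) (auto simp: add_pos_nonneg)
    show "summable (\<lambda>k. inverse ((1 / 8 + real k) ^ 2))" by (rule Polygamma_converges') auto
  qed
  finally show "norm (Polygamma 1 z) \<le> (\<Sum>k. inverse ((1 / 8 + real k) ^ 2))" .
qed

text \<open>By conjugation symmetry the two digamma values have real parts at points that differ by \<open>Im t\<close>
  only.\<close>

lemma Im_Z_factor_logderiv:
  "\<exists>C. \<forall>t. Re t > 1 \<longrightarrow> 0 < Im t \<longrightarrow> Im t < 1 / 4 \<longrightarrow>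
     Im (- (\<i> / 4) * (Digamma ((1 / 2 + \<i> * t) / 2) - Digamma ((1 / 2 - \<i> * t) / 2)) - 2 * t / (t\<^sup>2 + 1 / 4)) \<le> C * Im t"
proof -
  obtain K where K: "\<And>z::complex. Re z \<ge> 1 / 8 \<Longrightarrow> norm (Polygamma 1 z) \<le> K"
    using Polygamma_1_bounded by blast
  have "Im (- (\<i> / 4) * (Digamma ((1 / 2 + \<i> * t) / 2) - Digamma ((1 / 2 - \<i> * t) / 2)) - 2 * t / (t\<^sup>2 + 1 / 4))
      \<le> (K / 4 + 2) * Im t"
    if t: "Re t > 1" "0 < Im t" "Im t < 1 / 4" for t
  proof -
    define y where "y = Im t"
    define z where "z = (1 / 2 + \<i> * t) / 2"
    define z' where "z' = (1 / 2 - \<i> * t) / 2"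
    have cz: "cnj z' = z + of_real y" by (simp add: z_def z'_def y_def complex_eq_iff field_simps)
    have z'0: "z' \<noteq> 0" using t by (auto simp: z'_def complex_eq_iff)
    have "Re (Digamma z') = Re (Digamma (z + of_real y))"
      using cnj_Digamma[OF z'0] unfolding cz by simp
    moreover have "Im (- (\<i> / 4) * v) = - Re v / 4" for v by simp
    ultimately have "Im (- (\<i> / 4) * (Digamma z - Digamma z')) = Re (Digamma (z + of_real y) - Digamma z) / 4"
      by (simp only: minus_complex.simps minus_diff_eq)
    also have "\<dots> \<le> norm (Digamma (z + of_real y) - Digamma z) / 4"
      by (intro divide_right_mono complex_Re_le_cmod) auto
    \<comment> \<open>The mean value inequality on a horizontal segment of length
      \<open>Im t\<close>, with the trigamma bound.\<close>
    also have "norm (Digamma (z + of_real y) - Digamma z) \<le> K * norm (z + of_real y - z)"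
    proof (rule field_differentiable_bound[of "{z. Re z \<ge> 1 / 8}" Digamma "Polygamma 1"])
      show "convex {z. Re z \<ge> 1 / 8}" by (rule convex_halfspace_Re_ge)
      fix w :: complex assume w: "w \<in> {z. Re z \<ge> 1 / 8}"
      have "w \<notin> \<int>\<^sub>\<le>\<^sub>0" using w by (auto elim!: nonpos_Ints_cases)
      from has_field_derivative_Polygamma[OF this, of 0]
      show "(Digamma has_field_derivative Polygamma 1 w) (at w within {z. Re z \<ge> 1 / 8})"
        by (simp add: has_field_derivative_at_within)
      show "norm (Polygamma 1 w) \<le> K" using K w by simp
    qed (use t in \<open>simp_all add: z_def y_def field_simps\<close>)
    also have "norm (z + of_real y - z) = y" using t by (simp add: y_def)
    finally have 1: "Im (- (\<i> / 4) * (Digamma z - Digamma z')) \<le> K / 4 * Im t" by (simp add: y_def)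
    have p: "2 * t / (t\<^sup>2 + 1 / 4) = 1 / (t - \<i> / 2) + 1 / (t + \<i> / 2)"
    proof -
      have fac: "t\<^sup>2 + 1 / 4 = (t - \<i> / 2) * (t + \<i> / 2)" by (simp add: power2_eq_square algebra_simps)
      have "t - \<i> / 2 \<noteq> 0" "t + \<i> / 2 \<noteq> 0" using t by (auto simp: complex_eq_iff)
      thus ?thesis unfolding fac by (simp add: divide_simps)
    qed
    define x where "x = Re t"
    define A B where "A = x\<^sup>2 + (y - 1 / 2)\<^sup>2" and "B = x\<^sup>2 + (y + 1 / 2)\<^sup>2"
    have x1: "x\<^sup>2 \<ge> 1" using t(1) by (simp add: x_def)
    have AB: "A \<ge> x\<^sup>2" "B \<ge> x\<^sup>2" "A > 0" "B > 0" "A * B > 0"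
      using x1 by (auto simp: A_def B_def intro!: add_pos_nonneg mult_pos_pos)
    have Im_inv: "Im (1 / u) = - (Im u / ((Re u)\<^sup>2 + (Im u)\<^sup>2))" for u
      by (simp add: Im_divide)
    \<comment> \<open>The two terms cancel at \<open>y = 0\<close>, so their sum carries a factor
      \<open>y\<close>.\<close>
    have "Im (- (2 * t / (t\<^sup>2 + 1 / 4))) = (y - 1 / 2) / A + (y + 1 / 2) / B"
      by (simp only: p uminus_complex.simps plus_complex.simps Im_inv)
         (simp add: A_def B_def x_def y_def)
    also have "\<dots> = (2 * y * (x\<^sup>2 + (y\<^sup>2 - 1 / 4))) / (A * B)"
      using AB by (simp add: add_frac_eq) (simp add: A_def B_def power2_eq_square algebra_simps)
    also have "\<dots> \<le> (2 * y * x\<^sup>2) / (A * B)"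
    proof (intro divide_right_mono mult_left_mono)
      have "y\<^sup>2 \<le> (1 / 4)\<^sup>2" using t by (intro power_mono) (auto simp: y_def)
      thus "x\<^sup>2 + (y\<^sup>2 - 1 / 4) \<le> x\<^sup>2" by (simp add: power2_eq_square)
    qed (use t AB in \<open>auto simp: y_def\<close>)
    also have "\<dots> \<le> (2 * y * x\<^sup>2) / (1 * x\<^sup>2)"
      using AB x1 t by (intro divide_left_mono mult_mono mult_pos_pos) (auto simp: y_def)
    also have "\<dots> = 2 * Im t" using t(1) by (simp add: y_def x_def)
    finally have 2: "Im (- (2 * t / (t\<^sup>2 + 1 / 4))) \<le> 2 * Im t" .
    show ?thesis using 1 2 unfolding z_def z'_def by (simp add: algebra_simps)
  qed
  thus ?thesis by blast
qed

lemma Z_ext_logderiv_decays: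
  assumes riemann_hypothesis
  shows "logderiv_decays Z_ext (1 / 4)"
proof -
  obtain C where C: "\<And>t. Re t > 1 \<Longrightarrow> 0 < Im t \<Longrightarrow> Im t < 1 / 4 \<Longrightarrow>
     Im (- (\<i> / 4) * (Digamma ((1 / 2 + \<i> * t) / 2) - Digamma ((1 / 2 - \<i> * t) / 2)) - 2 * t / (t\<^sup>2 + 1 / 4)) \<le> C * Im t"
    using Im_Z_factor_logderiv by blast
  \<comment> \<open>The decay of \<open>Xi\<close> is restricted to the strip in which
    \<open>Z_factor\<close> is under control.\<close>
  have Xi: "logderiv_decays Xi (1 / 4)"
    unfolding logderiv_decays_def
  proof
    fix L
    obtain X where "\<forall>z. X < Re z \<and> 0 < Im z \<and> Im z < 5 / 2 \<longrightarrow> Xi z \<noteq> 0 \<and> Im (deriv Xi z / Xi z) \<le> - L * Im z"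
      using Xi_logderiv_decays[OF assms] unfolding logderiv_decays_def by blast
    thus "\<exists>X. \<forall>z. X < Re z \<and> 0 < Im z \<and> Im z < 1 / 4 \<longrightarrow> Xi z \<noteq> 0 \<and> Im (deriv Xi z / Xi z) \<le> - L * Im z"
      by (intro exI[of _ X] allI impI) simp
  qed
  have Z: "Z_ext = (\<lambda>t. Xi t * Z_factor t)" by (rule ext) (rule Z_ext_def)
  show ?thesis unfolding Z
  proof (rule logderiv_decays_mult_exp[OF Xi Xi_holomorphic, of 1])
    fix t assume t: "1 < Re t" "0 < Im t" "Im t < 1 / 4"
    have ts: "t \<in> strip (1 / 4)" using t by (simp add: strip_def)
    have nz: "Z_factor t \<noteq> 0"
      using Z_factor_deriv(2)[OF ts]
      unfolding Z_factor_def divide_eq_0_iff neg_equal_0_iff_equal by (simp only: exp_not_eq_zero simp_thms)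
    define g where "g = - (\<i> / 4) * (Digamma ((1 / 2 + \<i> * t) / 2) - Digamma ((1 / 2 - \<i> * t) / 2)) - 2 * t / (t\<^sup>2 + 1 / 4)"
    have "Z_factor t * g / Z_factor t = g" using nz by simp
    thus "Z_factor t \<noteq> 0 \<and> Im (Z_factor t *
       (- (\<i> / 4) * (Digamma ((1 / 2 + \<i> * t) / 2) - Digamma ((1 / 2 - \<i> * t) / 2)) - 2 * t / (t\<^sup>2 + 1 / 4)) / Z_factor t) \<le> C * Im t"
      using nz C[OF t] unfolding g_def by metis
  qed (rule Z_factor_deriv(1))
qed

section \<open>Passage to higher derivatives\<close>

lemma strip_quarter_power: "strip (1 / 4 / 4 ^ n) \<subseteq> strip (1 / 4)"
proof -
  have "(1 / 4 / 4 ^ n :: real) \<le> 1 / 4"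
    using divide_left_mono[of 1 "4 ^ n" "1 / 4 :: real"] by simp
  thus ?thesis unfolding strip_def by (intro Collect_mono impI) (erule (1) order_less_le_trans)
qed

text \<open>Holomorphy and reality persist on the full strip; only the strip of decay shrinks, by a
  factor 4 per derivative.\<close>

lemma higher_deriv_strip:
  assumes rh: riemann_hypothesis
  shows "(deriv ^^ n) Z_ext holomorphic_on strip (1 / 4) \<and> (\<forall>x::real. (deriv ^^ n) Z_ext (of_real x) \<in> \<real>) \<and>
     logderiv_decays ((deriv ^^ n) Z_ext) (1 / 4 / 4 ^ n)"
proof (induction n)
  case 0
  show ?case using Z_ext_holomorphic Z_ext_real Z_ext_logderiv_decays[OF rh] by simp
next
  case (Suc n)
  let ?F = "(deriv ^^ n) Z_ext"
  have hol: "?F holomorphic_on strip (1 / 4)" and re: "\<And>x::real. ?F (of_real x) \<in> \<real>"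
    and dec: "logderiv_decays ?F (1 / 4 / 4 ^ n)" using Suc.IH by auto
  have "strip (1 / 4 / 4 ^ n) \<subseteq> strip (1 / 4)"
    by (rule strip_quarter_power)
  hence hol': "?F holomorphic_on strip (1 / 4 / 4 ^ n)" by (rule holomorphic_on_subset[OF hol])
  have "deriv ?F holomorphic_on strip (1 / 4)" by (intro holomorphic_deriv hol open_strip)
  moreover have "deriv ?F (of_real x) \<in> \<real>" for x :: real
    by (rule deriv_real_on_reals[OF open_strip hol re]) (simp add: strip_def)
  moreover have "logderiv_decays (deriv ?F) (1 / 4 / 4 ^ n / 4)"
    by (rule logderiv_decays_deriv[OF _ hol' re dec]) simp
  ultimately show ?case by (simp add: field_simps)
qed

text \<open>Restricted to the real axis, a holomorphic function has its complex derivative as vector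
  derivative, so the two iterations agree.\<close>

lemma hardy_Z_deriv_eq: "hardy_Z_deriv n x = (deriv ^^ n) Z_ext (of_real x)"
proof (induction n arbitrary: x)
  case 0
  show ?case by (simp add: hardy_Z_deriv_def hardy_Z_eq)
next
  case (Suc n)
  have hol: "(deriv ^^ n) Z_ext holomorphic_on strip (1 / 4)"
    by (intro holomorphic_higher_deriv Z_ext_holomorphic open_strip)
  have eq: "hardy_Z_deriv n = (\<lambda>x. (deriv ^^ n) Z_ext (of_real x))" by (rule ext) (rule Suc.IH)
  have "((deriv ^^ n) Z_ext has_field_derivative deriv ((deriv ^^ n) Z_ext) (of_real x)) (at (of_real x))"
    by (rule holomorphic_derivI[OF hol open_strip]) (simp add: strip_def)
  hence "((\<lambda>x. (deriv ^^ n) Z_ext (of_real x)) has_vector_derivative deriv ((deriv ^^ n) Z_ext) (of_real x)) (at x)"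
    by (rule has_vector_derivative_real_field)
  hence "vector_derivative (hardy_Z_deriv n) (at x) = deriv ((deriv ^^ n) Z_ext) (of_real x)"
    unfolding eq by (rule vector_derivative_at)
  moreover have "hardy_Z_deriv (Suc n) x = vector_derivative (hardy_Z_deriv n) (at x)"
    by (simp add: hardy_Z_deriv_def)
  ultimately show ?case by simp
qed

theorem theorem1p1:
  assumes "riemann_hypothesis"
  shows "\<forall>n::nat. n \<ge> 1 \<longrightarrow>
           (\<exists>T::real. T > 0 \<and>
              (\<forall>a b. T < a \<and> consecutive_zeros (hardy_Z_deriv n) a b \<longrightarrow>
                 (\<exists>!u. a < u \<and> u < b \<and> hardy_Z_deriv (n + 1) u = 0)))"
proof (intro allI impI)
  fix n :: nat
  let ?F = "(deriv ^^ n) Z_ext" and ?Y = "1 / 4 / 4 ^ n :: real"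
  have IH: "?F holomorphic_on strip (1 / 4)" "\<And>x::real. ?F (of_real x) \<in> \<real>" "logderiv_decays ?F ?Y"
    using higher_deriv_strip[OF assms, of n] by auto
  have "strip ?Y \<subseteq> strip (1 / 4)"
    by (rule strip_quarter_power)
  hence hol: "?F holomorphic_on strip ?Y" by (rule holomorphic_on_subset[OF IH(1)])
  have Y: "?Y > 0" by simp
  have "\<exists>T>0. \<forall>a b. T < a \<and> a < b \<and> ?F (of_real a) = 0 \<and> ?F (of_real b) = 0 \<and>
           (\<forall>x. a < x \<and> x < b \<longrightarrow> ?F (of_real x) \<noteq> 0) \<longrightarrow>
           (\<exists>!u. a < u \<and> u < b \<and> deriv ?F (of_real u) = 0)"
    by (rule unique_critical_point[OF Y hol IH(2,3)])
  thus "\<exists>T::real. T > 0 \<and> (\<forall>a b. T < a \<and> consecutive_zeros (hardy_Z_deriv n) a b \<longrightarrow>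
                 (\<exists>!u. a < u \<and> u < b \<and> hardy_Z_deriv (n + 1) u = 0))"
    by (simp add: consecutive_zeros_def hardy_Z_deriv_eq)
qed

end
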